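(* Let $\lambda=(\lambda_1,\lambda_2,\ldots)$ be a partition all of whose parts are even. The coefficients $A_\lambda$ (defined in the context) of the even split class sums in the top degree part of the elementary symmetric functions in the squares of the odd Jucys–Murphy elements are given by $$A_{2r}=-C_{r+1}\quad (r\ge 1),\qquad A_\lambda=A_{\lambda_1}A_{\lambda_2}\cdots=(-1)^{\ell(\lambda)}\prod_{i\ge1}C_{\frac{\lambda_i}{2}+1},$$ where the last product runs over the parts of $\lambda$, $A_{2r}$ denotes $A_{(2r)}$, and $C_{r+1}=\frac1{r+1}\binom{2r}{r}$ are the Catalan numbers.
   Context: Partitions: $|\lambda|$ is the sum of the parts of $\lambda$, $\ell(\lambda)$ the number of parts. $\mathcal{EP}$ is the set of partitions all of whose parts are even (including $\emptyset$), and $\mathcal{EP}(m)$ those with $|\lambda|=m$. Double cover: $\widetilde S_n$ is the group generated by $t_1,\dots,t_{n-1},z$ with relations: $z$ central, $z^2=1$, $t_i^2=z$, $t_it_{i+1}t_i=t_{i+1}t_it_{i+1}$, $t_jt_i=zt_it_j$ for $|i-j|>1$. There are natural embeddings $\widetilde S_n\subset\widetilde S_{n+1}$. Cycles: in $\widetilde S_{n+1}$ put $x_i=t_it_{i+1}\cdots t_{n-1}t_nt_{n-1}\cdots t_{i+1}t_i$ for $1\le i\le n$ (so $x_n=t_n$). For distinct $i_1,\dots,i_m\in\{1,\dots,n\}$ with $m\ge2$ put $[i_1,\dots,i_m]=x_{i_1}x_{i_m}x_{i_{m-1}}\cdots x_{i_2}x_{i_1}$. This element lies in $\widetilde S_n$,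 does not depend on $n$, and maps to the cycle $(i_1,\dots,i_m)$ under $\widetilde S_n\to S_n$, $t_i\mapsto(i,i+1)$, $z\mapsto 1$ (permutations multiplied right to left). Classes: for $\lambda=(\lambda_1,\dots,\lambda_\ell)\in\mathcal{EP}$, $D_\lambda(n)$ is the set of all products of disjoint cycles $[i_1,\dots,i_{\lambda_1+1}][j_1,\dots,j_{\lambda_2+1}]\cdots[k_1,\dots,k_{\lambda_\ell+1}]$ in $\widetilde S_n$; it is empty if $|\lambda|+\ell(\lambda)>n$, and a conjugacy class of $\widetilde S_n$ otherwise. Spin group algebra: $\mathbb ZS_n^-=\mathbb Z\widetilde S_n/\langle z+1\rangle$, a superalgebra with every $t_i$ odd; $\mathcal Z_n$ is its even center (the set of even central elements). $d_\lambda(n)\in\mathbb ZS_n^-$ is the image of the class sum of $D_\lambda(n)$. The $d_\lambda(n)$ with $\lambda\in\mathcal{EP}$, $|\lambda|+\ell(\lambda)\le n$, form a basis of $\mathcal Z_n$. Odd Jucys–Murphy elements: $M_k=\sum_{i=1}^{k-1}[i,k]\in\mathbb ZS_n^-$ for $1\le k\le n$. The element $e_{r;n}=\sum_{1\le i_1<\cdots<i_r\le n}M_{i_1}^2M_{i_2}^2\cdots M_{i_r}^2$ lies in $\mathcal Z_n$. For $\lambda\in\mathcal{EP}(2r)$, $A_\lambda$ denotes the coefficient of $d_\lambda(n)$ in the expansion of $e_{r;n}$ in the basis $\{d_\mu(n) : \mu\in\mathcal{EP},\ |\mu|+\ell(\mu)\le n\}$ of $\mathcal Z_n$, for any $n\ge|\lambda|+\ell(\lambda)$;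 it does not depend on $n$. (By convention $e_{0;n}=1$.) *)

theory Defs
  imports "HOL-Algebra.QuotRing" Complex_Main
begin

section \<open>Partitions with even parts\<close>

text \<open>A partition is the weakly decreasing list of its parts, so \<open>sum_list\<close> is
  the size and \<open>length\<close> the number of parts.\<close>

definition partition :: "nat list \<Rightarrow> bool" where
  "partition p \<longleftrightarrow> sorted_wrt (\<ge>) p \<and> 0 \<notin> set p"

definition EP :: "nat list set" where
  "EP = {p. partition p \<and> (\<forall>k\<in>set p. even k)}"

definition EP_upto :: "nat \<Rightarrow> nat list set" where
  "EP_upto n = {p \<in> EP. sum_list p + length p \<le> n}"


section \<open>Groups given by generators and relations\<close>

text \<open>The letter \<open>(x, True)\<close> stands for the generator \<open>x\<close> and \<open>(x, False)\<close> for its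
  formal inverse.\<close>

type_synonym 'a gword = "('a \<times> bool) list"

inductive pres_eq :: "'a set \<Rightarrow> ('a gword \<times> 'a gword) set \<Rightarrow> 'a gword \<Rightarrow> 'a gword \<Rightarrow> bool"
  for X :: "'a set" and R :: "('a gword \<times> 'a gword) set"
where
  refl: "w \<in> lists (X \<times> UNIV) \<Longrightarrow> pres_eq X R w w"
| sym: "pres_eq X R u v \<Longrightarrow> pres_eq X R v u"
| trans: "pres_eq X R u v \<Longrightarrow> pres_eq X R v w \<Longrightarrow> pres_eq X R u w"
| mult: "pres_eq X R u v \<Longrightarrow> pres_eq X R u' v' \<Longrightarrow> pres_eq X R (u @ u') (v @ v')"
| cancel: "x \<in> X \<Longrightarrow> pres_eq X R [(x, b), (x, \<not> b)] []"
| rel: "(u, v) \<in> R \<Longrightarrow> pres_eq X R u v"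

definition pres_class :: "'a set \<Rightarrow> ('a gword \<times> 'a gword) set \<Rightarrow> 'a gword \<Rightarrow> 'a gword set" where
  "pres_class X R w = {v. pres_eq X R w v}"

text \<open>The group with generators \<open>X\<close> and relations \<open>u = v\<close> for \<open>(u, v) \<in> R\<close>, where \<open>R\<close>
  must consist of words over \<open>X\<close>.\<close>

definition pres_group :: "'a set \<Rightarrow> ('a gword \<times> 'a gword) set \<Rightarrow> 'a gword set monoid" where
  "pres_group X R =
    \<lparr> carrier = pres_class X R ` lists (X \<times> UNIV),
      mult = (\<lambda>A B. \<Union>u\<in>A. \<Union>v\<in>B. pres_class X R (u @ v)),
      one = pres_class X R [] \<rparr>"


section \<open>The double cover of the symmetric group\<close>

datatype spin_gen = Gen_t nat | Gen_z

abbreviation tw :: "nat \<Rightarrow> spin_gen gword" where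
  "tw i \<equiv> [(Gen_t i, True)]"

abbreviation zw :: "spin_gen gword" where
  "zw \<equiv> [(Gen_z, True)]"

definition spin_gens :: "nat \<Rightarrow> spin_gen set" where
  "spin_gens n = insert Gen_z (Gen_t ` {1..<n})"

definition spin_rels :: "nat \<Rightarrow> (spin_gen gword \<times> spin_gen gword) set" where
  "spin_rels n =
    {(zw @ tw i, tw i @ zw) | i. i \<in> {1..<n}} \<union>
    {(zw @ zw, [])} \<union>
    {(tw i @ tw i, zw) | i. i \<in> {1..<n}} \<union>
    {(tw i @ tw (i+1) @ tw i, tw (i+1) @ tw i @ tw (i+1)) | i. 1 \<le> i \<and> i + 1 < n} \<union>
    {(tw j @ tw i, zw @ tw i @ tw j) | i j.
        i \<in> {1..<n} \<and> j \<in> {1..<n} \<and> (i + 1 < j \<or> j + 1 < i)}"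

definition spin_group :: "nat \<Rightarrow> spin_gen gword set monoid" where
  "spin_group n = pres_group (spin_gens n) (spin_rels n)"

definition spin_class :: "nat \<Rightarrow> spin_gen gword \<Rightarrow> spin_gen gword set" where
  "spin_class n = pres_class (spin_gens n) (spin_rels n)"

text \<open>The natural embedding of \<open>spin_group n\<close> into \<open>spin_group (n+1)\<close>, which sends
  each generator to the generator of the same name.\<close>

definition spin_embed :: "nat \<Rightarrow> spin_gen gword set \<Rightarrow> spin_gen gword set" where
  "spin_embed n g = (\<Union>w\<in>g. spin_class (n+1) w)"


section \<open>Cycles and the even split classes\<close>

text \<open>\<open>x_word n i\<close> represents the element \<open>t_i \<dots> t_{n-1} t_n t_{n-1} \<dots> t_i\<close> of
  \<open>spin_group (n+1)\<close>.\<close>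

definition x_word :: "nat \<Rightarrow> nat \<Rightarrow> spin_gen gword" where
  "x_word n i = concat (map tw [i..<n]) @ tw n @ concat (map tw (rev [i..<n]))"

definition cycle_word :: "nat \<Rightarrow> nat list \<Rightarrow> spin_gen gword" where
  "cycle_word n is = x_word n (hd is) @ concat (map (x_word n) (rev is))"

text \<open>The word above lives one level up; the cycle is its preimage under the embedding.\<close>

definition spin_cycle :: "nat \<Rightarrow> nat list \<Rightarrow> spin_gen gword set" where
  "spin_cycle n is = (THE g. g \<in> carrier (spin_group n) \<and>
      spin_embed n g = spin_class (n+1) (cycle_word n is))"

definition D_class :: "nat list \<Rightarrow> nat \<Rightarrow> spin_gen gword set set" where
  "D_class p n =
    {foldr (mult (spin_group n)) (map (spin_cycle n) cs) (one (spin_group n)) | cs.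
       map length cs = map Suc p \<and> distinct (concat cs) \<and> set (concat cs) \<subseteq> {1..n}}"


section \<open>The spin group algebra\<close>

definition int_group_ring :: "('a, 'b) monoid_scheme \<Rightarrow> ('a \<Rightarrow> int) ring" where
  "int_group_ring G =
    \<lparr> carrier = {f. finite {x. f x \<noteq> 0} \<and> {x. f x \<noteq> 0} \<subseteq> carrier G},
      mult = (\<lambda>f g x. \<Sum>(u, v) \<in> {(u, v). f u \<noteq> 0 \<and> g v \<noteq> 0 \<and> u \<otimes>\<^bsub>G\<^esub> v = x}. f u * g v),
      one = (\<lambda>x. if x = \<one>\<^bsub>G\<^esub> then 1 else 0),
      zero = (\<lambda>x. 0),
      add = (\<lambda>f g x. f x + g x) \<rparr>"

definition set_sum :: "'a set \<Rightarrow> 'a \<Rightarrow> int" where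
  "set_sum A = (\<lambda>x. if x \<in> A then 1 else 0)"

definition spin_ideal :: "nat \<Rightarrow> (spin_gen gword set \<Rightarrow> int) set" where
  "spin_ideal n = (let ZG = int_group_ring (spin_group n)
     in Idl\<^bsub>ZG\<^esub> {set_sum {spin_class n zw} \<oplus>\<^bsub>ZG\<^esub> \<one>\<^bsub>ZG\<^esub>})"

definition spin_algebra :: "nat \<Rightarrow> (spin_gen gword set \<Rightarrow> int) set ring" where
  "spin_algebra n = int_group_ring (spin_group n) Quot spin_ideal n"

definition spin_proj :: "nat \<Rightarrow> (spin_gen gword set \<Rightarrow> int) \<Rightarrow> (spin_gen gword set \<Rightarrow> int) set" where
  "spin_proj n f = spin_ideal n +>\<^bsub>int_group_ring (spin_group n)\<^esub> f"

definition d_sum :: "nat list \<Rightarrow> nat \<Rightarrow> (spin_gen gword set \<Rightarrow> int) set" where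
  "d_sum p n = spin_proj n (set_sum (D_class p n))"


section \<open>Odd Jucys--Murphy elements\<close>

definition odd_JM :: "nat \<Rightarrow> nat \<Rightarrow> (spin_gen gword set \<Rightarrow> int) set" where
  "odd_JM n k = finsum (spin_algebra n) (\<lambda>i. spin_proj n (set_sum {spin_cycle n [i, k]})) {1..<k}"

text \<open>A sequence \<open>i_1 < \<dots> < i_r\<close> in \<open>{1..n}\<close> is encoded as the subset it enumerates.\<close>

definition elem_sym_JM :: "nat \<Rightarrow> nat \<Rightarrow> (spin_gen gword set \<Rightarrow> int) set" where
  "elem_sym_JM r n =
    finsum (spin_algebra n)
      (\<lambda>I. foldr (mult (spin_algebra n))
              (map (\<lambda>i. odd_JM n i [^]\<^bsub>spin_algebra n\<^esub> (2::nat)) (sorted_list_of_set I))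
              (one (spin_algebra n)))
      {I. I \<subseteq> {1..n} \<and> card I = r}"


section \<open>The coefficients\<close>

text \<open>The coordinates, with respect to the basis \<open>d_sum p n\<close> (\<open>p \<in> EP_upto n\<close>) of the even
  center, of an element \<open>a\<close> of the even center.\<close>

definition d_coords :: "nat \<Rightarrow> (spin_gen gword set \<Rightarrow> int) set \<Rightarrow> nat list \<Rightarrow> int" where
  "d_coords n a = (THE c. (\<forall>p. p \<notin> EP_upto n \<longrightarrow> c p = 0) \<and>
      a = finsum (spin_algebra n) (\<lambda>p. [c p] \<cdot>\<^bsub>spin_algebra n\<^esub> d_sum p n) (EP_upto n))"

text \<open>For \<open>p \<in> EP\<close> of size \<open>2 r\<close>, the coefficient of \<open>d_sum p n\<close> in \<open>elem_sym_JM r n\<close>.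
  Its independence of \<open>n \<ge> sum_list p + length p\<close> is not built in.\<close>

definition A_coeff :: "nat \<Rightarrow> nat list \<Rightarrow> int" where
  "A_coeff n p = d_coords n (elem_sym_JM (sum_list p div 2) n) p"

text \<open>The Catalan numbers, indexed from \<open>1\<close>: \<open>Cat (r + 1) = (2 r choose r) / (r + 1)\<close>.\<close>

definition Cat :: "nat \<Rightarrow> rat" where
  "Cat m = of_nat ((2 * (m - 1)) choose (m - 1)) / of_nat m"

end

theory Submission
  imports Defs "HOL-Combinatorics.Cycles" "HOL-Library.Poly_Mapping"
begin

text \<open>The double cover is realised in a Clifford algebra acting on functions on sets of naturals:
  \<open>t\<^sub>i\<close> acts as \<open>(c\<^sub>i - c\<^sub>i\<^sub>+\<^sub>1) / \<surd>2\<close> and \<open>z\<close> as \<open>- 1\<close>. Conjugation of the generators \<open>c\<^sub>i\<close> recovers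
  the underlying permutation, so a normal form modulo \<open>z\<close> shows that the action is faithful.

  Elementary symmetric functions in the \<open>M\<^sub>k\<^sup>2\<close> commute with every \<open>t\<^sub>i\<close>, hence their coefficients
  are constant on conjugacy classes, and they cancel modulo \<open>z + 1\<close> on every class outside
  \<open>\<plusminus>D\<^sub>\<lambda>\<close>: such an element is odd or is conjugate to its negative by one of its even-length cycles.
  In \<open>e\<^sub>r\<^sub>;\<^sub>n = e\<^sub>r\<^sub>;\<^sub>n\<^sub>-\<^sub>1 + e\<^sub>r\<^sub>-\<^sub>1\<^sub>;\<^sub>n\<^sub>-\<^sub>1 M\<^sub>n\<^sup>2\<close> a class element of top degree moving \<open>n\<close> only receives
  contributions that split the cycle through \<open>n\<close> into \<open>n\<close> and two cycles of odd length, each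
  with sign \<open>- 1\<close>. This is the Catalan recursion, and it leaves the other cycles untouched.\<close>

section \<open>A Clifford model of the double cover\<close>

text \<open>Relations alone never show that two words differ; even \<open>z\<close> being nontrivial
  needs a model, and the signs must be exact because the coefficients are signed. The operators
  \<open>tr a b\<close> do not depend on \<open>n\<close>, so the embeddings of the groups become
  inclusions and every sign comes from one conjugation rule. In the group algebra \<open>z\<close>
  stays a basis element \<open>gz\<close>, distinct from the scalar \<open>- 1\<close>. Centrality
  and support are proved there, and passing to the quotient only means reading off
  \<open>co a u - co a (- u)\<close>. Only products of odd-length cycles have a sign determined by
  their permutation, which is why the classes of even type survive. In top degree
  \<open>2 * r\<close> reflections must produce reflection length \<open>2 * r\<close>, so none of
  them may be wasted; this is enforced by counting invariant labellings of the points. Two weights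
  multiply to a positive product, and the sign of the cut makes it negative again.\<close>

definition linear_op :: "((nat set \<Rightarrow> real) \<Rightarrow> nat set \<Rightarrow> real) \<Rightarrow> bool" where
  "linear_op F \<longleftrightarrow> (\<forall>a b f g. F (\<lambda>S. a * f S + b * g S) = (\<lambda>S. a * F f S + b * F g S))"

lemma linear_opD: "linear_op F \<Longrightarrow> F (\<lambda>S. a * f S + b * g S) = (\<lambda>S. a * F f S + b * F g S)"
  unfolding linear_op_def by blast

lemma linear_opI:
  "(\<And>a b f g S. F (\<lambda>S. a * f S + b * g S) S = a * F f S + b * F g S) \<Longrightarrow> linear_op F"
  unfolding linear_op_def by blast

text \<open>Linearity is what makes left multiplication distribute over sums; real scalars are
  needed for the normalising factor \<open>1 / sqrt 2\<close> of the reflections.\<close>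

typedef lin_op = "{F. linear_op F}" morphisms app Lin_op
  by (rule exI[of _ "\<lambda>f. f"]) (simp add: linear_op_def)

lemma linear_op_add: "linear_op F \<Longrightarrow> F (\<lambda>S. f S + g S) = (\<lambda>S. F f S + F g S)"
  using linear_opD[of F 1 f 1 g] by simp

lemma linear_op_scale: "linear_op F \<Longrightarrow> F (\<lambda>S. r * f S) = (\<lambda>S. r * F f S)"
  using linear_opD[of F r f 0 f] by simp

setup_lifting type_definition_lin_op

instantiation lin_op :: real_algebra_1
begin

lift_definition zero_lin_op :: lin_op is "\<lambda>f S. 0"
  by (rule linear_opI) simp
lift_definition one_lin_op :: lin_op is "\<lambda>f. f"
  by (rule linear_opI) simp
lift_definition plus_lin_op :: "lin_op \<Rightarrow> lin_op \<Rightarrow> lin_op" is "\<lambda>F G f S. F f S + G f S"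
  by (rule linear_opI) (simp add: linear_opD algebra_simps)
lift_definition minus_lin_op :: "lin_op \<Rightarrow> lin_op \<Rightarrow> lin_op" is "\<lambda>F G f S. F f S - G f S"
  by (rule linear_opI) (simp add: linear_opD algebra_simps)
lift_definition uminus_lin_op :: "lin_op \<Rightarrow> lin_op" is "\<lambda>F f S. - F f S"
  by (rule linear_opI) (simp add: linear_opD algebra_simps)
lift_definition times_lin_op :: "lin_op \<Rightarrow> lin_op \<Rightarrow> lin_op" is "\<lambda>F G f. F (G f)"
  by (rule linear_opI) (simp add: linear_opD)
lift_definition scaleR_lin_op :: "real \<Rightarrow> lin_op \<Rightarrow> lin_op" is "\<lambda>r F f S. r * F f S"
  by (rule linear_opI) (simp add: linear_opD algebra_simps)

lemma app_add: "app u (\<lambda>S. f S + g S) = (\<lambda>S. app u f S + app u g S)"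
  and app_scale: "app u (\<lambda>S. r * f S) = (\<lambda>S. r * app u f S)"
  using linear_op_add[of "app u"] linear_op_scale[of "app u"] app[of u] by simp_all

instance
proof
  fix a b c :: lin_op and r s :: real
  show "a + b + c = a + (b + c)" by transfer (simp add: algebra_simps)
  show "a + b = b + a" by transfer (simp add: algebra_simps)
  show "0 + a = a" by transfer (simp add: algebra_simps)
  show "- a + a = 0" by transfer (simp add: algebra_simps)
  show "a - b = a + - b" by transfer (simp add: algebra_simps)
  show "a * b * c = a * (b * c)" by transfer (simp add: algebra_simps)
  show "(a + b) * c = a * c + b * c" by transfer (simp add: algebra_simps)
  show "a * (b + c) = a * b + a * c"
    by (simp only: app_inject[symmetric] times_lin_op.rep_eq plus_lin_op.rep_eq
        scaleR_lin_op.rep_eq app_add app_scale)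
  show "1 * a = a" by transfer (simp add: algebra_simps)
  show "a * 1 = a" by transfer (simp add: algebra_simps)
  show "r *\<^sub>R (a + b) = r *\<^sub>R a + r *\<^sub>R b" by transfer (simp add: algebra_simps)
  show "(r + s) *\<^sub>R a = r *\<^sub>R a + s *\<^sub>R a" by transfer (simp add: algebra_simps)
  show "r *\<^sub>R s *\<^sub>R a = (r * s) *\<^sub>R a" by transfer (simp add: algebra_simps)
  show "1 *\<^sub>R a = a" by transfer (simp add: algebra_simps)
  show "r *\<^sub>R a * b = r *\<^sub>R (a * b)" by transfer (simp add: algebra_simps)
  show "a * r *\<^sub>R b = r *\<^sub>R (a * b)"
  proof (rule app_inject[THEN iffD1], rule ext)
    fix f
    show "app (a * r *\<^sub>R b) f = app (r *\<^sub>R (a * b)) f"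
      unfolding times_lin_op.rep_eq scaleR_lin_op.rep_eq by (rule app_scale)
  qed
  have "(\<lambda>f S. 0) \<noteq> (\<lambda>f :: nat set \<Rightarrow> real. f)"
  proof
    assume "(\<lambda>f S. 0) = (\<lambda>f :: nat set \<Rightarrow> real. f)"
    from arg_cong[OF this, of "\<lambda>F. F (\<lambda>_. 1) {}"] show False by simp
  qed
  then show "(0 :: lin_op) \<noteq> 1" by transfer
qed

end

section \<open>Jordan-Wigner generators of the Clifford algebra\<close>

definition toggle :: "nat \<Rightarrow> nat set \<Rightarrow> nat set" where
  "toggle i S = (if i \<in> S then S - {i} else insert i S)"

text \<open>The power is the Jordan-Wigner sign, which makes different generators anticommute; the
  first factor makes each generator square to \<open>- 1\<close>. Infinite \<open>S\<close> cause no
  trouble, since only elements below \<open>i\<close> are counted.\<close>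

definition toggle_sgn :: "nat \<Rightarrow> nat set \<Rightarrow> real" where
  "toggle_sgn i S = (if i \<in> S then - 1 else 1) * (- 1) ^ card {j \<in> S. j < i}"

lift_definition clif :: "nat \<Rightarrow> lin_op" is "\<lambda>i f S. toggle_sgn i S * f (toggle i S)"
  by (rule linear_opI) (simp add: algebra_simps)

lemma toggle_toggle: "toggle i (toggle i S) = S"
  by (auto simp: toggle_def)

lemma toggle_commute: "toggle i (toggle j S) = toggle j (toggle i S)"
  by (auto simp: toggle_def)

lemma toggle_sgn_self: "toggle_sgn i (toggle i S) = - toggle_sgn i S"
proof -
  have "{j \<in> toggle i S. j < i} = {j \<in> S. j < i}" by (auto simp: toggle_def)
  then show ?thesis by (simp add: toggle_sgn_def) (simp add: toggle_def)
qed

lemma toggle_sgn_sq: "toggle_sgn i S * toggle_sgn i S = 1"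
  by (simp add: toggle_sgn_def flip: power_add mult_2)

lemma toggle_sgn_less:
  assumes "i < j"
  shows "toggle_sgn i (toggle j S) = toggle_sgn i S"
    and "toggle_sgn j (toggle i S) = - toggle_sgn j S"
proof -
  have "{k \<in> toggle j S. k < i} = {k \<in> S. k < i}" using assms by (auto simp: toggle_def)
  moreover have "i \<in> toggle j S \<longleftrightarrow> i \<in> S" using assms by (auto simp: toggle_def)
  ultimately show "toggle_sgn i (toggle j S) = toggle_sgn i S" by (simp add: toggle_sgn_def)
  have fin: "finite {k \<in> A. k < j}" for A by simp
  have "(- 1) ^ card {k \<in> toggle i S. k < j} = - ((- 1 :: real) ^ card {k \<in> S. k < j})"
  proof (cases "i \<in> S")
    case True
    then have "{k \<in> S. k < j} = insert i {k \<in> toggle i S. k < j}" "i \<notin> toggle i S"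
      using assms by (auto simp: toggle_def)
    then show ?thesis using fin by simp
  next
    case False
    then have "{k \<in> toggle i S. k < j} = insert i {k \<in> S. k < j}"
      using assms by (auto simp: toggle_def)
    then show ?thesis using fin False by simp
  qed
  moreover have "j \<in> toggle i S \<longleftrightarrow> j \<in> S" using assms by (auto simp: toggle_def)
  ultimately show "toggle_sgn j (toggle i S) = - toggle_sgn j S" by (simp add: toggle_sgn_def)
qed

lemma clif_sq [simp]: "clif i * clif i = - 1"
  by transfer
    (simp add: fun_eq_iff toggle_toggle toggle_sgn_self toggle_sgn_sq mult.assoc[symmetric])

lemma clif_anticommute:
  assumes "i \<noteq> j"
  shows "clif i * clif j = - (clif j * clif i)"
proof -
  have "clif i * clif j = - (clif j * clif i)" if "i < j" for i j
    using that by transfer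
      (simp add: fun_eq_iff toggle_sgn_less, metis toggle_commute)
  then show ?thesis using assms
    by (metis add.inverse_inverse linorder_neqE_nat)
qed

text \<open>Applied to the indicator function of the empty set, a multiple of \<open>clif i\<close>
  is supported at \<open>{i}\<close> alone, so index and scalar can be read off.\<close>

lemma clif_eqD:
  assumes "s *\<^sub>R clif a = t *\<^sub>R clif b" "s \<noteq> 0" "t \<noteq> 0"
  shows "a = b \<and> s = t"
proof -
  let ?f = "\<lambda>S :: nat set. if S = {} then 1 else 0 :: real"
  have "toggle i S = {} \<longleftrightarrow> S = {i}" for i S
    unfolding toggle_def by auto
  moreover have "toggle_sgn i {i} = - 1" for i
  proof -
    have "{j \<in> {i}. j < i} = {}" by blast
    then show ?thesis by (simp add: toggle_sgn_def del: Collect_empty_eq)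
  qed
  ultimately have *: "app (r *\<^sub>R clif i) ?f S = (if S = {i} then - r else 0)" for r i S
    by (simp add: scaleR_lin_op.rep_eq clif.rep_eq)
  have "app (s *\<^sub>R clif a) ?f {a} = app (t *\<^sub>R clif b) ?f {a}"
    by (simp only: assms(1))
  then have "- s = (if {a} = {b} then - t else 0)"
    unfolding * by simp
  then show ?thesis using assms(2) by (simp split: if_splits)
qed

text \<open>\<open>tr a b\<close> is the reflection exchanging \<open>clif a\<close> and \<open>clif b\<close>, a lift of the transposition
  of \<open>a\<close> and \<open>b\<close>.\<close>

definition tr :: "nat \<Rightarrow> nat \<Rightarrow> lin_op" where
  "tr a b = (1 / sqrt 2) *\<^sub>R (clif a - clif b)"

lemma tr_swap: "tr b a = - tr a b"
  by (simp add: tr_def scaleR_diff_right)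

lemma tr_sq [simp]:
  assumes "a \<noteq> b"
  shows "tr a b * tr a b = - 1"
proof -
  have "(clif a - clif b) * (clif a - clif b) = - (2 :: real) *\<^sub>R 1"
    using clif_anticommute[OF assms] by (simp add: algebra_simps scaleR_2)
  then show ?thesis by (simp add: tr_def)
qed

lemma tr_sq_left [simp]: "a \<noteq> b \<Longrightarrow> tr a b * (tr a b * u) = - u"
  by (simp add: mult.assoc[symmetric])

text \<open>A relational form of the projection to the symmetric group: on invertible operators
  \<open>p\<close> and a nonzero \<open>s\<close> are determined. The scalar \<open>s\<close> is the
  parity, each reflection contributing \<open>- 1\<close>.\<close>

definition lifts :: "lin_op \<Rightarrow> (nat \<Rightarrow> nat) \<Rightarrow> real \<Rightarrow> bool" where
  "lifts u p s \<longleftrightarrow> (\<forall>i. u * clif i = s *\<^sub>R (clif (p i) * u))"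

lemma lifts_one: "lifts 1 id 1"
  by (simp add: lifts_def)

lemma lifts_uminus: "lifts u p s \<Longrightarrow> lifts (- u) p s"
  by (simp add: lifts_def)

lemma lifts_uminus_iff: "lifts (- u) p s \<longleftrightarrow> lifts u p s"
  using lifts_uminus[of u p s] lifts_uminus[of "- u" p s] by auto

lemma lifts_mult:
  assumes "lifts u p s" "lifts v q t"
  shows "lifts (u * v) (p \<circ> q) (s * t)"
proof (unfold lifts_def, rule allI)
  fix i
  have "u * v * clif i = t *\<^sub>R (u * clif (q i) * v)"
    using assms(2) by (simp add: lifts_def mult.assoc)
  also have "\<dots> = (s * t) *\<^sub>R (clif (p (q i)) * (u * v))"
    using assms(1) by (simp add: lifts_def mult.assoc mult.commute)
  finally show "u * v * clif i = (s * t) *\<^sub>R (clif ((p \<circ> q) i) * (u * v))" by simp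
qed

lemma lifts_tr:
  assumes "a \<noteq> b"
  shows "lifts (tr a b) (transpose a b) (- 1)"
proof (unfold lifts_def, rule allI)
  fix i
  have "(clif a - clif b) * clif i = - (clif (transpose a b i) * (clif a - clif b))"
    using clif_anticommute[of a b] clif_anticommute[of a i] clif_anticommute[of b i] assms
    by (auto simp: transpose_def algebra_simps)
  then show "tr a b * clif i = (- 1) *\<^sub>R (clif (transpose a b i) * tr a b)"
    unfolding tr_def mult_scaleR_left mult_scaleR_right by simp
qed

lemma lifts_tr_apply:
  assumes "lifts u p s"
  shows "u * tr a b = s *\<^sub>R (tr (p a) (p b) * u)"
  using assms by (simp add: lifts_def tr_def algebra_simps)

lemma lifts_unique:
  assumes "lifts u p s" "lifts u q t" "u * v = 1" "s \<noteq> 0" "t \<noteq> 0"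
  shows "p = q \<and> s = t"
proof -
  have "s *\<^sub>R clif (p i) = t *\<^sub>R clif (q i)" for i
  proof -
    have "s *\<^sub>R (clif (p i) * u) * v = t *\<^sub>R (clif (q i) * u) * v"
      using assms(1,2) by (metis lifts_def)
    then show ?thesis using assms(3) by (simp add: mult.assoc)
  qed
  then have "p i = q i \<and> s = t" for i using assms(4,5) by (intro clif_eqD)
  then show ?thesis by auto
qed

text \<open>The source of all later signs: moving one reflection past another transposes the indices
  and costs a sign, whether or not the two share an index.\<close>

lemma tr_conj:
  assumes "a \<noteq> b"
  shows "tr a b * tr c d = - (tr (transpose a b c) (transpose a b d) * tr a b)"
  using lifts_tr_apply[OF lifts_tr[OF assms], of c d] by simp

section \<open>The group generated by the simple reflections and \<open>- 1\<close>\<close>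

inductive_set Spin :: "nat \<Rightarrow> lin_op set" for n where
  one: "1 \<in> Spin n"
| uminus: "u \<in> Spin n \<Longrightarrow> - u \<in> Spin n"
| gen: "u \<in> Spin n \<Longrightarrow> 1 \<le> i \<Longrightarrow> i < n \<Longrightarrow> tr i (Suc i) * u \<in> Spin n"

lemma Spin_uminus_iff [simp]: "- u \<in> Spin n \<longleftrightarrow> u \<in> Spin n"
  using Spin.uminus[of u n] Spin.uminus[of "- u" n] by auto

lemma Spin_mult: "u \<in> Spin n \<Longrightarrow> v \<in> Spin n \<Longrightarrow> u * v \<in> Spin n"
  by (induction rule: Spin.induct) (auto simp: mult.assoc intro: Spin.intros)

lemma Spin_simple: "1 \<le> i \<Longrightarrow> i < n \<Longrightarrow> tr i (Suc i) \<in> Spin n"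
  using Spin.gen[OF Spin.one, of i n] by simp

lemma Spin_tr_less: "1 \<le> a \<Longrightarrow> a < b \<Longrightarrow> b \<le> n \<Longrightarrow> tr a b \<in> Spin n"
proof (induction b)
  case (Suc b)
  show ?case
  proof (cases "a = b")
    case False
    then have "a < b" using Suc by simp
    then have "tr b (Suc b) * tr a b = - (tr a (Suc b) * tr b (Suc b))"
      by (subst tr_conj) (auto simp: transpose_def)
    \<comment> \<open>Multiplying on both sides by the next simple reflection raises the second
      index by one; the sign from \<open>tr_conj\<close> cancels against the square
      \<open>- 1\<close>.\<close>
    then have "tr b (Suc b) * tr a b * tr b (Suc b) = tr a (Suc b)"
      by (simp add: mult.assoc)
    moreover have "tr b (Suc b) * tr a b * tr b (Suc b) \<in> Spin n"
      using Suc False by (intro Spin_mult Spin_simple) auto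
    ultimately show ?thesis by simp
  qed (use Suc in \<open>simp add: Spin_simple\<close>)
qed simp

lemma Spin_tr:
  assumes "a \<in> {1..n}" "b \<in> {1..n}" "a \<noteq> b"
  shows "tr a b \<in> Spin n"
proof (cases "a < b")
  case False
  then have "tr b a \<in> Spin n" using assms by (intro Spin_tr_less) auto
  then show ?thesis by (subst tr_swap) simp
qed (use assms Spin_tr_less in auto)

lemma Spin_mono: "m \<le> n \<Longrightarrow> u \<in> Spin m \<Longrightarrow> u \<in> Spin n"
  by (rotate_tac 1, induction rule: Spin.induct) (auto intro: Spin.intros)

lemma Spin_inverse:
  assumes "u \<in> Spin n"
  obtains v where "v \<in> Spin n" "u * v = 1" "v * u = 1"
proof -
  from assms have "\<exists>v \<in> Spin n. u * v = 1 \<and> v * u = 1"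
  proof induction
    case one
    show ?case using Spin.one by auto
  next
    case (uminus u)
    then show ?case by (metis Spin.uminus minus_mult_minus)
  next
    case (gen u i)
    then obtain v where v: "v \<in> Spin n" "u * v = 1" "v * u = 1" by auto
    \<comment> \<open>A reflection squares to \<open>- 1\<close>, so its inverse is its
      negative.\<close>
    let ?w = "- (v * tr i (Suc i))"
    have "tr i (Suc i) * u * ?w = - (tr i (Suc i) * (u * v) * tr i (Suc i))"
      by (simp add: mult.assoc)
    moreover have "?w * (tr i (Suc i) * u) = - (v * (tr i (Suc i) * (tr i (Suc i) * u)))"
      by (simp only: mult.assoc mult_minus_left)
    moreover have "?w \<in> Spin n"
      by (intro Spin.uminus Spin_mult Spin_simple v(1) gen.hyps)
    ultimately show ?case using v by (intro bexI[of _ ?w]) auto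
  qed
  then show ?thesis using that by auto
qed

lemma Spin_lifts:
  assumes "u \<in> Spin n"
  obtains p s where "lifts u p s" "p permutes {1..n}" "s \<in> {1, - 1}"
proof -
  from assms have "\<exists>p s. lifts u p s \<and> p permutes {1..n} \<and> s \<in> {1, - 1}"
  proof induction
    case one
    show ?case using lifts_one permutes_id by blast
  next
    case (uminus u)
    then show ?case using lifts_uminus by blast
  next
    case (gen u i)
    then obtain p s where "lifts u p s" "p permutes {1..n}" "s \<in> {1, - 1}" by auto
    have "i \<in> {1..n}" "Suc i \<in> {1..n}" using gen.hyps by auto
    then have "transpose i (Suc i) \<circ> p permutes {1..n}"
      using \<open>p permutes {1..n}\<close> by (intro permutes_compose permutes_swap_id)
    moreover have "lifts (tr i (Suc i) * u) (transpose i (Suc i) \<circ> p) (- 1 * s)"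
      using \<open>lifts u p s\<close> by (intro lifts_mult lifts_tr) auto
    moreover have "- 1 * s \<in> {1, - 1}" using \<open>s \<in> {1, - 1}\<close> by auto
    ultimately
    show ?case by blast
  qed
  then show ?thesis using that by auto
qed

lemma Spin_lifts_unique:
  assumes "u \<in> Spin n" "lifts u p s" "lifts u q t" "s \<in> {1, - 1}" "t \<in> {1, - 1}"
  shows "p = q" "s = t"
proof -
  obtain v where "u * v = 1" using Spin_inverse[OF assms(1)] .
  then show "p = q" "s = t" using lifts_unique[of u p s q t v] assms by auto
qed

lemma Spin_neq_uminus: "u \<in> Spin n \<Longrightarrow> u \<noteq> - u"
proof
  assume u: "u \<in> Spin n" and "u = - u"
  then have "2 *\<^sub>R u = 0" by (metis add.right_inverse scaleR_2)
  then have "u = 0" by simp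
  moreover obtain v where "u * v = 1" using Spin_inverse[OF u] .
  ultimately show False by simp
qed

section \<open>Faithfulness of the model\<close>

abbreviation spin_words :: "nat \<Rightarrow> spin_gen gword set" where
  "spin_words n \<equiv> lists (spin_gens n \<times> UNIV)"

abbreviation spin_eq :: "nat \<Rightarrow> spin_gen gword \<Rightarrow> spin_gen gword \<Rightarrow> bool" where
  "spin_eq n \<equiv> pres_eq (spin_gens n) (spin_rels n)"

text \<open>An inverse letter acts by the negative, since a reflection squares to
  \<open>- 1\<close>; \<open>z\<close> is its own inverse, so its flag does not change the
  operator.\<close>

fun gen_op :: "spin_gen \<times> bool \<Rightarrow> lin_op" where
  "gen_op (Gen_t i, b) = (if b then tr i (Suc i) else - tr i (Suc i))"
| "gen_op (Gen_z, b) = - 1"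

definition word_op :: "spin_gen gword \<Rightarrow> lin_op" where
  "word_op w = prod_list (map gen_op w)"

lemma word_op_simps [simp]:
  "word_op [] = 1" "word_op (x # w) = gen_op x * word_op w" "word_op (u @ v) = word_op u * word_op v"
  by (simp_all add: word_op_def)

text \<open>Both sides equal the reflection \<open>tr i (Suc (Suc i))\<close>.\<close>

lemma braid: "tr i (Suc i) * (tr (Suc i) (Suc (Suc i)) * tr i (Suc i)) =
  tr (Suc i) (Suc (Suc i)) * (tr i (Suc i) * tr (Suc i) (Suc (Suc i)))"
proof -
  have 1: "tr i (Suc i) * tr (Suc i) (Suc (Suc i)) = - (tr i (Suc (Suc i)) * tr i (Suc i))"
    by (subst tr_conj) (auto simp: transpose_def)
  have 2: "tr (Suc i) (Suc (Suc i)) * tr i (Suc i) =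
      - (tr i (Suc (Suc i)) * tr (Suc i) (Suc (Suc i)))"
    by (subst tr_conj) (auto simp: transpose_def)
  have "tr i (Suc i) * tr (Suc i) (Suc (Suc i)) * tr i (Suc i) = tr i (Suc (Suc i))"
    unfolding 1 by (simp add: mult.assoc)
  moreover have "tr (Suc i) (Suc (Suc i)) * tr i (Suc i) * tr (Suc i) (Suc (Suc i)) =
      tr i (Suc (Suc i))"
    unfolding 2 by (simp add: mult.assoc)
  ultimately show ?thesis by (simp add: mult.assoc)
qed

lemma tr_disjoint:
  assumes "a \<noteq> b" "c \<notin> {a, b}" "d \<notin> {a, b}"
  shows "tr a b * tr c d = - (tr c d * tr a b)"
  using tr_conj[of a b c d] assms by simp

lemma spin_eq_sound:
  assumes "spin_eq n u v"
  shows "u \<in> spin_words n \<and> v \<in> spin_words n \<and> word_op u = word_op v"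
  using assms
proof induction
  case (cancel x b)
  then show ?case by (cases x) auto
next
  case (rel u v)
  then show ?case
    unfolding spin_rels_def
    by (auto simp: spin_gens_def intro!: braid tr_disjoint)
qed auto

lemma spin_eq_words: "spin_eq n u v \<Longrightarrow> u \<in> spin_words n" "spin_eq n u v \<Longrightarrow> v \<in> spin_words n"
  using spin_eq_sound by blast+

lemma spin_gens_mono: "m \<le> n \<Longrightarrow> spin_gens m \<subseteq> spin_gens n"
  by (auto simp: spin_gens_def)

lemma spin_words_mono: "m \<le> n \<Longrightarrow> spin_words m \<subseteq> spin_words n"
  using spin_gens_mono by (intro lists_mono) auto

lemma spin_eq_mono:
  assumes "spin_eq m u v" "m \<le> n"
  shows "spin_eq n u v"
  using assms(1)
proof induction
  case (refl w)
  then show ?case using spin_words_mono[OF assms(2)] by (auto intro!: pres_eq.refl)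
next
  case (rel u v)
  have "spin_rels m \<subseteq> spin_rels n"
    unfolding spin_rels_def using assms(2) by (intro Un_mono) fastforce+
  then show ?case using rel by (auto intro: pres_eq.rel)
qed (use spin_gens_mono[OF assms(2)] in \<open>auto intro: pres_eq.intros\<close>)

declare pres_eq.trans [trans]

lemma spin_eq_refl: "w \<in> spin_words n \<Longrightarrow> spin_eq n w w"
  by (rule pres_eq.refl)

lemma spin_eq_append:
  "spin_eq n u v \<Longrightarrow> w \<in> spin_words n \<Longrightarrow> spin_eq n (w @ u) (w @ v)"
  "spin_eq n u v \<Longrightarrow> w \<in> spin_words n \<Longrightarrow> spin_eq n (u @ w) (v @ w)"
  by (auto intro: pres_eq.mult spin_eq_refl)

lemma Gen_mem_spin_gens [simp]:
  "Gen_z \<in> spin_gens n" "Gen_t i \<in> spin_gens n \<longleftrightarrow> 1 \<le> i \<and> i < n"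
  by (auto simp: spin_gens_def)

lemma spin_eq_zz: "spin_eq n (zw @ zw) []"
  by (rule pres_eq.rel) (auto simp: spin_rels_def)

lemma spin_eq_tt: "1 \<le> i \<Longrightarrow> i < n \<Longrightarrow> spin_eq n (tw i @ tw i) zw"
  by (rule pres_eq.rel) (auto simp: spin_rels_def)

lemma spin_eq_zt: "1 \<le> i \<Longrightarrow> i < n \<Longrightarrow> spin_eq n (zw @ tw i) (tw i @ zw)"
  by (rule pres_eq.rel) (auto simp: spin_rels_def)

lemma spin_eq_z_inverse: "spin_eq n [(Gen_z, b)] zw"
proof (cases b)
  case True
  then show ?thesis by (auto intro!: spin_eq_refl)
next
  case False
  have "spin_eq n ([(Gen_z, False)] @ []) ([(Gen_z, False)] @ (zw @ zw))"
    by (intro spin_eq_append pres_eq.sym[OF spin_eq_zz]) simp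
  also have "[(Gen_z, False)] @ (zw @ zw) = [(Gen_z, False), (Gen_z, \<not> False)] @ zw" by simp
  also have "spin_eq n \<dots> ([] @ zw)"
    by (intro spin_eq_append pres_eq.cancel) simp_all
  finally show ?thesis using False by simp
qed

text \<open>Inserting \<open>z z = 1\<close> and one \<open>z = t t\<close> cancels the inverse
  letter. Formal inverses can thus be traded for positive letters.\<close>

lemma spin_eq_t_inverse:
  assumes "1 \<le> i" "i < n"
  shows "spin_eq n [(Gen_t i, False)] (zw @ tw i)"
proof -
  let ?i = "[(Gen_t i, False)]"
  have "spin_eq n (?i @ []) (?i @ (zw @ zw))"
    using assms by (intro spin_eq_append pres_eq.sym[OF spin_eq_zz]) simp
  also have "spin_eq n \<dots> (?i @ ((tw i @ tw i) @ zw))"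
    using assms by (intro spin_eq_append pres_eq.sym[OF spin_eq_tt]) simp_all
  also have "?i @ ((tw i @ tw i) @ zw) = [(Gen_t i, False), (Gen_t i, \<not> False)] @ (tw i @ zw)"
    by simp
  also have "spin_eq n \<dots> ([] @ (tw i @ zw))"
    using assms by (intro spin_eq_append pres_eq.cancel) simp_all
  also have "spin_eq n ([] @ (tw i @ zw)) (zw @ tw i)"
    using pres_eq.sym[OF spin_eq_zt[OF assms]] by simp
  finally show ?thesis by simp
qed

lemma spin_eq_z_central:
  assumes "w \<in> spin_words n"
  shows "spin_eq n (zw @ w) (w @ zw)"
  using assms
proof (induction w)
  case Nil
  then show ?case by (auto intro!: spin_eq_refl)
next
  case (Cons x w)
  \<comment> \<open>The letter is replaced by an equal word in positive letters, for which commuting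
    with \<open>z\<close> is a defining relation or follows from one.\<close>
  have "\<exists>l. spin_eq n [x] l \<and> spin_eq n (zw @ l) (l @ zw)"
  proof (cases x)
    case (Pair g b)
    show ?thesis
    proof (cases g)
      case (Gen_t i)
      then have i: "1 \<le> i" "i < n" using Cons.hyps Pair by auto
      show ?thesis
      proof (cases b)
        case True
        then show ?thesis using Pair Gen_t i spin_eq_zt[OF i]
          by (intro exI[of _ "tw i"]) (auto intro!: spin_eq_refl)
      next
        case False
        have "spin_eq n (zw @ (zw @ tw i)) (zw @ (tw i @ zw))"
          using i by (intro spin_eq_append spin_eq_zt) simp_all
        then show ?thesis using Pair Gen_t False spin_eq_t_inverse[OF i] by auto
      qed
    next
      case Gen_z
      then show ?thesis using Pair spin_eq_z_inverse[of n b]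
        by (intro exI[of _ zw]) (auto intro!: spin_eq_refl)
    qed
  qed
  then obtain l where l: "spin_eq n [x] l" "spin_eq n (zw @ l) (l @ zw)" by blast
  have x: "[x] \<in> spin_words n" and w: "w \<in> spin_words n" using Cons.hyps by simp_all
  have "spin_eq n (zw @ [x]) (zw @ l)" using l by (intro spin_eq_append) auto
  also note l(2)
  also have "spin_eq n (l @ zw) ([x] @ zw)" using l by (intro spin_eq_append pres_eq.sym[OF l(1)]) auto
  finally have "spin_eq n ((zw @ [x]) @ w) (([x] @ zw) @ w)" using w by (rule spin_eq_append)
  also have "([x] @ zw) @ w = [x] @ (zw @ w)" by simp
  also have "spin_eq n \<dots> ([x] @ (w @ zw))" using x Cons by (intro spin_eq_append) auto
  finally show ?case by simp
qed

text \<open>Up to the central element \<open>z\<close> the relations are those of the symmetric group, which keeps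
  signs out of the normal form argument.\<close>

definition sim :: "nat \<Rightarrow> spin_gen gword \<Rightarrow> spin_gen gword \<Rightarrow> bool" where
  "sim n u v \<longleftrightarrow> spin_eq n u v \<or> spin_eq n u (zw @ v)"

lemma sim_words: "sim n u v \<Longrightarrow> u \<in> spin_words n" "sim n u v \<Longrightarrow> v \<in> spin_words n"
  unfolding sim_def using spin_eq_words[of n u] by (metis append_in_lists_conv)+

lemma sim_refl: "w \<in> spin_words n \<Longrightarrow> sim n w w"
  by (simp add: sim_def spin_eq_refl)

lemma spin_eq_zz_left:
  assumes "w \<in> spin_words n"
  shows "spin_eq n (zw @ zw @ w) w"
  using spin_eq_append(2)[OF spin_eq_zz assms] by simp

lemma sim_trans [trans]:
  assumes "sim n u v" "sim n v w"
  shows "sim n u w"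
proof -
  have w: "w \<in> spin_words n" using sim_words[OF assms(2)] by simp
  have *: "spin_eq n (zw @ v) (zw @ x)" if "spin_eq n v x" for x
    using that by (intro spin_eq_append) simp_all
  consider "spin_eq n u v" | "spin_eq n u (zw @ v)" using assms(1) by (auto simp: sim_def)
  then show ?thesis
  proof cases
    case 1
    then show ?thesis using assms(2) unfolding sim_def by (metis pres_eq.trans)
  next
    case 2
    from assms(2) consider "spin_eq n v w" | "spin_eq n v (zw @ w)" by (auto simp: sim_def)
    then show ?thesis
    proof cases
      case 1
      then show ?thesis using pres_eq.trans[OF 2 *] by (simp add: sim_def)
    next
      case 3: 2
      show ?thesis using pres_eq.trans[OF pres_eq.trans[OF 2 *[OF 3]] spin_eq_zz_left[OF w]]
        by (simp add: sim_def)
    qed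
  qed
qed

lemma sim_append:
  assumes "sim n u v" "w \<in> spin_words n"
  shows "sim n (w @ u) (w @ v)" "sim n (u @ w) (v @ w)"
proof -
  have v: "v \<in> spin_words n" using sim_words[OF assms(1)] by simp
  have "spin_eq n (w @ (zw @ v)) (zw @ w @ v)"
    using spin_eq_append(2)[OF pres_eq.sym[OF spin_eq_z_central[OF assms(2)]] v] by simp
  note * = pres_eq.trans[OF spin_eq_append(1)[OF _ assms(2)] this]
  show "sim n (w @ u) (w @ v)"
    using assms(1) * spin_eq_append(1)[OF _ assms(2)] unfolding sim_def by metis
  show "sim n (u @ w) (v @ w)"
    using assms(1) spin_eq_append(2)[OF _ assms(2)] unfolding sim_def by (metis append.assoc)
qed

lemma sim_mono: "sim m u v \<Longrightarrow> m \<le> n \<Longrightarrow> sim n u v"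
  unfolding sim_def using spin_eq_mono by blast

lemma sim_tt: "1 \<le> i \<Longrightarrow> i < n \<Longrightarrow> sim n (tw i @ tw i) []"
  unfolding sim_def using spin_eq_tt[of i n] by auto

lemma sim_braid:
  assumes "1 \<le> i" "Suc i < n"
  shows "sim n (tw (Suc i) @ tw i @ tw (Suc i)) (tw i @ tw (Suc i) @ tw i)"
proof -
  have "spin_eq n (tw i @ tw (i + 1) @ tw i) (tw (i + 1) @ tw i @ tw (i + 1))"
    using assms by (intro pres_eq.rel) (auto simp: spin_rels_def)
  from pres_eq.sym[OF this] show ?thesis by (simp add: sim_def)
qed

lemma sim_commute:
  assumes "1 \<le> i" "i < n" "1 \<le> j" "j < n" "i + 1 < j \<or> j + 1 < i"
  shows "sim n (tw j @ tw i) (tw i @ tw j)"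
proof -
  have "spin_eq n (tw j @ tw i) (zw @ tw i @ tw j)"
    using assms unfolding spin_rels_def by (intro pres_eq.rel) auto
  then show ?thesis by (simp add: sim_def)
qed

definition tws :: "nat list \<Rightarrow> spin_gen gword" where
  "tws js = concat (map tw js)"

lemma tws_simps [simp]:
  "tws [] = []" "tws (j # js) = tw j @ tws js" "tws (is @ js) = tws is @ tws js"
  by (simp_all add: tws_def)

lemma tws_words [simp]: "tws js \<in> spin_words n \<longleftrightarrow> set js \<subseteq> {1..<n}"
  by (induction js) auto

lemma sim_commute_tws:
  assumes "1 \<le> i" "i < n" "set js \<subseteq> {1..<n}" "\<And>j. j \<in> set js \<Longrightarrow> i + 1 < j \<or> j + 1 < i"
  shows "sim n (tws js @ tw i) (tw i @ tws js)"
  using assms(3,4)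
proof (induction js)
  case Nil
  then show ?case using assms by (auto intro!: sim_refl)
next
  case (Cons j js)
  have "sim n (tw j @ (tws js @ tw i)) (tw j @ (tw i @ tws js))"
    using Cons by (intro sim_append) auto
  also have "tw j @ (tw i @ tws js) = (tw j @ tw i) @ tws js" by simp
  also have "sim n \<dots> ((tw i @ tw j) @ tws js)"
    using Cons assms(1,2) by (intro sim_append sim_commute) auto
  finally show ?case by simp
qed

text \<open>The words \<open>t_(n-1) ... t_i\<close>, empty for \<open>i = n\<close>, represent the
  cosets of the subgroup on \<open>n - 1\<close> points: the permutation of such a word sends
  \<open>i\<close> to \<open>n\<close>.\<close>

definition descent :: "nat \<Rightarrow> nat \<Rightarrow> spin_gen gword" where
  "descent n i = tws (rev [i..<n])"

lemma descent_Suc: "i < n \<Longrightarrow> descent n i = descent n (Suc i) @ tw i"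
  by (simp add: descent_def upt_conv_Cons)

lemma descent_words [simp]: "1 \<le> i \<Longrightarrow> descent n i \<in> spin_words n"
  by (auto simp: descent_def)

text \<open>The letter commutes past the smaller letters of the descent, a braid move lowers it by
  one, and the lowered letter commutes past the larger ones.\<close>

lemma sim_descent_tw_greater:
  assumes "1 \<le> i" "i < j" "j < n"
  shows "sim n (descent n i @ tw j) (tw (j - 1) @ descent n i)"
proof -
  define k where "k = j - 1"
  have j: "j = Suc k" and k: "i \<le> k" "1 \<le> k" "Suc k < n" using assms by (auto simp: k_def)
  define U where "U = tws (rev [Suc (Suc k)..<n])"
  define W where "W = tws (rev [i..<k])"
  have "[i..<n] = [i..<k] @ [k..<n]" using upt_add_eq_append[of i k "n - k"] k by simp
  moreover have "[k..<n] = k # Suc k # [Suc (Suc k)..<n]" using k by (simp add: upt_conv_Cons)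
  ultimately have D: "descent n i = U @ tw (Suc k) @ tw k @ W"
    unfolding descent_def U_def W_def by simp
  have words: "U \<in> spin_words n" "W \<in> spin_words n" "tw k \<in> spin_words n"
    "tw (Suc k) \<in> spin_words n"
    using k assms(1) by (auto simp: U_def W_def)
  have "sim n ((U @ tw (Suc k) @ tw k) @ (W @ tw (Suc k)))
      ((U @ tw (Suc k) @ tw k) @ (tw (Suc k) @ W))"
    unfolding W_def using k assms(1) words by (intro sim_append sim_commute_tws) auto
  also have "\<dots> = (U @ (tw (Suc k) @ tw k @ tw (Suc k))) @ W" by simp
  also have "sim n \<dots> ((U @ (tw k @ tw (Suc k) @ tw k)) @ W)"
    using words k by (intro sim_append sim_braid) auto
  also have "\<dots> = (U @ tw k) @ (tw (Suc k) @ tw k @ W)" by simp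
  also have "sim n \<dots> ((tw k @ U) @ (tw (Suc k) @ tw k @ W))"
    unfolding U_def using k words by (intro sim_append sim_commute_tws) auto
  finally show ?thesis unfolding D j by simp
qed

text \<open>Appending a letter \<open>t_j\<close> to \<open>v @ descent n i\<close> either shifts
  \<open>i\<close> by one (\<open>j = i\<close> or \<open>j = i - 1\<close>) or sends a letter
  through the descent into \<open>v\<close>. In the latter case the letter that arrives has index at
  most \<open>n - 2\<close>, so \<open>v\<close> stays one level below.\<close>

lemma normal_form:
  assumes "w \<in> spin_words n" "1 \<le> n"
  shows "\<exists>v i. v \<in> spin_words (n - 1) \<and> i \<in> {1..n} \<and> sim n w (v @ descent n i)"
  using assms(1)
proof (induction w rule: rev_induct)
  case Nil
  have "sim n [] ([] @ descent n n)" by (simp add: descent_def sim_refl)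
  then show ?case using assms(2) by (intro exI[of _ "[]"] exI[of _ n]) simp
next
  case (snoc x w)
  then obtain v i where v: "v \<in> spin_words (n - 1)" "i \<in> {1..n}" "sim n w (v @ descent n i)"
    by auto
  have v': "v \<in> spin_words n" using v(1) spin_words_mono[of "n - 1" n] by auto
  have x: "[x] \<in> spin_words n" using snoc.prems by simp
  have *: "sim n (w @ [x]) (v @ (descent n i @ l))" if "sim n [x] l" for l
  proof -
    have "sim n (w @ [x]) ((v @ descent n i) @ [x])" using v(3) x by (rule sim_append)
    also have "sim n \<dots> ((v @ descent n i) @ l)"
      using that v(2) v' by (intro sim_append) auto
    finally show ?thesis by simp
  qed
  have **: ?case if "sim n [x] l" "sim n (descent n i @ l) (u @ descent n k)"
    "u \<in> spin_words (n - 1)" "k \<in> {1..n}" for l u k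
  proof -
    note *[OF that(1)]
    also have "sim n (v @ (descent n i @ l)) (v @ (u @ descent n k))"
      using that(2) v' by (rule sim_append)
    finally show ?thesis using that v(1)
      by (intro exI[of _ "v @ u"] exI[of _ k]) simp
  qed
  obtain g b where gb: "x = (g, b)" by (cases x)
  show ?case
  proof (cases g)
    case Gen_z
    have "spin_eq n [x] (zw @ [])" using spin_eq_z_inverse[of n b] gb Gen_z by simp
    then have "sim n [x] []" by (auto simp: sim_def)
    then show ?thesis
      by (rule **[of "[]" "[]" i]) (use v(2) in \<open>simp_all add: sim_refl del: in_lists_conv_set\<close>)
  next
    case (Gen_t j)
    then have j: "1 \<le> j" "j < n" using x gb by auto
    have xj: "sim n [x] (tw j)"
    proof (cases b)
      case False
      then show ?thesis using spin_eq_t_inverse[OF j] gb Gen_t by (simp add: sim_def)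
    qed (use x gb Gen_t in \<open>simp add: sim_refl\<close>)
    consider "i < j" | "i = j" | "i = Suc j" | "Suc j < i" by linarith
    then show ?thesis
    proof cases
      case 1
      then have "sim n (descent n i @ tw j) (tw (j - 1) @ descent n i)"
        using v(2) j by (intro sim_descent_tw_greater) auto
      with xj show ?thesis by (rule **) (use 1 v(2) j in auto)
    next
      case 2
      have "descent n i @ tw j = descent n (Suc i) @ (tw i @ tw i)"
        using 2 j by (simp add: descent_Suc)
      also have "sim n \<dots> (descent n (Suc i) @ [])"
        using 2 j by (intro sim_append sim_tt) auto
      finally have "sim n (descent n i @ tw j) ([] @ descent n (Suc i))" by simp
      with xj show ?thesis by (rule **) (use 2 j in auto)
    next
      case 3
      then have "descent n i @ tw j = descent n j" using j by (simp add: descent_Suc)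
      then have "sim n (descent n i @ tw j) ([] @ descent n j)" using j by (simp add: sim_refl)
      with xj show ?thesis by (rule **) (use j in auto)
    next
      case 4
      then have "sim n (descent n i @ tw j) (tw j @ descent n i)"
        unfolding descent_def using j v(2) by (intro sim_commute_tws) auto
      with xj show ?thesis by (rule **) (use 4 v(2) j in auto)
    qed
  qed
qed

lemma lifts_word_descent:
  assumes "i \<le> n"
  shows "\<exists>p s. lifts (word_op (descent n i)) p s \<and> p i = n \<and> s \<in> {1, - 1}"
  using assms
proof (induction i rule: inc_induct)
  case base
  have "lifts (word_op (descent n n)) id 1 \<and> id n = n" using lifts_one by (simp add: descent_def)
  then show ?case by blast
next
  case (step i)
  then obtain p s where p: "lifts (word_op (descent n (Suc i))) p s" "p (Suc i) = n" "s \<in> {1, - 1}"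
    by auto
  have "lifts (word_op (descent n (Suc i)) * tr i (Suc i)) (p \<circ> transpose i (Suc i)) (s * - 1)"
    using p(1) by (intro lifts_mult lifts_tr) auto
  then have "lifts (word_op (descent n i)) (p \<circ> transpose i (Suc i)) (s * - 1)"
    using step.hyps by (simp add: descent_Suc)
  moreover have "(p \<circ> transpose i (Suc i)) i = n" using p(2) by simp
  moreover have "s * - 1 \<in> {1, - 1}" using p(3) by auto
  ultimately show ?case by blast
qed

lemma sim_word_op: "sim n u v \<Longrightarrow> word_op u = word_op v \<or> word_op u = - word_op v"
  unfolding sim_def using spin_eq_sound[of n u] by fastforce

lemma word_op_Spin: "w \<in> spin_words n \<Longrightarrow> word_op w \<in> Spin n"
proof (induction w)
  case Nil
  show ?case by (simp add: Spin.one)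
next
  case (Cons x w)
  then show ?case by (cases "fst x"; cases x) (auto intro: Spin.intros)
qed

text \<open>For a trivial permutation the coset representative must be empty: the descent sends
  \<open>i\<close> to the last point, which the remaining word fixes, so \<open>i\<close> is the
  last point. The word then lives one level below, where induction applies.\<close>

lemma sim_Nil_of_lifts_id:
  assumes "w \<in> spin_words n" "lifts (word_op w) p s" "\<And>i. p i = i" "s \<in> {1, - 1}"
  shows "sim n w []"
  using assms(1,2,4)
proof (induction n arbitrary: w)
  case 0
  then show ?case
  proof (induction w)
    case Nil
    show ?case by (simp add: sim_refl)
  next
    case (Cons x w)
    then have x: "fst x = Gen_z" by (auto simp: spin_gens_def)
    then have "spin_eq 0 [x] (zw @ [])" using spin_eq_z_inverse[of 0 "snd x"] by (cases x) simp
    then have "sim 0 [x] []" by (auto simp: sim_def)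
    then have "sim 0 ([x] @ w) ([] @ w)" using Cons.hyps(2) by (rule sim_append)
    moreover have "lifts (word_op w) p s"
      using Cons.prems(1) x by (cases x) (simp add: lifts_uminus_iff)
    then have "sim 0 w []" using Cons.prems(2) by (rule Cons.IH)
    ultimately show ?case using sim_trans[of 0 "[x] @ w" w "[]"] by simp
  qed
next
  case (Suc n)
  obtain v i where v: "v \<in> spin_words n" "i \<in> {1..Suc n}" "sim (Suc n) w (v @ descent (Suc n) i)"
    using normal_form[OF Suc.prems(1)] by auto
  obtain q t where q: "lifts (word_op (descent (Suc n) i)) q t" "q i = Suc n" "t \<in> {1, - 1}"
    using lifts_word_descent[of i "Suc n"] v(2) by auto
  obtain p' r where p': "lifts (word_op v) p' r" "p' permutes {1..n}" "r \<in> {1, - 1}"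
    using Spin_lifts[OF word_op_Spin[OF v(1)]] by blast
  have *: "lifts (word_op (v @ descent (Suc n) i)) p s"
    using sim_word_op[OF v(3)] Suc.prems(2) lifts_uminus_iff by metis
  moreover have "lifts (word_op (v @ descent (Suc n) i)) (p' \<circ> q) (r * t)"
    using lifts_mult[OF p'(1) q(1)] by simp
  moreover have "word_op (v @ descent (Suc n) i) \<in> Spin (Suc n)"
    using sim_words(2)[OF v(3)] by (rule word_op_Spin)
  moreover have "r * t \<in> {1, - 1}" using p'(3) q(3) by auto
  ultimately have "p = p' \<circ> q" using Suc.prems(3) Spin_lifts_unique(1) by blast
  then have "i = p' (q i)" using assms(3) by (metis comp_apply)
  also have "\<dots> = Suc n" using p'(2) q(2) by (simp add: permutes_def)
  finally have i: "i = Suc n" .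
  then have "sim (Suc n) w v" using v(3) by (simp add: descent_def)
  moreover have "sim n v []"
  proof (rule Suc.IH[OF v(1)])
    show "lifts (word_op v) p s" using * i by (simp add: descent_def)
  qed (fact Suc.prems)
  then have "sim (Suc n) v []" by (rule sim_mono) simp
  ultimately show ?case by (rule sim_trans)
qed

definition word_inv :: "spin_gen gword \<Rightarrow> spin_gen gword" where
  "word_inv w = rev (map (\<lambda>(x, b). (x, \<not> b)) w)"

lemma word_inv_words [simp]: "word_inv w \<in> spin_words n \<longleftrightarrow> w \<in> spin_words n"
  by (force simp: word_inv_def in_lists_conv_set)

lemma spin_eq_word_inv:
  assumes "w \<in> spin_words n"
  shows "spin_eq n (w @ word_inv w) []" "spin_eq n (word_inv w @ w) []"
proof -
  have "spin_eq n (w @ word_inv w) [] \<and> spin_eq n (word_inv w @ w) []"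
    using assms
  proof (induction w)
    case Nil
    show ?case by (simp add: word_inv_def spin_eq_refl)
  next
    case (Cons x w)
    obtain g b where x: "x = (g, b)" by (cases x)
    have g: "g \<in> spin_gens n" and w: "w \<in> spin_words n" using Cons.hyps x by auto
    have inv: "word_inv (x # w) = word_inv w @ [(g, \<not> b)]" by (simp add: word_inv_def x)
    have "spin_eq n ([x] @ (w @ word_inv w) @ [(g, \<not> b)]) ([x] @ [] @ [(g, \<not> b)])"
      using Cons g w x by (intro spin_eq_append) auto
    also have "spin_eq n \<dots> []" using pres_eq.cancel[OF g, of _ b] x by simp
    finally have 1: "spin_eq n ((x # w) @ word_inv (x # w)) []" by (simp add: inv)
    have "spin_eq n (word_inv w @ [(g, \<not> b), (g, \<not> \<not> b)] @ w) (word_inv w @ [] @ w)"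
      using w g by (intro spin_eq_append pres_eq.cancel) auto
    also have "spin_eq n \<dots> []" using Cons by simp
    finally have "spin_eq n (word_inv (x # w) @ (x # w)) []" unfolding inv by (simp add: x)
    with 1 show ?case by blast
  qed
  then show "spin_eq n (w @ word_inv w) []" "spin_eq n (word_inv w @ w) []" by auto
qed

text \<open>The sign left open by \<open>sim\<close> is decided in the model, where \<open>z\<close>
  acts as \<open>- 1\<close>, which differs from \<open>1\<close>.\<close>

lemma spin_eq_Nil_of_sim:
  assumes "sim n w []" "word_op w = 1"
  shows "spin_eq n w []"
proof -
  have "\<not> spin_eq n w (zw @ [])"
  proof
    assume "spin_eq n w (zw @ [])"
    then have "(1 :: lin_op) = - 1" using spin_eq_sound[of n w] assms(2) by fastforce
    then show False using Spin_neq_uminus[OF Spin.one] by simp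
  qed
  then show ?thesis using assms(1) by (simp add: sim_def)
qed

theorem spin_eq_complete:
  assumes "u \<in> spin_words n" "v \<in> spin_words n" "word_op u = word_op v"
  shows "spin_eq n u v"
proof -
  note inv = spin_eq_word_inv[OF assms(2)]
  have "word_op (u @ word_inv v) = word_op (v @ word_inv v)" using assms(3) by simp
  also have "\<dots> = 1" using spin_eq_sound[OF inv(1)] by simp
  finally have one: "word_op (u @ word_inv v) = 1" .
  then have "sim n (u @ word_inv v) []"
    using assms lifts_one by (intro sim_Nil_of_lifts_id[of _ _ id 1]) auto
  then have "spin_eq n (u @ word_inv v) []" using one by (rule spin_eq_Nil_of_sim)
  then have 1: "spin_eq n ((u @ word_inv v) @ v) ([] @ v)" using assms(2) by (rule spin_eq_append)
  have "spin_eq n (u @ (word_inv v @ v)) (u @ [])"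
    using inv(2) assms(1) by (rule spin_eq_append)
  then have "spin_eq n ((u @ word_inv v) @ v) u" by simp
  from pres_eq.trans[OF pres_eq.sym[OF this] 1] show ?thesis by simp
qed

lemma Spin_word_op: "u \<in> Spin n \<Longrightarrow> \<exists>w \<in> spin_words n. u = word_op w"
proof (induction rule: Spin.induct)
  case one
  show ?case by (intro bexI[of _ "[]"]) auto
next
  case (uminus u)
  then obtain w where "w \<in> spin_words n" "u = word_op w" by blast
  then show ?case by (intro bexI[of _ "zw @ w"]) auto
next
  case (gen u i)
  then obtain w where "w \<in> spin_words n" "u = word_op w" by blast
  then show ?case using gen.hyps by (intro bexI[of _ "tw i @ w"]) auto
qed

lemma Spin_eq_word_op_image: "Spin n = word_op ` spin_words n"
  using Spin_word_op word_op_Spin by blast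

text \<open>The quotient of the two lifts is the value of a word with trivial permutation, which
  reduces to the empty word up to \<open>z\<close>. So the projection to the symmetric group has
  kernel \<open>{1, - 1}\<close>.\<close>

lemma Spin_eq_up_to_sign:
  assumes "u \<in> Spin n" "v \<in> Spin n" "lifts u p s" "lifts v p t" "s \<in> {1, - 1}" "t \<in> {1, - 1}"
  shows "u = v \<or> u = - v"
proof -
  obtain v' where v': "v' \<in> Spin n" "v * v' = 1" "v' * v = 1" using Spin_inverse[OF assms(2)] .
  obtain q r where q: "lifts v' q r" "r \<in> {1, - 1}" using Spin_lifts[OF v'(1)] .
  have "lifts 1 (p \<circ> q) (t * r)" using lifts_mult[OF assms(4) q(1)] v'(2) by simp
  moreover have "t * r \<in> {1, - 1}" using assms(6) q(2) by auto
  ultimately have "p \<circ> q = id"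
    using Spin_lifts_unique(1)[OF Spin.one _ lifts_one] by blast
  then have l: "lifts (u * v') id (s * r)" using lifts_mult[OF assms(3) q(1)] by simp
  obtain w where w: "w \<in> spin_words n" "u * v' = word_op w"
    using Spin_word_op[OF Spin_mult[OF assms(1) v'(1)]] by blast
  have "sim n w []"
    using w(1) l[unfolded w(2)] id_apply by (rule sim_Nil_of_lifts_id) (use assms(5) q(2) in auto)
  then have "u * v' = 1 \<or> u * v' = - 1" using sim_word_op[of n w "[]"] w(2) by simp
  moreover have "u = (u * v') * v" using v' by (simp add: mult.assoc)
  ultimately show ?thesis by (metis mult_1 mult_minus_left)
qed

lemma finite_Spin: "finite (Spin n)"
proof -
  let ?P = "{p. p permutes {1..n}}"
  define f where "f p = (SOME u. u \<in> Spin n \<and> (\<exists>s \<in> {1, - 1}. lifts u p s))" for p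
  have "Spin n \<subseteq> f ` ?P \<union> uminus ` f ` ?P"
  proof
    fix u assume u: "u \<in> Spin n"
    then obtain p s where p: "lifts u p s" "p permutes {1..n}" "s \<in> {1, - 1}" by (rule Spin_lifts)
    then have "\<exists>u. u \<in> Spin n \<and> (\<exists>s \<in> {1, - 1}. lifts u p s)" using u by blast
    from someI_ex[OF this] obtain t where "f p \<in> Spin n" "t \<in> {1, - 1}" "lifts (f p) p t"
      unfolding f_def[symmetric] by blast
    then have "u = f p \<or> u = - f p" using Spin_eq_up_to_sign[OF u _ p(1)] p(3) by blast
    then show "u \<in> f ` ?P \<union> uminus ` f ` ?P" using p(2) by blast
  qed
  moreover have "finite (f ` ?P \<union> uminus ` f ` ?P)" by (simp add: finite_permutations)
  ultimately show ?thesis by (rule finite_subset)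
qed

section \<open>The group algebra\<close>

text \<open>A copy of the multiplicative monoid of operators, written additively because
  \<open>poly_mapping\<close> builds monoid algebras over additive monoids.\<close>

datatype mop = Mop (unmop: lin_op)

instantiation mop :: monoid_add
begin
definition "0 = Mop 1"
definition "x + y = Mop (unmop x * unmop y)"
instance by standard (simp_all add: zero_mop_def plus_mop_def mult.assoc)
end

type_synonym galg = "mop \<Rightarrow>\<^sub>0 int"

definition gel :: "lin_op \<Rightarrow> galg" where
  "gel u = Poly_Mapping.single (Mop u) 1"

definition co :: "galg \<Rightarrow> lin_op \<Rightarrow> int" where
  "co a u = Poly_Mapping.lookup a (Mop u)"

lemma galg_eqI: "(\<And>u. co a u = co b u) \<Longrightarrow> a = b"
  unfolding co_def by (intro poly_mapping_eqI) (metis mop.collapse)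

lemma co_simps [simp]:
  "co (a + b) u = co a u + co b u" "co (a - b) u = co a u - co b u" "co (- a) u = - co a u"
  "co 0 u = 0"
  by (simp_all add: co_def lookup_add lookup_minus)

lemma co_sum [simp]: "co (\<Sum>i\<in>I. f i) u = (\<Sum>i\<in>I. co (f i) u)"
  by (simp add: co_def lookup_sum)

lemma co_gel: "co (gel u) v = (if u = v then 1 else 0)"
  by (simp add: co_def gel_def lookup_single when_def)

lemma gel_one [simp]: "gel 1 = 1"
  by (simp add: gel_def flip: single_one zero_mop_def)

lemma gel_mult [simp]: "gel u * gel v = gel (u * v)"
  by (simp add: gel_def mult_single plus_mop_def)

lemma galg_induct:
  fixes P :: "galg \<Rightarrow> bool"
  assumes "\<And>u c. P (Poly_Mapping.single (Mop u) c)" "\<And>a b. P a \<Longrightarrow> P b \<Longrightarrow> P (a + b)"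
  shows "P a"
proof -
  have "P (\<Sum>k\<in>K. Poly_Mapping.single k (f k))" if "finite K" for K f
    using that
  proof induction
    case empty
    show ?case using assms(1)[of 1 0] by simp
  next
    case (insert k K)
    then show ?case using assms(1)[of "unmop k" "f k"] assms(2) by simp
  qed
  from this[of "Poly_Mapping.keys a" "Poly_Mapping.lookup a"]
  have "P (\<Sum>k\<in>Poly_Mapping.keys a. Poly_Mapping.single k (Poly_Mapping.lookup a k))" by simp
  also have "(\<Sum>k\<in>Poly_Mapping.keys a. Poly_Mapping.single k (Poly_Mapping.lookup a k)) = a"
    by (rule poly_mapping_eqI) (simp add: lookup_sum lookup_single when_def in_keys_iff)
  finally show ?thesis .
qed

lemma co_mult_gel:
  assumes "v * v' = 1" "v' * v = 1"
  shows "co (a * gel v) u = co a (u * v')"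
proof (induction a rule: galg_induct)
  case (1 w c)
  have "w * v = u \<longleftrightarrow> w = u * v'" using assms by (metis mult.assoc mult_1_right)
  then show ?case
    by (simp add: co_def gel_def mult_single plus_mop_def lookup_single when_def)
qed (simp add: distrib_right)

lemma co_gel_mult:
  assumes "v * v' = 1" "v' * v = 1"
  shows "co (gel v * a) u = co a (v' * u)"
proof (induction a rule: galg_induct)
  case (1 w c)
  have "v * w = u \<longleftrightarrow> w = v' * u" using assms by (metis mult.assoc mult_1_left)
  then show ?case
    by (simp add: co_def gel_def mult_single plus_mop_def lookup_single when_def)
qed (simp add: distrib_left)

text \<open>The group element \<open>- 1\<close> as a basis vector; it becomes the ring element
  \<open>- 1\<close> only in the quotient by \<open>z + 1\<close>.\<close>

definition gz :: galg where
  "gz = gel (- 1)"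

lemma gz_gz [simp]: "gz * gz = 1" "gz * (gz * a) = a"
  by (simp_all add: gz_def flip: mult.assoc)

lemma gz_central: "a * gz = gz * a"
  by (rule galg_eqI) (simp add: gz_def co_mult_gel[of _ "- 1"] co_gel_mult[of _ "- 1"])

lemma gz_left_commute: "a * (gz * b) = gz * (a * b)"
  using gz_central[of a] by (simp flip: mult.assoc)

lemma gel_uminus: "gel (- u) = gz * gel u"
  by (simp add: gz_def)

text \<open>The order of indices matters: the cycle \<open>[i, k]\<close> is the operator
  \<open>tr k i\<close>, and \<open>tr i k\<close> is its negative.\<close>

definition JM :: "nat \<Rightarrow> galg" where
  "JM k = (\<Sum>i\<in>{1..<k}. gel (tr k i))"

fun JM_elem :: "nat \<Rightarrow> nat \<Rightarrow> galg" where
  "JM_elem 0 n = 1"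
| "JM_elem (Suc r) 0 = 0"
| "JM_elem (Suc r) (Suc n) = JM_elem (Suc r) n + JM_elem r n * (JM (Suc n))\<^sup>2"

subsection \<open>Centrality\<close>

lemma gel_JM_conj:
  assumes "lifts g p (- 1)" "bij_betw p {1..<k} {1..<k}" "p k = k"
  shows "gel g * JM k = gz * JM k * gel g"
proof -
  have "gel g * gel (tr k i) = gz * gel (tr k (p i)) * gel g" for i
    using lifts_tr_apply[OF assms(1), of k i] assms(3) by (simp add: gz_def)
  then have "gel g * JM k = gz * (\<Sum>i\<in>{1..<k}. gel (tr k (p i))) * gel g"
    by (simp add: JM_def sum_distrib_left sum_distrib_right)
  also have "(\<Sum>i\<in>{1..<k}. gel (tr k (p i))) = JM k"
    unfolding JM_def by (rule sum.reindex_bij_betw[OF assms(2)])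
  finally show ?thesis .
qed

lemma bij_betw_transpose:
  assumes "a \<in> S \<longleftrightarrow> b \<in> S"
  shows "bij_betw (transpose a b) S S"
proof (rule bij_betw_byWitness[of _ "transpose a b"])
qed (use assms in \<open>auto simp: transpose_def\<close>)

lemma gel_tr_JM:
  assumes "a \<noteq> b" "k \<notin> {a, b}" "a \<in> {1..<k} \<longleftrightarrow> b \<in> {1..<k}"
  shows "gel (tr a b) * JM k = gz * JM k * gel (tr a b)"
  by (rule gel_JM_conj[OF lifts_tr[OF assms(1)] bij_betw_transpose[OF assms(3)]])
    (use assms(2) in auto)

text \<open>Each summand of \<open>JM k\<close> is a reflection in two points below
  \<open>l\<close>, so it permutes the summands of \<open>JM l\<close> at the cost of one
  \<open>gz\<close>.\<close>

lemma JM_anticommute: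
  assumes "k < l"
  shows "JM k * JM l = gz * JM l * JM k"
proof -
  have "JM k * JM l = (\<Sum>j\<in>{1..<k}. gel (tr k j) * JM l)" by (simp add: JM_def sum_distrib_right)
  also have "\<dots> = (\<Sum>j\<in>{1..<k}. gz * JM l * gel (tr k j))"
    using assms by (intro sum.cong gel_tr_JM) auto
  also have "\<dots> = gz * JM l * JM k" by (simp add: JM_def[of k] sum_distrib_left)
  finally show ?thesis .
qed

text \<open>Multiplying by \<open>t\<close> on both sides replaces the index \<open>i\<close> by
  \<open>Suc i\<close> in every summand of \<open>JM i\<close>; the missing summand, for the pair
  \<open>i\<close>, \<open>Suc i\<close> itself, is the extra term.\<close>

lemma JM_Suc:
  assumes "1 \<le> i"
  defines "t \<equiv> gel (tr i (Suc i))"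
  shows "JM (Suc i) = t * JM i * t + gz * t"
proof -
  have "t * gel (tr i j) * t = gel (tr (Suc i) j)" if "j < i" for j
  proof -
    have "tr i (Suc i) * tr i j = - (tr (Suc i) j * tr i (Suc i))"
      using tr_conj[of i "Suc i" i j] that by simp
    then have "tr i (Suc i) * tr i j * tr i (Suc i) = tr (Suc i) j" by (simp add: mult.assoc)
    then show ?thesis by (simp add: t_def)
  qed
  then have "t * JM i * t = (\<Sum>j\<in>{1..<i}. gel (tr (Suc i) j))"
    by (simp add: JM_def sum_distrib_left sum_distrib_right)
  moreover have "gz * t = gel (tr (Suc i) i)" by (simp add: t_def gz_def tr_swap[of "Suc i" i])
  ultimately show ?thesis using assms(1) by (simp add: JM_def)
qed

lemma JM_sq_commute:
  assumes "x * JM k = gz * JM k * x"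
  shows "x * (JM k)\<^sup>2 = (JM k)\<^sup>2 * x"
proof -
  have "x * (JM k)\<^sup>2 = (x * JM k) * JM k" by (simp add: power2_eq_square mult.assoc)
  also have "\<dots> = gz * JM k * (x * JM k)" by (subst assms) (simp add: mult.assoc)
  also have "\<dots> = gz * JM k * (gz * JM k * x)" by (simp only: assms)
  also have "\<dots> = (JM k)\<^sup>2 * x" by (simp add: gz_left_commute[of "JM k"] power2_eq_square mult.assoc)
  finally show ?thesis .
qed

context
  fixes i :: nat and t :: galg
  assumes i: "1 \<le> i" and t: "t = gel (tr i (Suc i))"
begin

private lemma tt: "t * t = gz" "t * (t * a) = gz * a"
  by (simp_all add: t gz_def flip: mult.assoc)

private lemmas gz_left = gz_left_commute[of t] gz_left_commute[of "JM i"]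
  gz_left_commute[of "JM (Suc i)"]

private lemmas gz_right = gz_central[of t] gz_central[of "JM i"] gz_central[of "JM (Suc i)"]

private lemma t_JM: "t * JM i = gz * JM (Suc i) * t - gz"
proof -
  have "JM (Suc i) * t = gz * t * JM i + 1"
    using i by (simp add: JM_Suc t[symmetric] distrib_right mult.assoc tt gz_right gz_left)
  then have "gz * (JM (Suc i) * t) = gz * (gz * t * JM i + 1)" by simp
  then show ?thesis by (simp add: distrib_left mult.assoc)
qed

private lemma t_JM_Suc: "t * JM (Suc i) = gz * JM i * t + 1"
  using i by (simp add: JM_Suc t[symmetric] distrib_left mult.assoc tt gz_left)

text \<open>The correction terms here and in \<open>t_sq_Suc\<close> are negatives of each other, so
  they cancel in the sum of the two squares.\<close>

private lemma t_sq: "t * (JM i)\<^sup>2 = (JM (Suc i))\<^sup>2 * t - JM (Suc i) - gz * JM i"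
proof -
  have "t * (JM i)\<^sup>2 = (t * JM i) * JM i" by (simp add: power2_eq_square mult.assoc)
  also have "\<dots> = gz * JM (Suc i) * (t * JM i) - gz * JM i"
    by (simp add: t_JM left_diff_distrib mult.assoc)
  also have "\<dots> = (JM (Suc i))\<^sup>2 * t - JM (Suc i) - gz * JM i"
    by (simp add: t_JM right_diff_distrib power2_eq_square mult.assoc gz_left gz_right)
  finally show ?thesis .
qed

private lemma t_sq_Suc: "t * (JM (Suc i))\<^sup>2 = (JM i)\<^sup>2 * t + gz * JM i + JM (Suc i)"
proof -
  have "t * (JM (Suc i))\<^sup>2 = (t * JM (Suc i)) * JM (Suc i)"
    by (simp add: power2_eq_square mult.assoc)
  also have "\<dots> = gz * JM i * (t * JM (Suc i)) + JM (Suc i)"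
    by (simp add: t_JM_Suc distrib_right mult.assoc)
  also have "\<dots> = (JM i)\<^sup>2 * t + gz * JM i + JM (Suc i)"
    by (simp add: t_JM_Suc distrib_left power2_eq_square mult.assoc gz_left)
  finally show ?thesis .
qed

lemma t_sq_sum: "t * ((JM i)\<^sup>2 + (JM (Suc i))\<^sup>2) = ((JM i)\<^sup>2 + (JM (Suc i))\<^sup>2) * t"
  by (simp add: distrib_left distrib_right t_sq t_sq_Suc)

text \<open>The two corrections appear with \<open>?b\<^sup>2\<close> on the right and on the left
  respectively; \<open>?b\<^sup>2\<close> commutes with both \<open>?a\<close> and
  \<open>?b\<close>, so they cancel again.\<close>

lemma t_sq_prod: "t * ((JM i)\<^sup>2 * (JM (Suc i))\<^sup>2) = (JM i)\<^sup>2 * (JM (Suc i))\<^sup>2 * t"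
proof -
  let ?a = "JM i" and ?b = "JM (Suc i)"
  have ab: "?a * ?b\<^sup>2 = ?b\<^sup>2 * ?a" using JM_anticommute[of i "Suc i"] by (intro JM_sq_commute) simp
  then have aabb: "?a\<^sup>2 * ?b\<^sup>2 = ?b\<^sup>2 * ?a\<^sup>2"
    by (simp add: power2_eq_square[of ?a] mult.assoc) (simp add: ab flip: mult.assoc)
  have "t * (?a\<^sup>2 * ?b\<^sup>2) = (?b\<^sup>2 * t - ?b - gz * ?a) * ?b\<^sup>2"
    by (simp add: t_sq flip: mult.assoc)
  also have "\<dots> = ?b\<^sup>2 * (t * ?b\<^sup>2) - ?b * ?b\<^sup>2 - gz * (?a * ?b\<^sup>2)"
    by (simp add: left_diff_distrib mult.assoc)
  also have "\<dots> = ?b\<^sup>2 * ?a\<^sup>2 * t + (?b\<^sup>2 * (gz * ?a) - gz * (?b\<^sup>2 * ?a)) + (?b\<^sup>2 * ?b - ?b * ?b\<^sup>2)"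
    by (simp add: t_sq_Suc distrib_left ab mult.assoc)
  also have "\<dots> = ?a\<^sup>2 * ?b\<^sup>2 * t"
    by (simp add: aabb power_commutes gz_left_commute[of "?b\<^sup>2"])
  finally show ?thesis .
qed

lemma t_sq_other: "k \<noteq> i \<Longrightarrow> k \<noteq> Suc i \<Longrightarrow> t * (JM k)\<^sup>2 = (JM k)\<^sup>2 * t"
  unfolding t using i by (intro JM_sq_commute gel_tr_JM) auto

lemma t_JM_elem_less: "m < i \<Longrightarrow> t * JM_elem r m = JM_elem r m * t"
proof (induction r m rule: JM_elem.induct)
  case (3 r n)
  have "t * (JM_elem r n * (JM (Suc n))\<^sup>2) = JM_elem r n * (t * (JM (Suc n))\<^sup>2)"
    using 3 by (simp flip: mult.assoc)
  then show ?case using 3 t_sq_other[of "Suc n"] by (simp add: distrib_left distrib_right mult.assoc)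
qed simp_all

text \<open>Splitting off the indices \<open>i\<close> and \<open>Suc i\<close> leaves only the
  symmetric combinations \<open>?a + ?b\<close> and \<open>?a * ?b\<close> of their squares, and
  \<open>t\<close> commutes with both as well as with all other squares.\<close>

lemma t_JM_elem: "Suc i \<le> n \<Longrightarrow> t * JM_elem r n = JM_elem r n * t"
proof (induction n arbitrary: r rule: nat_induct_at_least)
  case base
  obtain m where m: "i = Suc m" using i by (cases i) auto
  let ?a = "(JM i)\<^sup>2" and ?b = "(JM (Suc i))\<^sup>2"
  have c: "t * (JM_elem s m * x) = JM_elem s m * x * t" if "t * x = x * t" for s x
  proof -
    have "t * (JM_elem s m * x) = JM_elem s m * (t * x)"
      using t_JM_elem_less[of m s] m by (simp flip: mult.assoc)
    then show ?thesis by (simp add: that mult.assoc)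
  qed
  consider "r = 0" | "r = 1" | s where "r = Suc (Suc s)" by (metis One_nat_def not0_implies_Suc)
  then show ?case
  proof cases
    case 2
    then have "JM_elem r (Suc i) = JM_elem 1 m + (?a + ?b)" using m by simp
    then show ?thesis using t_JM_elem_less[of m 1] t_sq_sum m
      by (simp only: distrib_left[of t] distrib_right[of _ _ t] lessI)
  next
    case 3
    then have "JM_elem r (Suc i) = JM_elem (Suc (Suc s)) m + JM_elem (Suc s) m * (?a + ?b) +
        JM_elem s m * (?a * ?b)"
      using m by (simp add: distrib_left distrib_right mult.assoc)
    then show ?thesis using t_JM_elem_less[of m "Suc (Suc s)"] c[OF t_sq_sum] c[OF t_sq_prod] m
      by (simp only: distrib_left[of t] distrib_right[of _ _ t] lessI)
  qed simp
next
  case (Suc n)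
  show ?case
  proof (cases r)
    case (Suc s)
    have "t * (JM_elem s n * (JM (Suc n))\<^sup>2) = JM_elem s n * (t * (JM (Suc n))\<^sup>2)"
      using Suc.IH by (simp flip: mult.assoc)
    then show ?thesis using Suc.IH Suc.hyps t_sq_other[of "Suc n"] Suc
      by (simp add: distrib_left distrib_right mult.assoc)
  qed simp
qed

end

lemma JM_elem_central:
  assumes "g \<in> Spin n"
  shows "gel g * JM_elem r n = JM_elem r n * gel g"
  using assms
proof induction
  case (uminus u)
  then show ?case by (simp add: gel_uminus gz_left_commute[of "JM_elem r n"] mult.assoc)
next
  case (gen u i)
  then have "gel (tr i (Suc i)) * JM_elem r n = JM_elem r n * gel (tr i (Suc i))"
    by (intro t_JM_elem) auto
  then have "gel (tr i (Suc i)) * (gel u * JM_elem r n) = JM_elem r n * gel (tr i (Suc i)) * gel u"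
    unfolding gen.IH by (simp only: mult.assoc[symmetric])
  then show ?case by (simp add: mult.assoc[symmetric]) (simp add: mult.assoc)
qed simp

lemma co_JM_elem_conj:
  assumes "g \<in> Spin n" "g * u = v * g"
  shows "co (JM_elem r n) u = co (JM_elem r n) v"
proof -
  obtain g' where g': "g * g' = 1" "g' * g = 1" using Spin_inverse[OF assms(1)] .
  have "co (JM_elem r n) (v * g * g') = co (JM_elem r n) (g' * (g * u))"
    using arg_cong[OF JM_elem_central[OF assms(1), of r], of "\<lambda>a. co a (g * u)"]
    unfolding co_mult_gel[OF g'] co_gel_mult[OF g'] assms(2) by simp
  then show ?thesis using g' by (simp add: mult.assoc) (simp flip: mult.assoc)
qed

subsection \<open>Support\<close>

text \<open>\<open>h\<close> labels the points by unions of cycles of \<open>p\<close>, so that \<open>card {1..n} - card (h ` {1..n})\<close>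
  is at least the reflection length of \<open>p\<close>.\<close>

definition rank_le :: "nat \<Rightarrow> nat \<Rightarrow> real \<Rightarrow> lin_op \<Rightarrow> bool" where
  "rank_le n k s u \<longleftrightarrow> u \<in> Spin n \<and> (\<exists>p h. lifts u p s \<and> p permutes {1..n} \<and>
     (\<forall>i. h (p i) = (h i :: nat)) \<and> n \<le> card (h ` {1..n}) + k)"

lemma rank_le_one: "rank_le n 0 1 1"
  unfolding rank_le_def
  by (intro conjI Spin.one exI[of _ id] exI[of _ "\<lambda>i. i"] lifts_one permutes_id) auto

lemma rank_le_tr:
  assumes "rank_le n k s u" "a \<in> {1..n}" "b \<in> {1..n}" "a \<noteq> b"
  shows "rank_le n (Suc k) (- s) (u * tr a b)"
proof -
  obtain p h where p: "lifts u p s" "p permutes {1..n}" "\<And>i. h (p i) = (h i :: nat)"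
    "n \<le> card (h ` {1..n}) + k" and u: "u \<in> Spin n"
    using assms(1) unfolding rank_le_def by blast
  \<comment> \<open>Merging the labels of \<open>a\<close> and \<open>b\<close> makes the labelling
    invariant under the new permutation and loses at most one label.\<close>
  define h' where "h' x = (if h x = h b then h a else h x)" for x
  have "h ` {1..n} \<subseteq> insert (h b) (h' ` {1..n})" by (auto simp: h'_def)
  then have "card (h ` {1..n}) \<le> card (insert (h b) (h' ` {1..n}))" by (intro card_mono) auto
  also have "\<dots> \<le> Suc (card (h' ` {1..n}))" by (rule card_insert_le_m1) auto
  finally have "n \<le> card (h' ` {1..n}) + Suc k" using p(4) by simp
  moreover have "h' ((p \<circ> transpose a b) i) = h' i" for i
    using p(3)[of "transpose a b i"] by (auto simp: h'_def transpose_def)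
  moreover have "lifts (u * tr a b) (p \<circ> transpose a b) (s * - 1)"
    using p(1) assms(4) by (intro lifts_mult lifts_tr)
  moreover have "p \<circ> transpose a b permutes {1..n}"
    using assms p(2) by (intro permutes_compose permutes_swap_id)
  moreover have "u * tr a b \<in> Spin n" using u assms by (intro Spin_mult Spin_tr)
  ultimately show ?thesis unfolding rank_le_def by (simp del: comp_apply) blast
qed

lemma rank_le_Suc:
  assumes "rank_le n k s u"
  shows "rank_le (Suc n) k s u"
proof -
  obtain p h where p: "lifts u p s" "p permutes {1..n}" "\<And>i. h (p i) = (h i :: nat)"
    "n \<le> card (h ` {1..n}) + k" and u: "u \<in> Spin n"
    using assms(1) unfolding rank_le_def by blast
  \<comment> \<open>The shift by \<open>Suc\<close> keeps \<open>0\<close> free as a fresh label for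
    the new fixed point.\<close>
  define h' where "h' x = (if x = Suc n then 0 else Suc (h x))" for x
  have pn: "p (Suc n) = Suc n" using p(2) by (simp add: permutes_def)
  then have "p i = Suc n \<longleftrightarrow> i = Suc n" for i using permutes_inj[OF p(2)] by (metis injD)
  then have "h' (p i) = h' i" for i using p(3)[of i] by (auto simp: h'_def)
  moreover have "h' ` {1..Suc n} = insert 0 (Suc ` (h ` {1..n}))"
    by (auto simp: h'_def image_iff atLeastAtMostSuc_conv)
  then have "card (h' ` {1..Suc n}) = Suc (card (h ` {1..n}))"
    by (simp add: card_image card_insert_if)
  moreover have "p permutes {1..Suc n}" using p(2) by (rule permutes_subset) auto
  moreover have "u \<in> Spin (Suc n)" using u by (rule Spin_mono[rotated]) simp
  ultimately show ?thesis using p(1,4) unfolding rank_le_def by (metis Suc_le_mono add_Suc)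
qed

lemma co_mult_JM_sq:
  "co (a * (JM k)\<^sup>2) u = (\<Sum>i\<in>{1..<k}. \<Sum>j\<in>{1..<k}. co a (u * (tr j k * tr i k)))"
proof -
  have "(JM k)\<^sup>2 = (\<Sum>i\<in>{1..<k}. \<Sum>j\<in>{1..<k}. gel (tr k i * tr k j))"
    by (simp add: JM_def power2_eq_square sum_product)
  moreover have "co (a * gel (tr k i * tr k j)) u = co a (u * (tr j k * tr i k))"
    if "i \<in> {1..<k}" "j \<in> {1..<k}" for i j
  proof (rule co_mult_gel)
    show "tr k i * tr k j * (tr j k * tr i k) = 1"
      using that by (simp add: tr_swap[of k] mult.assoc)
    show "tr j k * tr i k * (tr k i * tr k j) = 1"
      using that by (simp add: tr_swap[of k] mult.assoc)
  qed
  ultimately show ?thesis by (simp add: sum_distrib_left)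
qed

text \<open>Each factor \<open>(JM k)\<^sup>2\<close> is a sum of products of two reflections, so it
  raises the rank bound by two and leaves the parity \<open>1\<close> unchanged.\<close>

lemma JM_elem_support: "co (JM_elem r n) u \<noteq> 0 \<Longrightarrow> rank_le n (2 * r) 1 u"
proof (induction r n arbitrary: u rule: JM_elem.induct)
  case (1 n)
  then have "u = 1" by (metis co_gel gel_one JM_elem.simps(1))
  then show ?case using rank_le_one by simp
next
  case (2 r)
  then show ?case by simp
next
  case (3 r n)
  then consider "co (JM_elem (Suc r) n) u \<noteq> 0" | "co (JM_elem r n * (JM (Suc n))\<^sup>2) u \<noteq> 0"
    by (cases "co (JM_elem (Suc r) n) u = 0") auto
  then show ?case
  proof cases
    case 1
    then show ?thesis using 3(1) rank_le_Suc by blast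
  next
    case 2
    then obtain i j where ij: "i \<in> {1..<Suc n}" "j \<in> {1..<Suc n}"
      "co (JM_elem r n) (u * (tr j (Suc n) * tr i (Suc n))) \<noteq> 0"
      unfolding co_mult_JM_sq by (meson sum.not_neutral_contains_not_neutral)
    let ?v = "u * (tr j (Suc n) * tr i (Suc n))"
    have "rank_le (Suc n) (2 * r) 1 ?v" using 3(2) ij(3) rank_le_Suc by blast
    then have "rank_le (Suc n) (Suc (Suc (2 * r))) (- (- 1)) (?v * tr i (Suc n) * tr j (Suc n))"
      using ij by (intro rank_le_tr) auto
    moreover have "?v * tr i (Suc n) * tr j (Suc n) = u"
      using ij by (simp add: mult.assoc)
    ultimately show ?thesis by simp
  qed
qed

section \<open>Lifts of products of disjoint cycles\<close>

abbreviation sg :: "nat \<Rightarrow> lin_op \<Rightarrow> lin_op" where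
  "sg k u \<equiv> (- 1) ^ k *\<^sub>R u"

lemma neg_one_power_mem: "(- 1 :: real) ^ k \<in> {1, - 1}"
  by (cases "even k") auto

lemma sg_mem_Spin [simp]: "sg k u \<in> Spin n \<longleftrightarrow> u \<in> Spin n"
  by (cases "even k") auto

lemma lifts_sg [simp]: "lifts (sg k u) p s \<longleftrightarrow> lifts u p s"
  by (cases "even k") (auto simp: lifts_uminus_iff)

lemma Spin_cancel_right:
  assumes "g \<in> Spin n" "u * g = v * g"
  shows "u = v"
proof -
  obtain g' where "g * g' = 1" using Spin_inverse[OF assms(1)] .
  then have "u = (u * g) * g'" "v = (v * g) * g'" by (simp_all add: mult.assoc)
  then show ?thesis using assms(2) by simp
qed

text \<open>The cycle \<open>[i\<^sub>1, \<dots>, i\<^sub>m]\<close> of the paper; the empty product of reflections in it carries the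
  sign of \<open>x * x = - 1\<close>.\<close>

fun cyc :: "nat list \<Rightarrow> lin_op" where
  "cyc (i # j # cs) = sg (Suc (length cs)) (tr j i * cyc (j # cs))"
| "cyc _ = - 1"

lemma cyc_Spin: "distinct xs \<Longrightarrow> set xs \<subseteq> {1..n} \<Longrightarrow> cyc xs \<in> Spin n"
  by (induction xs rule: cyc.induct) (auto intro!: Spin_mult Spin_tr Spin.intros)

lemma lifts_cyc: "distinct xs \<Longrightarrow> lifts (cyc xs) (cycle_of_list xs) ((- 1) ^ (length xs - 1))"
proof (induction xs rule: cyc.induct)
  case (1 i j cs)
  have "lifts (tr j i) (transpose i j) (- 1)"
    using 1(2) lifts_tr[of j i] by (simp add: transpose_commute)
  from lifts_mult[OF this 1(1)] 1(2)
  show ?case unfolding cyc.simps lifts_sg cycle_of_list.simps by simp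
qed (use lifts_one in \<open>simp_all add: lifts_uminus_iff\<close>)

lemma lifts_cyc_conj:
  assumes "lifts g p s"
  shows "g * cyc xs = s ^ (length xs - 1) *\<^sub>R (cyc (map p xs) * g)"
proof (induction xs rule: cyc.induct)
  case (1 i j cs)
  have "g * cyc (i # j # cs) = sg (Suc (length cs)) (g * tr j i * cyc (j # cs))"
    by (simp add: mult.assoc)
  also have "\<dots> = s *\<^sub>R sg (Suc (length cs)) (tr (p j) (p i) * (g * cyc (j # cs)))"
    using lifts_tr_apply[OF assms, of j i] by (simp add: mult.assoc)
  also have "\<dots> = s ^ Suc (length cs) *\<^sub>R sg (Suc (length cs)) (tr (p j) (p i) * cyc (map p (j # cs)) * g)"
    using 1 by (simp add: mult.assoc mult.commute)
  also have "\<dots> = s ^ (length (i # j # cs) - 1) *\<^sub>R (cyc (map p (i # j # cs)) * g)"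
    by simp
  finally show ?case .
qed simp_all

text \<open>Conjugating a cycle by itself rotates its entries. For odd length the cycle is an even
  operator, so no sign appears; for positive even length the same computation would give
  \<open>- 1\<close>.\<close>

lemma cyc_rotate:
  assumes "distinct xs" "odd (length xs)" "set xs \<subseteq> {1..n}"
  shows "cyc (rotate k xs) = cyc xs"
proof (induction k)
  case (Suc k)
  let ?xs = "rotate k xs"
  have "distinct ?xs" "odd (length ?xs)" using assms by auto
  moreover from this have "map (cycle_of_list ?xs) ?xs = rotate1 ?xs"
    using cyclic_rotation[of ?xs 1] by simp
  ultimately have "cyc ?xs * cyc ?xs = cyc (rotate1 ?xs) * cyc ?xs"
    using lifts_cyc_conj[OF lifts_cyc, of ?xs ?xs] by simp
  moreover have "cyc ?xs \<in> Spin n" using assms by (intro cyc_Spin) auto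
  ultimately show ?case using Suc Spin_cancel_right by auto
qed simp

definition refl_len :: "nat list list \<Rightarrow> nat" where
  "refl_len cs = (\<Sum>c\<leftarrow>cs. length c - 1)"

definition cycs :: "nat list list \<Rightarrow> lin_op" where
  "cycs cs = prod_list (map cyc cs)"

definition cycs_perm :: "nat list list \<Rightarrow> nat \<Rightarrow> nat" where
  "cycs_perm cs = foldr (\<circ>) (map cycle_of_list cs) id"

lemma cycs_simps [simp]:
  "cycs [] = 1" "cycs (c # cs) = cyc c * cycs cs" "cycs (cs @ ds) = cycs cs * cycs ds"
  by (simp_all add: cycs_def)

lemma refl_len_simps [simp]:
  "refl_len [] = 0" "refl_len (c # cs) = length c - 1 + refl_len cs"
  "refl_len (cs @ ds) = refl_len cs + refl_len ds"
  by (simp_all add: refl_len_def)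

lemma cycs_perm_simps [simp]:
  "cycs_perm [] = id" "cycs_perm (c # cs) = cycle_of_list c \<circ> cycs_perm cs"
  by (simp_all add: cycs_perm_def)

definition disj_cycles :: "nat \<Rightarrow> nat list list \<Rightarrow> bool" where
  "disj_cycles n cs \<longleftrightarrow> distinct (concat cs) \<and> set (concat cs) \<subseteq> {1..n}"

lemma disj_cycles_simps [simp]:
  "disj_cycles n []"
  "disj_cycles n (c # cs) \<longleftrightarrow> distinct c \<and> set c \<subseteq> {1..n} \<and> disj_cycles n cs \<and>
     set c \<inter> set (concat cs) = {}"
  by (auto simp: disj_cycles_def)

lemma disj_cycles_append:
  "disj_cycles n (cs @ ds) \<longleftrightarrow> disj_cycles n cs \<and> disj_cycles n ds \<and>
     set (concat cs) \<inter> set (concat ds) = {}"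
  by (auto simp: disj_cycles_def)

lemma disj_cycles_memD:
  assumes "disj_cycles n cs" "c \<in> set cs"
  shows "distinct c" "set c \<subseteq> {1..n}"
  using assms by (induction cs) auto

lemma disj_cycles_disjoint:
  "disj_cycles n cs \<Longrightarrow> c \<in> set cs \<Longrightarrow> d \<in> set cs \<Longrightarrow> c \<noteq> d \<Longrightarrow> set c \<inter> set d = {}"
  by (induction cs) auto

lemma cycs_Spin: "disj_cycles n cs \<Longrightarrow> cycs cs \<in> Spin n"
  by (induction cs) (auto intro!: Spin_mult cyc_Spin Spin.one)

lemma lifts_cycs: "disj_cycles n cs \<Longrightarrow> lifts (cycs cs) (cycs_perm cs) ((- 1) ^ refl_len cs)"
proof (induction cs)
  case (Cons c cs)
  then have "distinct c" "lifts (cycs cs) (cycs_perm cs) ((- 1) ^ refl_len cs)" by simp_all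
  from lifts_mult[OF lifts_cyc[OF this(1)] this(2)] show ?case
    unfolding cycs_simps cycs_perm_simps refl_len_simps power_add .
qed (simp add: lifts_one)

lemma lifts_cycs_conj:
  assumes "lifts g p s"
  shows "g * cycs cs = s ^ refl_len cs *\<^sub>R (cycs (map (map p) cs) * g)"
proof (induction cs)
  case (Cons c cs)
  have "g * cycs (c # cs) = s ^ (length c - 1) *\<^sub>R (cyc (map p c) * (g * cycs cs))"
    using lifts_cyc_conj[OF assms, of c] by (simp flip: mult.assoc)
  then show ?case using Cons by (simp add: power_add mult.assoc)
qed simp

lemma cyc_cycs_commute:
  assumes "distinct c" "set c \<inter> set (concat cs) = {}"
  shows "cyc c * cycs cs = sg ((length c - 1) * refl_len cs) (cycs cs * cyc c)"
proof -
  have "map (map (cycle_of_list c)) cs = cs"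
    using assms(2) by (auto intro!: map_idI id_outside_supp)
  then show ?thesis using lifts_cycs_conj[OF lifts_cyc[OF assms(1)], of cs] by (simp add: power_mult)
qed

lemma refl_len_even: "\<forall>c\<in>set cs. odd (length c) \<Longrightarrow> even (refl_len cs)"
  by (induction cs) auto

lemma cyc_commute:
  assumes "distinct c" "set c \<inter> set d = {}" "odd (length c)"
  shows "cyc c * cyc d = cyc d * cyc c"
  using cyc_cycs_commute[of c "[d]"] assms by (simp add: power_mult)

lemma prod_list_mset_eq:
  fixes xs ys :: "'a :: monoid_mult list"
  assumes "mset xs = mset ys" "\<And>x y. x \<in> set xs \<Longrightarrow> y \<in> set xs \<Longrightarrow> x * y = y * x"
  shows "prod_list xs = prod_list ys"
  using assms
proof (induction xs arbitrary: ys)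
  case (Cons x xs)
  have "x \<in> set ys" using Cons.prems(1) by (metis list.set_intros(1) mset_eq_setD)
  then obtain as bs where ys: "ys = as @ x # bs" by (meson split_list)
  then have "mset xs = mset (as @ bs)" using Cons.prems(1) by simp
  then have "prod_list xs = prod_list (as @ bs)"
    by (rule Cons.IH) (use Cons.prems(2) in auto)
  moreover have "x * prod_list as = prod_list as * x"
  proof -
    have "set as \<subseteq> set (x # xs)" using Cons.prems(1) ys by (metis mset_eq_setD set_append Un_upper1)
    then have "\<forall>y\<in>set as. x * y = y * x" using Cons.prems(2) by auto
    then show ?thesis by (induction as) (auto simp: mult.assoc[symmetric], simp add: mult.assoc)
  qed
  ultimately show ?case using ys by (simp flip: mult.assoc)
qed simp

lemma cycs_mset_eq:
  assumes "disj_cycles n cs" "\<forall>c\<in>set cs. odd (length c)" "mset cs = mset ds"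
  shows "cycs cs = cycs ds"
  unfolding cycs_def
proof (rule prod_list_mset_eq)
  show "mset (map cyc cs) = mset (map cyc ds)" using assms(3) by simp
  fix x y assume "x \<in> set (map cyc cs)" "y \<in> set (map cyc cs)"
  then obtain c d where "c \<in> set cs" "d \<in> set cs" "x = cyc c" "y = cyc d" by auto
  then show "x * y = y * x"
    using cyc_commute[of c d] disj_cycles_disjoint[OF assms(1), of c d]
      disj_cycles_memD[OF assms(1)] assms(2) by (cases "c = d") auto
qed

subsection \<open>Orbits\<close>

lemma cycs_perm_outside: "x \<notin> set (concat cs) \<Longrightarrow> cycs_perm cs x = x"
  by (induction cs) (auto simp: id_outside_supp)

lemma cycs_perm_inside:
  assumes "disj_cycles n cs" "c \<in> set cs" "x \<in> set c"
  shows "cycs_perm cs x = cycle_of_list c x"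
  using assms
proof (induction cs)
  case (Cons d cs)
  show ?case
  proof (cases "c = d")
    case True
    then have "x \<notin> set (concat cs)" using Cons.prems by auto
    then show ?thesis using True cycs_perm_outside[of x cs] by simp
  next
    case False
    then have "cycs_perm cs x = cycle_of_list c x" "c \<in> set cs" using Cons by auto
    moreover have "cycle_of_list c x \<in> set c" using Cons.prems(3) cycle_permutes permutes_in_image by metis
    ultimately have "cycle_of_list c x \<notin> set d" using Cons.prems by auto
    then show ?thesis using \<open>cycs_perm cs x = _\<close> by (simp add: id_outside_supp)
  qed
qed simp

lemma cycs_perm_funpow:
  assumes "disj_cycles n cs" "c \<in> set cs" "x \<in> set c"
  shows "(cycs_perm cs ^^ i) x = (cycle_of_list c ^^ i) x \<and> (cycle_of_list c ^^ i) x \<in> set c"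
proof (induction i)
  case (Suc i)
  then have "(cycle_of_list c ^^ Suc i) x \<in> set c" using permutes_in_image[OF cycle_permutes[of c]] by simp
  then show ?case using Suc cycs_perm_inside[OF assms(1,2)] by simp
qed (use assms in simp)

lemma rotate_eq_orbit:
  assumes "disj_cycles n cs" "c \<in> set cs" "k < length c"
  shows "rotate k c = map (\<lambda>i. (cycs_perm cs ^^ i) (c ! k)) [0..<length c]"
proof (rule nth_equalityI)
  fix i assume "i < length (rotate k c)"
  then have i: "i < length c" by simp
  have "rotate k c ! i = rotate i c ! k" using i assms(3) by (simp add: nth_rotate add.commute)
  also have "\<dots> = (cycle_of_list c ^^ i) (c ! k)"
    using cyclic_rotation[OF disj_cycles_memD(1)[OF assms(1,2)], of i] assms(3) by (metis nth_map)
  also have "\<dots> = (cycs_perm cs ^^ i) (c ! k)" using cycs_perm_funpow[OF assms(1,2)] assms(3) by simp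
  finally show "rotate k c ! i = map (\<lambda>i. (cycs_perm cs ^^ i) (c ! k)) [0..<length c] ! i"
    using i by simp
qed simp

definition orb :: "(nat \<Rightarrow> nat) \<Rightarrow> nat \<Rightarrow> nat set" where
  "orb p x = range (\<lambda>i. (p ^^ i) x)"

text \<open>A canonical spelling of a cycle, started at the minimum of its support, which depends
  only on the permutation and the support.\<close>

definition orb_cyc :: "(nat \<Rightarrow> nat) \<Rightarrow> nat set \<Rightarrow> lin_op" where
  "orb_cyc p A = cyc (map (\<lambda>i. (p ^^ i) (Min A)) [0..<card A])"

lemma set_eq_orb:
  assumes "disj_cycles n cs" "c \<in> set cs" "x \<in> set c"
  shows "set c = orb (cycs_perm cs) x"
proof
  obtain k where k: "k < length c" "x = c ! k" using assms(3) by (metis in_set_conv_nth)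
  have "set c = set (rotate k c)" by simp
  then show "set c \<subseteq> orb (cycs_perm cs) x"
    unfolding rotate_eq_orbit[OF assms(1,2) k(1)] orb_def k(2) by auto
  show "orb (cycs_perm cs) x \<subseteq> set c"
    unfolding orb_def using cycs_perm_funpow[OF assms] by auto
qed

lemma cyc_eq_orb_cyc:
  assumes "disj_cycles n cs" "c \<in> set cs" "odd (length c)"
  shows "cyc c = orb_cyc (cycs_perm cs) (set c)"
proof -
  have c: "distinct c" "set c \<subseteq> {1..n}" using disj_cycles_memD[OF assms(1,2)] by auto
  have "Min (set c) \<in> set c" using assms(3) by (intro Min_in) (auto elim: oddE)
  then obtain k where k: "k < length c" "Min (set c) = c ! k" by (metis in_set_conv_nth)
  have "cyc c = cyc (rotate k c)" using cyc_rotate[OF c(1) assms(3) c(2)] by simp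
  also have "\<dots> = orb_cyc (cycs_perm cs) (set c)"
    unfolding rotate_eq_orbit[OF assms(1,2) k(1)] orb_cyc_def k(2) distinct_card[OF c(1)] ..
  finally show ?thesis .
qed

lemma cycs_perm_moves:
  assumes "disj_cycles n cs" "c \<in> set cs" "x \<in> set c" "2 \<le> length c"
  shows "cycs_perm cs x \<noteq> x"
proof
  assume "cycs_perm cs x = x"
  then have "(cycs_perm cs ^^ i) x = x" for i by (induction i) auto
  then have "set c = {x}" using set_eq_orb[OF assms(1-3)] by (auto simp: orb_def)
  then show False using assms(4) distinct_card[OF disj_cycles_memD(1)[OF assms(1,2)]] by simp
qed

text \<open>The supports are the orbits of the moved points, hence determined by the permutation;
  disjointness and nonemptiness exclude repetitions, so the multisets agree too.\<close>

lemma mset_cycs_supports: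
  assumes "disj_cycles n cs" "\<forall>c\<in>set cs. 2 \<le> length c"
  shows "mset (map set cs) = mset_set (orb (cycs_perm cs) ` {x. cycs_perm cs x \<noteq> x})"
proof -
  have "set (map set cs) = orb (cycs_perm cs) ` {x. cycs_perm cs x \<noteq> x}"
  proof (rule equalityI; rule subsetI)
    fix A assume "A \<in> set (map set cs)"
    then obtain c where c: "c \<in> set cs" "A = set c" by auto
    then have "hd c \<in> set c" using assms(2) by (intro hd_in_set) auto
    then show "A \<in> orb (cycs_perm cs) ` {x. cycs_perm cs x \<noteq> x}"
      using c set_eq_orb[OF assms(1)] cycs_perm_moves[OF assms(1)] assms(2) by blast
  next
    fix A assume "A \<in> orb (cycs_perm cs) ` {x. cycs_perm cs x \<noteq> x}"
    then obtain x where x: "cycs_perm cs x \<noteq> x" "A = orb (cycs_perm cs) x" by auto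
    then obtain c where "c \<in> set cs" "x \<in> set c" using cycs_perm_outside[of x cs] by auto
    then show "A \<in> set (map set cs)" using x set_eq_orb[OF assms(1)] by auto
  qed
  moreover have "distinct (map set cs)"
    using assms
  proof (induction cs)
    case (Cons c cs)
    have "set c \<noteq> set d" if "d \<in> set cs" for d
    proof
      assume cd: "set c = set d"
      have "set c \<subseteq> set (concat cs)" unfolding cd using that by auto
      moreover have "set c \<inter> set (concat cs) = {}" using Cons.prems(1) by simp
      ultimately have "set c = {}" by (metis Int_absorb2)
      then show False using Cons.prems(2) by auto
    qed
    then show ?case using Cons by auto
  qed simp
  ultimately show ?thesis by (metis mset_set_set)
qed

definition odd_cycles :: "nat \<Rightarrow> nat list list \<Rightarrow> bool" where
  "odd_cycles n cs \<longleftrightarrow> disj_cycles n cs \<and> (\<forall>c\<in>set cs. odd (length c) \<and> 2 \<le> length c)"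

text \<open>Of the two lifts of a permutation at most one is a product of disjoint odd cycles: the
  supports are orbits, an odd cycle is the \<open>orb_cyc\<close> of its support, and odd cycles
  commute. This is what separates a class from its negative.\<close>

theorem odd_cycles_unique:
  assumes "odd_cycles n cs" "odd_cycles n ds" "cycs_perm cs = cycs_perm ds"
  shows "cycs cs = cycs ds" "mset (map length cs) = mset (map length ds)"
proof -
  let ?p = "cycs_perm cs"
  have cs: "disj_cycles n cs" "disj_cycles n ds" "\<forall>c\<in>set cs. 2 \<le> length c" "\<forall>c\<in>set ds. 2 \<le> length c"
    "\<forall>c\<in>set cs. odd (length c)" "\<forall>c\<in>set ds. odd (length c)"
    using assms(1,2) by (auto simp: odd_cycles_def)
  have eq: "mset (map set cs) = mset (map set ds)"
    using mset_cycs_supports[OF cs(1,3)] mset_cycs_supports[OF cs(2,4)] assms(3) by simp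
  have "map length cs = map card (map set cs)" "map length ds = map card (map set ds)"
    using disj_cycles_memD(1)[OF cs(1)] disj_cycles_memD(1)[OF cs(2)] by (auto simp: distinct_card)
  then show "mset (map length cs) = mset (map length ds)" using eq by (metis mset_map)
  have "map cyc cs = map (orb_cyc ?p) (map set cs)" "map cyc ds = map (orb_cyc ?p) (map set ds)"
    using cyc_eq_orb_cyc[OF cs(1)] cyc_eq_orb_cyc[OF cs(2)] cs(5,6) assms(3) by auto
  then have "mset (map cyc cs) = mset (map cyc ds)" using eq by (metis mset_map)
  then show "cycs cs = cycs ds"
    unfolding cycs_def
  proof (rule prod_list_mset_eq)
    fix x y assume "x \<in> set (map cyc cs)" "y \<in> set (map cyc cs)"
    then obtain c d where "c \<in> set cs" "d \<in> set cs" "x = cyc c" "y = cyc d" by auto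
    then show "x * y = y * x"
      using cyc_commute[of c d] disj_cycles_disjoint[OF cs(1), of c d]
        disj_cycles_memD[OF cs(1)] cs(5) by (cases "c = d") auto
  qed
qed

lemma cycle_decomp_cycs:
  assumes "cycle_decomp S p"
  shows "\<exists>cs. distinct (concat cs) \<and> set (concat cs) \<subseteq> S \<and> (\<forall>c\<in>set cs. 2 \<le> length c) \<and> cycs_perm cs = p"
  using assms
proof induction
  case empty
  show ?case by (intro exI[of _ "[]"]) simp
next
  case (comp I p c)
  then obtain cs where cs: "distinct (concat cs)" "set (concat cs) \<subseteq> I" "\<forall>c\<in>set cs. 2 \<le> length c"
    "cycs_perm cs = p" by blast
  show ?case
  proof (cases "2 \<le> length c")
    case True
    then show ?thesis using cs comp by (intro exI[of _ "c # cs"]) auto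
  next
    case False
    then have "c = [] \<or> (\<exists>x. c = [x])" by (cases c; cases "tl c") auto
    then have "cycle_of_list c = id" by auto
    then show ?thesis using cs by (intro exI[of _ cs]) auto
  qed
qed

lemma permutes_eq_cycs_perm:
  assumes "p permutes {1..n}"
  obtains cs where "disj_cycles n cs" "\<forall>c\<in>set cs. 2 \<le> length c" "cycs_perm cs = p"
  using cycle_decomp_cycs[OF cycle_decomposition[OF assms]] that
  by (auto simp: disj_cycles_def)

lemma Spin_eq_cycs:
  assumes "u \<in> Spin n" "lifts u p s" "p permutes {1..n}" "s \<in> {1, - 1}"
  obtains cs where "disj_cycles n cs" "\<forall>c\<in>set cs. 2 \<le> length c" "u = cycs cs \<or> u = - cycs cs"
    "s = (- 1) ^ refl_len cs"
proof -
  obtain cs where cs: "disj_cycles n cs" "\<forall>c\<in>set cs. 2 \<le> length c" "cycs_perm cs = p"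
    using permutes_eq_cycs_perm[OF assms(3)] .
  have l: "lifts (cycs cs) p ((- 1) ^ refl_len cs)" using lifts_cycs[OF cs(1)] unfolding cs(3) .
  have *: "u = cycs cs \<or> u = - cycs cs"
    by (rule Spin_eq_up_to_sign[OF assms(1) cycs_Spin[OF cs(1)] assms(2) l assms(4) neg_one_power_mem])
  then have "lifts u p ((- 1) ^ refl_len cs)" using l lifts_uminus by blast
  then have "s = (- 1) ^ refl_len cs"
    by (rule Spin_lifts_unique(2)[OF assms(1,2) _ assms(4) neg_one_power_mem])
  with cs * show ?thesis using that by blast
qed

lemma permutes_map_eq:
  assumes "distinct xs" "distinct ys" "length xs = length ys" "set xs \<subseteq> S" "set ys \<subseteq> S"
  obtains p where "p permutes S" "map p xs = ys"
proof -
  from assms(3,1,2,4,5) have "\<exists>p. p permutes S \<and> map p xs = ys"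
  proof (induction xs ys rule: list_induct2)
    case Nil
    show ?case by (rule exI[of _ id], rule conjI[OF permutes_id]) simp
  next
    case (Cons x xs y ys)
    then obtain p where p: "p permutes S" "map p xs = ys" by auto
    have "p x \<notin> p ` set xs" using Cons.prems(1) inj_image_mem_iff[OF permutes_inj[OF p(1)]] by simp
    then have "p x \<notin> set ys" using p(2) by auto
    moreover have "y \<notin> set ys" using Cons.prems(2) by simp
    ultimately have "map (transpose (p x) y) ys = ys"
      by (intro map_idI transpose_apply_other) auto
    then have 1: "map (transpose (p x) y \<circ> p) (x # xs) = y # ys"
      unfolding map_map[symmetric] list.map p(2) by simp
    have "p x \<in> S" "y \<in> S" using Cons.prems permutes_in_image[OF p(1), of x] by auto
    then have "transpose (p x) y \<circ> p permutes S"
      using p(1) by (intro permutes_compose permutes_swap_id)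
    with 1 show ?case by (intro exI[of _ "transpose (p x) y \<circ> p"] conjI)
  qed
  then show ?thesis using that by blast
qed

lemma map_map_concat_eq:
  "map length cs = map length ds \<Longrightarrow> map f (concat cs) = concat ds \<Longrightarrow> map (map f) cs = ds"
proof (induction cs arbitrary: ds)
  case (Cons c cs)
  then obtain d ds' where ds: "ds = d # ds'" "length c = length d" by (cases ds) auto
  then have "map f c = d" "map f (concat cs) = concat ds'" using Cons.prems(2) by auto
  then show ?case using Cons ds by auto
qed simp

text \<open>Matching the entries gives a permutation of the points, lifted by the product of its own
  cycles. Its parity enters with the exponent \<open>refl_len cs\<close>, which is even, so the
  conjugation produces no sign.\<close>

lemma cycs_conjugate:
  assumes "odd_cycles n cs" "odd_cycles n ds" "map length cs = map length ds"
  obtains g where "g \<in> Spin n" "g * cycs cs = cycs ds * g"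
proof -
  have "length (concat cs) = length (concat ds)" using assms(3) by (simp add: length_concat)
  then obtain p where p: "p permutes {1..n}" "map p (concat cs) = concat ds"
    using permutes_map_eq[of "concat cs" "concat ds" "{1..n}"] assms(1,2)
    by (auto simp: odd_cycles_def disj_cycles_def)
  obtain es where es: "disj_cycles n es" "cycs_perm es = p" using permutes_eq_cycs_perm[OF p(1)] .
  have "map (map p) cs = ds" using map_map_concat_eq[OF assms(3) p(2)] .
  moreover have "even (refl_len cs)" using assms(1) by (intro refl_len_even) (auto simp: odd_cycles_def)
  ultimately have "cycs es * cycs cs = cycs ds * cycs es"
    using lifts_cycs_conj[OF lifts_cycs[OF es(1)], of cs] es(2)
    by (simp flip: power_mult)
  then show ?thesis using that cycs_Spin[OF es(1)] by blast
qed

subsection \<open>The coefficients that vanish\<close>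

lemma co_JM_elem_odd:
  assumes "u \<in> Spin n" "lifts u p (- 1)"
  shows "co (JM_elem r n) u = 0"
proof (rule ccontr)
  assume "co (JM_elem r n) u \<noteq> 0"
  then obtain q where "lifts u q 1" using JM_elem_support unfolding rank_le_def by blast
  from Spin_lifts_unique(2)[OF assms(1,2) this] show False by simp
qed

text \<open>Two odd operators with disjoint supports anticommute. Conjugation by the even-length
  cycle therefore negates the product, while centrality keeps the coefficient.\<close>

lemma co_JM_elem_even_cycle:
  assumes "distinct c" "set c \<subseteq> {1..n}" "even (length c)" "2 \<le> length c"
    "set c \<inter> set (concat cs) = {}" "odd (refl_len cs)"
  shows "co (JM_elem r n) (cyc c * cycs cs) = co (JM_elem r n) (- (cyc c * cycs cs))"
proof (rule co_JM_elem_conj[OF cyc_Spin[OF assms(1,2)]])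
  have "odd (length c - 1)" using assms(3,4) by (cases c) auto
  then have "cyc c * cycs cs = - (cycs cs * cyc c)"
    using cyc_cycs_commute[OF assms(1,5)] assms(6) by simp
  then have "cyc c * (cyc c * cycs cs) = cyc c * - (cycs cs * cyc c)" by (rule arg_cong)
  then show "cyc c * (cyc c * cycs cs) = - (cyc c * cycs cs) * cyc c" by (simp add: mult.assoc)
qed

lemma co_JM_elem_cases:
  assumes "u \<in> Spin n" "co (JM_elem r n) u \<noteq> co (JM_elem r n) (- u)"
  obtains cs where "odd_cycles n cs" "u = cycs cs \<or> u = - cycs cs"
proof -
  obtain p s where p: "lifts u p s" "p permutes {1..n}" "s \<in> {1, - 1}" using Spin_lifts[OF assms(1)] .
  have "s = 1"
  proof (rule ccontr)
    assume "s \<noteq> 1"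
    then have "lifts u p (- 1)" using p by auto
    then show False using assms co_JM_elem_odd[of u n p r] co_JM_elem_odd[of "- u" n p r]
      by (simp add: lifts_uminus_iff)
  qed
  obtain cs where cs: "disj_cycles n cs" "\<forall>c\<in>set cs. 2 \<le> length c" "u = cycs cs \<or> u = - cycs cs"
    "s = (- 1) ^ refl_len cs" using Spin_eq_cycs[OF assms(1) p] .
  have even: "even (refl_len cs)" using cs(4) \<open>s = 1\<close> by (cases "even (refl_len cs)") auto
  have "odd (length c)" if c: "c \<in> set cs" for c
  proof (rule ccontr)
    assume ec: "\<not> odd (length c)"
    obtain as bs where abs: "cs = as @ c # bs" using c by (meson split_list)
    have c': "distinct c" "set c \<subseteq> {1..n}" "2 \<le> length c" "set c \<inter> set (concat (as @ bs)) = {}"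
      "set c \<inter> set (concat as) = {}"
      using cs(1,2) unfolding abs disj_cycles_append by auto
    \<comment> \<open>The total parity is even, so removing a cycle of even length leaves an odd
      rest. Moving that cycle to the front costs at most a sign, which is harmless since the
      coefficients at \<open>u\<close> and \<open>- u\<close> are being compared.\<close>
    have "odd (refl_len (as @ bs))" using even ec c'(3) by (auto simp: abs)
    then have *: "co (JM_elem r n) (cyc c * cycs (as @ bs)) = co (JM_elem r n) (- (cyc c * cycs (as @ bs)))"
      using c' ec by (intro co_JM_elem_even_cycle) auto
    have "cycs as * cyc c = cyc c * cycs as \<or> cycs as * cyc c = - (cyc c * cycs as)"
      using cyc_cycs_commute[OF c'(1,5)] by (cases "even ((length c - 1) * refl_len as)") auto
    then have "cycs cs = cyc c * cycs (as @ bs) \<or> cycs cs = - (cyc c * cycs (as @ bs))"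
      unfolding abs by (auto simp: mult.assoc[symmetric])
    then show False using * cs(3) assms(2) by auto
  qed
  then have "odd_cycles n cs" using cs by (auto simp: odd_cycles_def)
  then show ?thesis using that cs(3) by blast
qed

section \<open>Catalan numbers\<close>

text \<open>The convolution recurrence is the form in which cutting cycles produces these numbers;
  the binomial form enters only through \<open>of_nat_catalan\<close>.\<close>

fun catalan :: "nat \<Rightarrow> nat" where
  "catalan 0 = 1"
| "catalan (Suc n) = (\<Sum>i\<le>n. catalan i * catalan (n - i))"

lemma central_binomial_Suc:
  "Suc k * (2 * Suc k choose Suc k) = 2 * (2 * k + 1) * (2 * k choose k)"
proof -
  have "Suc k * (Suc (2 * k + 1) choose Suc k) = Suc (2 * k + 1) * (2 * k + 1 choose k)"
    by (rule Suc_times_binomial)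
  moreover have "(2 * k + 1 - k) * (2 * k + 1 choose k) = (2 * k + 1) * ((2 * k + 1 - 1) choose k)"
    by (rule binomial_absorb_comp)
  ultimately show ?thesis by (simp add: algebra_simps)
qed

lemma Cat_Suc_Suc: "of_nat (k + 2) * Cat (Suc (Suc k)) = of_nat (4 * k + 2) * Cat (Suc k)"
proof -
  have "rat_of_nat (Suc k * (2 * Suc k choose Suc k)) = of_nat (2 * (2 * k + 1) * (2 * k choose k))"
    by (simp only: central_binomial_Suc)
  then show ?thesis by (simp add: Cat_def field_simps del: binomial_Suc_Suc)
qed

text \<open>The symmetry \<open>i\<close> to \<open>m - i\<close> pairs the weights
  \<open>i + 1\<close> and \<open>m - i + 1\<close>, whose sum \<open>m + 2\<close> is
  constant.\<close>

lemma weighted_self_convolution: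
  fixes f :: "nat \<Rightarrow> rat"
  shows "2 * (\<Sum>i\<le>m. of_nat (i + 1) * (f i * f (m - i))) = of_nat (m + 2) * (\<Sum>i\<le>m. f i * f (m - i))"
proof -
  let ?T = "\<Sum>i\<le>m. of_nat (i + 1) * (f i * f (m - i))"
  have "?T = (\<Sum>i\<le>m. of_nat (m - i + 1) * (f i * f (m - i)))"
    by (rule sum.reindex_bij_witness[of _ "\<lambda>i. m - i" "\<lambda>i. m - i"]) (auto simp: mult.commute)
  then have "?T + ?T = (\<Sum>i\<le>m. (of_nat (i + 1) + of_nat (m - i + 1)) * (f i * f (m - i)))"
    by (simp only: distrib_right sum.distrib)
  also have "\<dots> = (\<Sum>i\<le>m. of_nat (m + 2) * (f i * f (m - i)))"
  proof (rule sum.cong)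
    fix i assume "i \<in> {..m}"
    then have "i + 1 + (m - i + 1) = m + 2" by simp
    then show "(of_nat (i + 1) + of_nat (m - i + 1)) * (f i * f (m - i)) =
        of_nat (m + 2) * (f i * f (m - i))" by (simp only: of_nat_add[symmetric])
  qed simp
  finally show ?thesis by (simp only: mult_2 sum_distrib_left[symmetric])
qed

text \<open>The first-order recurrence turns the weighted sum for \<open>n + 1\<close> into the plain sum for \<open>n\<close>.\<close>

lemma Cat_convolution: "(\<Sum>i\<le>n. Cat (Suc i) * Cat (Suc (n - i))) = Cat (Suc (Suc n))"
proof (induction n)
  case 0
  show ?case by (simp add: Cat_def)
next
  case (Suc n)
  define S where "S m = (\<Sum>i\<le>m. Cat (Suc i) * Cat (Suc (m - i)))" for m
  define T where "T m = (\<Sum>i\<le>m. of_nat (i + 1) * (Cat (Suc i) * Cat (Suc (m - i))))" for m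
  let ?C = "Cat (Suc (Suc n))"
  have w: "2 * T m = of_nat (m + 2) * S m" for m
    unfolding T_def S_def by (rule weighted_self_convolution[of "\<lambda>i. Cat (Suc i)"])
  have "T (Suc n) = Cat 1 * ?C +
      (\<Sum>i\<le>n. of_nat (i + 2) * Cat (Suc (Suc i)) * Cat (Suc (n - i)))"
    unfolding T_def by (subst sum.atMost_Suc_shift) (simp add: mult.assoc)
  also have "(\<Sum>i\<le>n. of_nat (i + 2) * Cat (Suc (Suc i)) * Cat (Suc (n - i))) =
      (\<Sum>i\<le>n. 4 * (of_nat (i + 1) * (Cat (Suc i) * Cat (Suc (n - i)))) -
        2 * (Cat (Suc i) * Cat (Suc (n - i))))"
    unfolding Cat_Suc_Suc by (intro sum.cong) (simp_all add: algebra_simps)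
  also have "\<dots> = 4 * T n - 2 * S n" by (simp add: T_def S_def sum_subtractf sum_distrib_left)
  finally have "T (Suc n) = ?C + 4 * T n - 2 * S n" by (simp add: Cat_def)
  moreover have "S n = ?C" using Suc by (simp add: S_def)
  moreover have "2 * T n = of_nat (n + 2) * S n" "2 * T (Suc n) = of_nat (Suc n + 2) * S (Suc n)"
    by (rule w)+
  ultimately have "of_nat (n + 3) * S (Suc n) = of_nat (4 * Suc n + 2) * ?C"
    by (simp add: algebra_simps)
  also have "\<dots> = of_nat (n + 3) * Cat (Suc (Suc (Suc n)))"
    unfolding Cat_Suc_Suc[symmetric] by simp
  finally have "S (Suc n) = Cat (Suc (Suc (Suc n)))"
    by (metis mult_cancel_left of_nat_eq_0_iff add_is_0 zero_neq_numeral)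
  then show ?case by (simp add: S_def)
qed

lemma of_nat_catalan: "of_nat (catalan k) = Cat (k + 1)"
proof (induction k rule: less_induct)
  case (less k)
  show ?case
  proof (cases k)
    case 0
    then show ?thesis by (simp add: Cat_def)
  next
    case (Suc n)
    then show ?thesis using Cat_convolution[of n] less by simp
  qed
qed

section \<open>The coefficients in top degree\<close>

definition wind :: "nat \<Rightarrow> nat list \<Rightarrow> lin_op" where
  "wind N ys = prod_list (map (\<lambda>y. tr y N) (rev ys))"

lemma wind_simps [simp]:
  "wind N [] = 1" "wind N (y # ys) = wind N ys * tr y N" "wind N (xs @ ys) = wind N ys * wind N xs"
  by (simp_all add: wind_def)

lemma cyc_tr_fixed:
  assumes "distinct xs" "a \<notin> set xs" "b \<notin> set xs"
  shows "cyc xs * tr a b = sg (length xs - 1) (tr a b * cyc xs)"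
  using lifts_tr_apply[OF lifts_cyc[OF assms(1)], of a b] assms by (simp add: id_outside_supp)

text \<open>The defining word of a cycle, for an auxiliary point \<open>N\<close>.\<close>

lemma cyc_eq_wind:
  assumes "distinct xs" "N \<notin> set xs" "xs \<noteq> []"
  shows "tr (hd xs) N * wind N xs = cyc xs"
  using assms
proof (induction xs rule: cyc.induct)
  case (1 i j cs)
  have ij: "i \<noteq> j" "i \<noteq> N" "j \<noteq> N" using 1(2,3) by auto
  have "wind N (j # cs) = - (tr j N * (tr j N * wind N (j # cs)))" using ij by simp
  also have "tr j N * wind N (j # cs) = cyc (j # cs)" using 1 by simp
  finally have w: "wind N (j # cs) = - (tr j N * cyc (j # cs))" .
  have "tr i N * tr j N * tr i N = tr j i"
  proof -
    have "tr i N * tr j N = - (tr j i * tr i N)" using tr_conj[of i N j N] ij by simp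
    then show ?thesis using ij by (simp add: mult.assoc)
  qed
  moreover have "cyc (j # cs) * tr i N = sg (length cs) (tr i N * cyc (j # cs))"
    using cyc_tr_fixed[of "j # cs" i N] 1(2,3) by simp
  ultimately show ?case using w by (simp add: mult.assoc) (simp flip: mult.assoc)
qed simp_all

lemma wind_eq_cyc:
  assumes "distinct xs" "N \<notin> set xs" "xs \<noteq> []"
  shows "wind N xs = - (tr (hd xs) N * cyc xs)"
proof -
  have "hd xs \<noteq> N" using assms by auto
  then show ?thesis unfolding cyc_eq_wind[OF assms, symmetric] by simp
qed

lemma cyc_Cons_eq_wind:
  assumes "distinct xs" "N \<notin> set xs" "xs \<noteq> []"
  shows "cyc (N # xs) = sg (Suc (length xs)) (wind N xs)"
proof -
  have "cyc (N # xs) = sg (length xs) (tr (hd xs) N * cyc xs)" using assms(3) by (cases xs) auto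
  then show ?thesis unfolding wind_eq_cyc[OF assms] by simp
qed

lemma cycle_of_list_last:
  assumes "distinct xs" "xs \<noteq> []"
  shows "cycle_of_list xs (last xs) = hd xs"
proof -
  have "map (cycle_of_list xs) xs = rotate1 xs" using cyclic_rotation[OF assms(1), of 1] by simp
  then have "cycle_of_list xs (last xs) = last (rotate1 xs)" using assms(2) by (metis last_map)
  then show ?thesis using assms(2) by (cases xs) auto
qed

text \<open>The cycle sends its last entry to its head and fixes \<open>N\<close>, so carrying the
  reflection from the left of \<open>cyc xs\<close> to the right replaces \<open>hd xs\<close> by
  \<open>last xs\<close>.\<close>

lemma wind_eq_cyc_last:
  assumes "distinct xs" "N \<notin> set xs" "xs \<noteq> []"
  shows "wind N xs = - sg (length xs - 1) (cyc xs * tr (last xs) N)"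
proof -
  have "cyc xs * tr (last xs) N = sg (length xs - 1) (tr (hd xs) N * cyc xs)"
    using lifts_tr_apply[OF lifts_cyc[OF assms(1)], of "last xs" N] assms
    by (simp add: id_outside_supp cycle_of_list_last)
  then show ?thesis by (simp add: wind_eq_cyc[OF assms] flip: power_add mult_2)
qed

text \<open>The word of the cycle through \<open>N\<close> breaks into the words of
  \<open>ys\<close> and \<open>xs\<close>, each a cycle times one reflection through
  \<open>N\<close>. A summand of the squared Jucys-Murphy element cancels these two reflections, and
  for odd \<open>length xs\<close> the sign is the \<open>- 1\<close> of the recursion.\<close>

lemma cyc_split:
  assumes "distinct (xs @ ys)" "N \<notin> set (xs @ ys)" "xs \<noteq> []" "ys \<noteq> []"
  shows "cyc (N # xs @ ys) = sg (length xs) (cyc ys * cyc xs * (tr (last ys) N * tr (last xs) N))"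
proof -
  have "last ys \<in> set ys" using assms(4) by simp
  then have l: "last ys \<notin> set xs" using assms(1) by auto
  have e: "length (xs @ ys) = length xs - 1 + (length ys - 1) + 2" using assms(3,4) by (cases xs; cases ys) auto
  have "cyc xs * tr (last ys) N = sg (length xs - 1) (tr (last ys) N * cyc xs)"
    using assms l by (intro cyc_tr_fixed) auto
  then have 1: "tr (last ys) N * cyc xs = sg (length xs - 1) (cyc xs * tr (last ys) N)"
    by (simp flip: power_add mult_2)
  have "cyc (N # xs @ ys) = sg (Suc (length (xs @ ys))) (wind N ys * wind N xs)"
    using cyc_Cons_eq_wind[of "xs @ ys" N] assms by simp
  also have "wind N ys * wind N xs = sg (length ys - 1) (sg (length xs - 1)
      (cyc ys * (tr (last ys) N * cyc xs) * tr (last xs) N))"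
    using assms by (simp add: wind_eq_cyc_last mult.assoc)
  also have "\<dots> = sg (length ys - 1) (cyc ys * cyc xs * (tr (last ys) N * tr (last xs) N))"
    unfolding 1 by (simp add: mult.assoc flip: power_add mult_2)
  also have "sg (Suc (length (xs @ ys))) \<dots> =
      sg (length xs) (cyc ys * cyc xs * (tr (last ys) N * tr (last xs) N))"
  proof -
    have "even (Suc (length (xs @ ys)) + (length ys - 1)) \<longleftrightarrow> even (length xs)"
      using assms(4) by (cases ys) auto
    then have "(- 1 :: real) ^ (Suc (length (xs @ ys)) + (length ys - 1)) = (- 1) ^ length xs"
      by (cases "even (length xs)") (simp_all del: length_append)
    then show ?thesis by (simp only: scaleR_scaleR power_add)
  qed
  finally show ?thesis .
qed

text \<open>The coefficient that remains once \<open>z\<close> is identified with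
  \<open>- 1\<close>: then \<open>gel (- u)\<close> becomes the negative of
  \<open>gel u\<close>.\<close>

definition co_diff :: "nat \<Rightarrow> nat \<Rightarrow> lin_op \<Rightarrow> int" where
  "co_diff r n u = co (JM_elem r n) u - co (JM_elem r n) (- u)"

lemma co_diff_uminus [simp]: "co_diff r n (- u) = - co_diff r n u"
  by (simp add: co_diff_def)

lemma co_diff_support:
  assumes "co_diff r n u \<noteq> 0"
  shows "rank_le n (2 * r) 1 u"
proof -
  have "rank_le n (2 * r) 1 u \<or> rank_le n (2 * r) 1 (- u)"
    using assms JM_elem_support[of r n u] JM_elem_support[of r n "- u"]
    by (cases "co (JM_elem r n) u = 0") (auto simp: co_diff_def)
  then show ?thesis
    unfolding rank_le_def lifts_uminus_iff Spin_uminus_iff by blast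
qed

lemma co_diff_Suc_Suc:
  "co_diff (Suc r) (Suc n) u = co_diff (Suc r) n u +
     (\<Sum>i\<in>{1..n}. \<Sum>j\<in>{1..n}. co_diff r n (u * (tr j (Suc n) * tr i (Suc n))))"
proof -
  have "{1..<Suc n} = {1..n}" by auto
  then show ?thesis by (simp add: co_diff_def co_mult_JM_sq sum_subtractf)
qed

section \<open>Counting invariant labellings\<close>

lemma invariant_on_cycle:
  assumes "disj_cycles n cs" "c \<in> set cs" "h \<circ> cycs_perm cs = h" "x \<in> set c"
  shows "h x = h (hd c)"
proof -
  have "h ((cycs_perm cs ^^ i) y) = h y" for i y
    using fun_cong[OF assms(3)] by (induction i) auto
  moreover have "hd c \<in> set c" using assms(4) by (cases c) auto
  then have "x \<in> orb (cycs_perm cs) (hd c)" using set_eq_orb[OF assms(1,2)] assms(4) by blast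
  ultimately show ?thesis by (auto simp: orb_def)
qed

text \<open>One point for each cycle together with all points outside the cycles; an invariant
  labelling takes all its values there.\<close>

definition cycle_reps :: "nat \<Rightarrow> nat list list \<Rightarrow> nat set" where
  "cycle_reps n cs = {1..n} - set (concat cs) \<union> hd ` set cs"

lemma card_cycle_reps:
  assumes "disj_cycles n cs" "\<forall>c\<in>set cs. c \<noteq> []"
  shows "card (cycle_reps n cs) + refl_len cs \<le> n"
proof -
  have "length (concat cs) = refl_len cs + length cs"
    using assms(2) by (induction cs) (auto simp: Suc_le_eq)
  moreover have c: "card (set (concat cs)) = length (concat cs)" "set (concat cs) \<subseteq> {1..n}"
    using assms(1) by (simp_all only: disj_cycles_def distinct_card)
  moreover have "card ({1..n} - set (concat cs)) = n - card (set (concat cs))"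
    using c(2) by (simp add: card_Diff_subset)
  moreover have "card (set (concat cs)) \<le> n" using card_mono[OF _ c(2)] by simp
  moreover have "card (hd ` set cs) \<le> length cs"
    using card_image_le[of "set cs" hd] card_length[of cs] by simp
  moreover have "card (cycle_reps n cs) \<le> card ({1..n} - set (concat cs)) + card (hd ` set cs)"
    unfolding cycle_reps_def by (rule card_Un_le)
  ultimately show ?thesis by linarith
qed

lemma invariant_image_cycle_reps:
  assumes "disj_cycles n cs" "h \<circ> cycs_perm cs = h"
  shows "h ` {1..n} \<subseteq> h ` cycle_reps n cs"
proof
  fix y assume "y \<in> h ` {1..n}"
  then obtain x where x: "x \<in> {1..n}" "y = h x" by auto
  show "y \<in> h ` cycle_reps n cs"
  proof (cases "x \<in> set (concat cs)")
    case True
    then obtain c where c: "c \<in> set cs" "x \<in> set c" by auto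
    then have "h x = h (hd c)" using invariant_on_cycle[OF assms(1) c(1) assms(2)] by blast
    then show ?thesis using x c by (auto simp: cycle_reps_def)
  qed (use x in \<open>auto simp: cycle_reps_def\<close>)
qed

lemma card_invariant_le:
  assumes "disj_cycles n cs" "\<forall>c\<in>set cs. c \<noteq> []" "h \<circ> cycs_perm cs = h"
  shows "card (h ` {1..n}) + refl_len cs \<le> n"
proof -
  have "finite (cycle_reps n cs)" by (simp add: cycle_reps_def)
  then have "card (h ` {1..n}) \<le> card (cycle_reps n cs)"
    using invariant_image_cycle_reps[OF assms(1,3)]
    by (meson card_image_le card_mono finite_imageI le_trans)
  then show ?thesis using card_cycle_reps[OF assms(1,2)] by linarith
qed

lemma card_invariant_less:
  assumes "disj_cycles n cs" "\<forall>c\<in>set cs. c \<noteq> []" "h \<circ> cycs_perm cs = h"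
    and "c \<in> set cs" "x \<in> {1..n}" "x \<notin> set c" "h x = h (hd c)"
  shows "card (h ` {1..n}) + refl_len cs < n"
proof -
  let ?A = "cycle_reps n cs"
  have fin: "finite ?A" by (simp add: cycle_reps_def)
  have "\<exists>y \<in> ?A. y \<noteq> hd c \<and> h y = h (hd c)"
  proof (cases "x \<in> set (concat cs)")
    case True
    then obtain d where d: "d \<in> set cs" "x \<in> set d" by auto
    then have "c \<noteq> d" using assms(6) by auto
    then have "set c \<inter> set d = {}" using disj_cycles_disjoint[OF assms(1,4) d(1)] by simp
    moreover have "hd c \<in> set c" "hd d \<in> set d" using assms(2,4) d by auto
    ultimately have "hd d \<noteq> hd c" by auto
    moreover have "h (hd d) = h x" using invariant_on_cycle[OF assms(1) d(1) assms(3) d(2)] by simp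
    ultimately show ?thesis using d assms(7) by (intro bexI[of _ "hd d"]) (auto simp: cycle_reps_def)
  next
    case False
    moreover have "hd c \<in> set c" using assms(2,4) by auto
    ultimately show ?thesis using assms(4-7) by (intro bexI[of _ x]) (auto simp: cycle_reps_def)
  qed
  then obtain y where y: "y \<in> ?A" "y \<noteq> hd c" "h y = h (hd c)" by blast
  have "hd c \<in> ?A" using assms(4) by (auto simp: cycle_reps_def)
  have "h ` ?A \<subseteq> h ` (?A - {y})"
  proof (rule image_subsetI)
    fix z assume "z \<in> ?A"
    then show "h z \<in> h ` (?A - {y})"
      using y \<open>hd c \<in> ?A\<close> by (cases "z = y") auto
  qed
  then have "h ` {1..n} \<subseteq> h ` (?A - {y})" using invariant_image_cycle_reps[OF assms(1,3)] by blast
  then have "card (h ` {1..n}) \<le> card (?A - {y})"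
    using fin by (meson card_image_le card_mono finite_Diff finite_imageI le_trans)
  also have "\<dots> < card ?A" using fin y(1) by (rule card_Diff1_less)
  finally show ?thesis using card_cycle_reps[OF assms(1,2)] by linarith
qed

lemma cycs_tr_commute:
  assumes "disj_cycles n cs" "even (refl_len cs)" "a \<notin> set (concat cs)" "b \<notin> set (concat cs)"
  shows "cycs cs * tr a b = tr a b * cycs cs"
  using lifts_tr_apply[OF lifts_cycs[OF assms(1)], of a b] assms(2) cycs_perm_outside[OF assms(3)]
    cycs_perm_outside[OF assms(4)] by simp

lemma Spin_lifts_fixes:
  assumes "u \<in> Spin n" "lifts u p s" "s \<in> {1, - 1}"
  shows "p (Suc n) = Suc n"
proof -
  obtain q t where q: "lifts u q t" "q permutes {1..n}" "t \<in> {1, - 1}" using Spin_lifts[OF assms(1)] .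
  have "p = q" by (rule Spin_lifts_unique(1)[OF assms(1,2) q(1) assms(3) q(3)])
  then show ?thesis using q(2) by (simp add: permutes_def)
qed

lemma co_diff_not_Spin: "u \<notin> Spin n \<Longrightarrow> co_diff r n u = 0"
  using co_diff_support unfolding rank_le_def by blast

lemma lifts_tr_pair:
  assumes "lifts u p 1" "i \<noteq> N" "j \<noteq> N"
  shows "lifts (u * (tr j N * tr i N)) (p \<circ> (transpose j N \<circ> transpose i N)) 1"
  using lifts_mult[OF assms(1) lifts_mult[OF lifts_tr[OF assms(3)] lifts_tr[OF assms(2)]]] by simp

lemma rank_le_fixed:
  assumes "rank_le n k s u" "lifts u p t" "disj_cycles n cs" "\<forall>c\<in>set cs. c \<noteq> []"
    "p = cycs_perm cs" "s \<in> {1, - 1}" "t \<in> {1, - 1}"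
  shows "refl_len cs \<le> k"
proof -
  obtain q h where q: "lifts u q s" "\<forall>i. h (q i) = (h i :: nat)" "n \<le> card (h ` {1..n}) + k"
    "u \<in> Spin n"
    using assms(1) unfolding rank_le_def by blast
  have "q = p" by (rule Spin_lifts_unique(1)[OF q(4,1) assms(2,6,7)])
  then have "h \<circ> cycs_perm cs = h" using q(2) assms(5) by auto
  from card_invariant_le[OF assms(3,4) this] show ?thesis using q(3) by linarith
qed

lemma refl_len_even_lifts:
  "disj_cycles n cs \<Longrightarrow> even (refl_len cs) \<Longrightarrow> lifts (cycs cs) (cycs_perm cs) 1"
  using lifts_cycs[of n cs] by simp

text \<open>All new summands of the recursion vanish. For \<open>i = j\<close> the operator is
  \<open>- cycs cs\<close>, whose reflection length exceeds the degree \<open>2 * s\<close>; for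
  \<open>i \<noteq> j\<close> membership in \<open>Spin n\<close> would force the permutation to
  send \<open>i\<close> to \<open>Suc n\<close>.\<close>

lemma co_diff_Suc_fixed:
  assumes "disj_cycles n cs" "\<forall>c\<in>set cs. odd (length c)" "refl_len cs = 2 * r"
  shows "co_diff r (Suc n) (cycs cs) = co_diff r n (cycs cs)"
proof (cases r)
  case 0
  then show ?thesis by (simp add: co_diff_def)
next
  case (Suc s)
  let ?N = "Suc n" and ?p = "cycs_perm cs" and ?u = "cycs cs"
  have u: "?u \<in> Spin n" using cycs_Spin[OF assms(1)] .
  have l: "lifts ?u ?p 1" using refl_len_even_lifts[OF assms(1)] assms(3) by simp
  have ne: "\<forall>c\<in>set cs. c \<noteq> []" using assms(2) by auto
  have "co_diff s n (?u * (tr j ?N * tr i ?N)) = 0" if ij: "i \<in> {1..n}" "j \<in> {1..n}" for i j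
  proof (rule ccontr)
    let ?v = "?u * (tr j ?N * tr i ?N)"
    assume nz: "co_diff s n ?v \<noteq> 0"
    have N: "i \<noteq> ?N" "j \<noteq> ?N" using ij by auto
    from nz have rk: "rank_le n (2 * s) 1 ?v" by (rule co_diff_support)
    show False
    proof (cases "i = j")
      case True
      then have "?v = - ?u" using N by simp
      then have "lifts ?v ?p 1" using l lifts_uminus by simp
      from rank_le_fixed[OF rk this assms(1) ne HOL.refl] show False using assms(3) Suc by simp
    next
      case False
      have "?v \<in> Spin n" using rk by (simp add: rank_le_def)
      from Spin_lifts_fixes[OF this lifts_tr_pair[OF l N]]
      have "?p i = ?N" using False N by (simp add: transpose_def)
      moreover have "?p i \<in> {1..n}"
        using Spin_lifts[OF u] Spin_lifts_unique(1)[OF u l] ij(1) permutes_in_image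
        by (metis insertCI)
      ultimately show False by simp
    qed
  qed
  then show ?thesis by (simp add: Suc co_diff_Suc_Suc)
qed

text \<open>In \<open>cycs (((Suc n) # ys) # cs) = v * [i, n + 1] [j, n + 1]\<close> with \<open>v\<close> fixing \<open>n + 1\<close>, the
  point \<open>i\<close> must be the preimage \<open>last ys\<close> of \<open>n + 1\<close>, and by degree \<open>j\<close> must lie on the same cycle.\<close>

context
  fixes n r :: nat and ys :: "nat list" and cs :: "nat list list" and u :: lin_op
    and N :: nat and f :: "nat \<Rightarrow> nat \<Rightarrow> int"
  assumes disj: "disj_cycles (Suc n) ((Suc n # ys) # cs)"
    and len: "odd (length (Suc n # ys))" "\<forall>c\<in>set cs. odd (length c)"
    and deg: "refl_len ((Suc n # ys) # cs) = 2 * Suc r"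
    and ys: "ys \<noteq> []"
  defines "N \<equiv> Suc n"
    and "u \<equiv> cycs ((Suc n # ys) # cs)"
    and "f i j \<equiv> co_diff r n (u * (tr j N * tr i N))"
begin

private abbreviation "ds \<equiv> (N # ys) # cs"

private lemma facts:
  "distinct ys" "N \<notin> set ys" "set ys \<subseteq> {1..n}" "disj_cycles n cs" "set ys \<inter> set (concat cs) = {}"
  "N \<notin> set (concat cs)" "\<forall>c\<in>set ds. c \<noteq> []" "even (refl_len cs)" "lifts u (cycs_perm ds) 1"
  "disj_cycles N ds"
proof -
  show ne: "\<forall>c\<in>set ds. c \<noteq> []" using len by auto
  show 1: "distinct ys" "N \<notin> set ys" "set ys \<inter> set (concat cs) = {}" "N \<notin> set (concat cs)"
    "disj_cycles N ds"
    using disj by (simp_all add: N_def)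
  have "set ys \<subseteq> {1..N}" "set (concat cs) \<subseteq> {1..N}" "distinct (concat cs)"
    using disj by (simp_all add: N_def disj_cycles_def)
  then have "set ys \<subseteq> {1..N} - {N}" "set (concat cs) \<subseteq> {1..N} - {N}" using 1(2,4) by blast+
  moreover have "{1..N} - {N} = {1..n}" by (auto simp: N_def)
  ultimately show "set ys \<subseteq> {1..n}" "disj_cycles n cs"
    using \<open>distinct (concat cs)\<close> by (simp_all only: disj_cycles_def)
  show "even (refl_len cs)" using refl_len_even[OF len(2)] .
  show "lifts u (cycs_perm ds) 1"
    unfolding u_def N_def by (rule refl_len_even_lifts[OF disj]) (simp only: deg, simp)
qed

private lemma perm_last: "cycs_perm ds (last ys) = N"
proof -
  have "cycs_perm ds (last ys) = cycle_of_list (N # ys) (last ys)"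
    using ys by (intro cycs_perm_inside[OF facts(10)]) (auto simp: N_def)
  also have "\<dots> = N" using cycle_of_list_last[of "N # ys"] facts(1,2) ys by simp
  finally show ?thesis .
qed

private lemma perm_inj: "cycs_perm ds i = cycs_perm ds j \<Longrightarrow> i = j"
proof -
  have u: "u \<in> Spin N" unfolding u_def using cycs_Spin[OF disj] by (simp add: N_def)
  obtain q t where q: "lifts u q t" "q permutes {1..N}" "t \<in> {1, - 1}" using Spin_lifts[OF u] .
  have pq: "cycs_perm ds = q" by (rule Spin_lifts_unique(1)[OF u facts(9) q(1) _ q(3)]) simp
  then show "cycs_perm ds i = cycs_perm ds j \<Longrightarrow> i = j"
    unfolding pq using permutes_inj[OF q(2)] by (simp add: inj_eq)
qed

private lemma f_zero:
  assumes "i \<in> {1..n}" "j \<in> {1..n}" "i \<noteq> last ys \<or> i = j"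
  shows "f i j = 0"
proof (rule ccontr)
  let ?v = "u * (tr j N * tr i N)"
  assume nz: "f i j \<noteq> 0"
  have N: "i \<noteq> N" "j \<noteq> N" using assms(1,2) by (auto simp: N_def)
  have v: "?v \<in> Spin n" using co_diff_not_Spin nz unfolding f_def by blast
  show False
  proof (cases "i = j")
    \<comment> \<open>For equal indices the two reflections cancel up to sign, and what remains
      still moves \<open>N\<close>, so it cannot lie in \<open>Spin n\<close>.\<close>
    case True
    then have "?v = - u" using N by simp
    then have "lifts ?v (cycs_perm ds) 1" using facts(9) lifts_uminus by simp
    from Spin_lifts_fixes[OF v this] have "cycs_perm ds N = N" by (simp add: N_def)
    then show False using perm_inj perm_last facts(2) ys by (metis last_in_set)
  next
    case False
    from Spin_lifts_fixes[OF v lifts_tr_pair[OF facts(9) N]]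
    have "cycs_perm ds i = N" using False N by (simp add: N_def transpose_def)
    then show False using assms(3) False perm_inj perm_last by metis
  qed
qed

private lemma f_outside:
  assumes "j \<in> {1..n}" "j \<notin> set ys"
  shows "f (last ys) j = 0"
proof (rule ccontr)
  let ?i = "last ys" let ?v = "u * (tr j N * tr ?i N)"
  assume nz: "f ?i j \<noteq> 0"
  have "?i \<in> {1..n}" using facts(3) last_in_set[OF ys] by blast
  moreover have "?i \<noteq> j" using assms(2) last_in_set[OF ys] by metis
  ultimately have i: "?i \<in> {1..n}" "?i \<noteq> N" "j \<noteq> N" "?i \<noteq> j"
    using assms(1) by (auto simp: N_def)
  have "rank_le n (2 * r) 1 ?v" using co_diff_support nz unfolding f_def by blast
  then obtain q h where q: "?v \<in> Spin n" "lifts ?v q 1" "\<forall>x. h (q x) = (h x :: nat)"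
    "n \<le> card (h ` {1..n}) + 2 * r" unfolding rank_le_def by blast
  have "q = cycs_perm ds \<circ> (transpose j N \<circ> transpose ?i N)"
    using Spin_lifts_unique(1)[OF q(1,2) lifts_tr_pair[OF facts(9) i(2,3)]] by simp
  then have p: "cycs_perm ds = q \<circ> (transpose ?i N \<circ> transpose j N)"
    by (simp add: fun_eq_iff)
  have qN: "q N = N" using Spin_lifts_fixes[OF q(1,2)] by (simp add: N_def)
  have qx: "q x \<noteq> N" if "x \<noteq> N" for x
  proof
    assume "q x = N"
    then have "cycs_perm ds (transpose j N (transpose ?i N x)) = cycs_perm ds (transpose j N (transpose ?i N N))"
      using qN p by simp
    then have "transpose j N (transpose ?i N x) = transpose j N (transpose ?i N N)" by (rule perm_inj)
    then show False using that by (metis transpose_involutory)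
  qed
  \<comment> \<open>From a labelling for the shortened operator, \<open>h1\<close> gives
    \<open>N\<close> the label of \<open>last ys\<close>, and \<open>h2\<close> also merges the
    label of \<open>j\<close> with it. Only this merge can lose a label, and \<open>h2\<close> is
    invariant under \<open>cycs_perm ds\<close>. As \<open>j\<close> lies outside the cycle of
    \<open>N\<close>, the strict bound applies and contradicts the size of \<open>h\<close>.\<close>
  define h1 where "h1 x = (if x = N then h ?i else h x)" for x
  define h2 where "h2 x = (if h1 x = h1 j then h1 N else h1 x)" for x
  have h1: "h1 (q x) = h1 x" for x using qN qx q(3) by (auto simp: h1_def)
  have "h2 (cycs_perm ds x) = h2 x" for x
  proof -
    have "h1 (cycs_perm ds x) = h1 (transpose ?i N (transpose j N x))" using h1 p by simp
    also have "\<dots> = h1 (transpose j N x)" using i(2) by (auto simp: h1_def transpose_def)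
    finally show ?thesis by (auto simp: h2_def transpose_def)
  qed
  then have "h2 \<circ> cycs_perm ds = h2" by auto
  moreover have "h2 j = h2 (hd (N # ys))" by (simp add: h2_def)
  moreover have "N # ys \<in> set ds" "j \<in> {1..N}" "j \<notin> set (N # ys)" using assms i(3) by (auto simp: N_def)
  ultimately have "card (h2 ` {1..N}) + refl_len ds < N"
    using card_invariant_less[OF facts(10,7)] by blast
  then have "card (h2 ` {1..N}) + 2 * r + 2 < Suc n" using deg by (simp add: N_def)
  moreover have "h ` {1..n} \<subseteq> insert (h1 j) (h2 ` {1..N})"
    by (auto simp: h1_def h2_def N_def)
  then have "card (h ` {1..n}) \<le> card (insert (h1 j) (h2 ` {1..N}))" by (intro card_mono) auto
  then have "card (h ` {1..n}) \<le> Suc (card (h2 ` {1..N}))"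
    using card_insert_le_m1[of "Suc (card (h2 ` {1..N}))" "h2 ` {1..N}" "h1 j"] by simp
  ultimately show False using q(4) by simp
qed

private lemma f_split:
  assumes "ys = xs @ zs" "xs \<noteq> []" "zs \<noteq> []"
  shows "f (last ys) (last xs) = (if odd (length xs) then - co_diff r n (cycs (zs # xs # cs)) else 0)"
proof -
  let ?a = "tr (last zs) N" and ?b = "tr (last xs) N"
  have l: "last ys = last zs" using assms by simp
  have mem: "last zs \<in> set ys" "last xs \<in> set ys" using assms by auto
  then have N: "last zs \<noteq> N" "last xs \<noteq> N" using facts(2) by auto
  have notin: "last zs \<notin> set (concat cs)" "last xs \<notin> set (concat cs)" using mem facts(5) by blast+
  have "cyc (N # ys) = sg (length xs) (cyc zs * cyc xs * (?a * ?b))"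
    unfolding assms(1) using facts(1,2) assms by (intro cyc_split) auto
  then have "u = sg (length xs) (cyc zs * cyc xs * (?a * (?b * cycs cs)))"
    by (simp add: u_def N_def mult.assoc)
  also have "?b * cycs cs = cycs cs * ?b"
    by (rule cycs_tr_commute[OF facts(4,8) notin(2) facts(6), symmetric])
  also have "?a * (cycs cs * ?b) = cycs cs * (?a * ?b)"
    unfolding mult.assoc[symmetric] cycs_tr_commute[OF facts(4,8) notin(1) facts(6)] ..
  finally have "u * (?b * ?a) = sg (length xs) (cycs (zs # xs # cs))"
    using N by (simp add: mult.assoc)
  then have f: "f (last ys) (last xs) = co_diff r n (sg (length xs) (cycs (zs # xs # cs)))"
    by (simp add: f_def l)
  show ?thesis
  proof (cases "odd (length xs)")
    case True
    then show ?thesis using f by simp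
  next
    case False
    \<comment> \<open>Both pieces now have even length. Relative to \<open>zs\<close> the remaining
      factors are odd in total, so the coefficients at the operator and at its negative agree and
      their difference vanishes.\<close>
    have "even (length zs)" using False len(1) assms by simp
    moreover from this have "2 \<le> length zs" using assms(3) by (cases zs; cases "tl zs") auto
    moreover have "odd (length xs - 1)" using False assms(2) by (cases xs) auto
    ultimately have "co (JM_elem r n) (cyc zs * cycs (xs # cs)) = co (JM_elem r n) (- (cyc zs * cycs (xs # cs)))"
      using facts(1,3,5,8) assms(1) by (intro co_JM_elem_even_cycle) auto
    then show ?thesis using f False by (simp add: co_diff_def)
  qed
qed

lemma co_diff_Suc_moved:
  "co_diff (Suc r) (Suc n) (cycs ((Suc n # ys) # cs)) =
     - (\<Sum>i<length ys div 2. co_diff r n (cycs (drop (2 * i + 1) ys # take (2 * i + 1) ys # cs)))"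
proof -
  let ?m = "length ys" and ?l = "last ys"
  let ?g = "\<lambda>k. f ?l (ys ! k)"
  have "even ?m" using len(1) by simp
  moreover have "?m \<noteq> 0" using ys by simp
  moreover have "?m \<noteq> 1" using \<open>even ?m\<close> by auto
  ultimately have m: "even ?m" "2 \<le> ?m" by linarith+
  have l: "?l \<in> {1..n}" using facts(3) ys by (meson last_in_set subsetD)
  \<comment> \<open>Since \<open>u\<close> moves \<open>N\<close>, the summand of the recursion
    without the factor \<open>(JM N)\<^sup>2\<close> contributes nothing.\<close>
  have "u \<notin> Spin n"
  proof
    assume "u \<in> Spin n"
    from Spin_lifts_fixes[OF this facts(9)] have "cycs_perm ds N = N" by (simp add: N_def)
    then show False using perm_inj perm_last facts(2) ys by (metis last_in_set)
  qed
  then have "co_diff (Suc r) (Suc n) u = (\<Sum>i\<in>{1..n}. \<Sum>j\<in>{1..n}. f i j)"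
    by (simp add: co_diff_Suc_Suc co_diff_not_Spin f_def N_def)
  also have "\<dots> = (\<Sum>i\<in>{?l}. \<Sum>j\<in>{1..n}. f i j)"
    using l f_zero by (intro sum.mono_neutral_right) auto
  also have "\<dots> = (\<Sum>j\<in>{1..n}. f ?l j)" by simp
  also have "\<dots> = (\<Sum>j\<in>set (butlast ys). f ?l j)"
  proof (rule sum.mono_neutral_right)
    show "set (butlast ys) \<subseteq> {1..n}" using facts(3) by (meson in_set_butlastD subset_iff)
    have "j \<in> set (butlast ys) \<or> j = ?l" if "j \<in> set ys" for j
      using that ys by (metis append_butlast_last_id in_set_conv_decomp rotate1.simps(2) set_ConsD set_rotate1)
    then show "\<forall>j\<in>{1..n} - set (butlast ys). f ?l j = 0"
      using f_zero[OF l] f_outside by blast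
  qed simp
  also have "\<dots> = (\<Sum>k<?m - 1. ?g k)"
  proof -
    have "bij_betw ((!) (butlast ys)) {..<?m - 1} (set (butlast ys))"
      using facts(1) by (intro bij_betw_nth distinct_butlast) auto
    from sum.reindex_bij_betw[OF this, of "f ?l"] show ?thesis by (simp add: nth_butlast)
  qed
  \<comment> \<open>The index \<open>k\<close> counts from \<open>0\<close> and cuts off
    \<open>k + 1\<close> entries, so pieces of odd length correspond to even
    \<open>k\<close>.\<close>
  also have "\<dots> = (\<Sum>k\<in>(\<lambda>i. 2 * i) ` {..<?m div 2}. ?g k)"
  proof (rule sum.mono_neutral_right)
    show "(\<lambda>i. 2 * i) ` {..<?m div 2} \<subseteq> {..<?m - 1}" using m by auto
    show "\<forall>k\<in>{..<?m - 1} - (\<lambda>i. 2 * i) ` {..<?m div 2}. ?g k = 0"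
    proof
      fix k assume k: "k \<in> {..<?m - 1} - (\<lambda>i. 2 * i) ` {..<?m div 2}"
      have "odd k"
      proof
        assume "even k"
        then obtain i where "k = 2 * i" by blast
        then show False using k by auto
      qed
      moreover have kk: "k < ?m" "Suc k < ?m" using k by auto
      moreover from kk have "last (take (Suc k) ys) = ys ! k" by (simp add: take_Suc_conv_app_nth)
      moreover from kk have "min ?m (Suc k) = Suc k" by simp
      ultimately show "?g k = 0"
        using f_split[of "take (Suc k) ys" "drop (Suc k) ys"] ys by simp
    qed
  qed simp
  also have "\<dots> = (\<Sum>i<?m div 2. ?g (2 * i))" by (subst sum.reindex) (auto simp: inj_on_def)
  also have "\<dots> = (\<Sum>i<?m div 2. - co_diff r n (cycs (drop (2 * i + 1) ys # take (2 * i + 1) ys # cs)))"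
  proof (rule sum.cong)
    fix i assume "i \<in> {..<?m div 2}"
    then have i: "2 * i < ?m" "Suc (2 * i) < ?m" using m by auto
    have "last (take (Suc (2 * i)) ys) = ys ! (2 * i)" using i by (simp add: take_Suc_conv_app_nth)
    moreover have "min ?m (Suc (2 * i)) = Suc (2 * i)" using i by simp
    ultimately show "?g (2 * i) = - co_diff r n (cycs (drop (2 * i + 1) ys # take (2 * i + 1) ys # cs))"
      using f_split[of "take (Suc (2 * i)) ys" "drop (Suc (2 * i)) ys"] i ys by simp
  qed simp
  finally show ?thesis by (simp add: u_def sum_negf)
qed

end

text \<open>A cycle of length \<open>2 * h + 1\<close> has the weight \<open>- Cat (h + 1)\<close>.
  A one-point cycle has weight \<open>- 1\<close>, the same factor as the operator
  \<open>cyc [x]\<close>, so trivial cycles may stay in the list.\<close>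

definition cycle_weight :: "nat list \<Rightarrow> int" where
  "cycle_weight c = - int (catalan ((length c - 1) div 2))"

theorem co_diff_top_degree:
  assumes "disj_cycles n cs" "\<forall>c\<in>set cs. odd (length c)" "refl_len cs = 2 * r"
  shows "co_diff r n (cycs cs) = (\<Prod>c\<leftarrow>cs. cycle_weight c)"
  using assms
proof (induction n arbitrary: r cs)
  case 0
  then have "cs = []" by (cases cs) (auto elim: oddE)
  moreover have "co 1 1 = 1" "co 1 (- 1) = 0"
    using co_gel[of 1] Spin_neq_uminus[OF Spin.one] by simp_all
  ultimately show ?case using 0 by (simp add: co_diff_def)
next
  case (Suc n)
  have fixed: "co_diff r (Suc n) (cycs cs) = (\<Prod>c\<leftarrow>cs. cycle_weight c)"
    if "disj_cycles (Suc n) cs" "\<forall>c\<in>set cs. odd (length c)" "refl_len cs = 2 * r" "Suc n \<notin> set (concat cs)"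
    for cs
  proof -
    have "{1..Suc n} - {Suc n} = {1..n}" by auto
    then have "disj_cycles n cs" using that(1,4) unfolding disj_cycles_def by blast
    then show ?thesis using co_diff_Suc_fixed that(2,3) Suc.IH by simp
  qed
  show ?case
  proof (cases "Suc n \<in> set (concat cs)")
    case False
    then show ?thesis using fixed Suc.prems by blast
  next
    case True
    then obtain c where c: "c \<in> set cs" "Suc n \<in> set c" by auto
    then obtain k where k: "k < length c" "c ! k = Suc n" by (metis in_set_conv_nth)
    obtain as bs where abs: "cs = as @ c # bs" using c(1) by (meson split_list)
    define ys where "ys = tl (rotate k c)"
    define es where "es = as @ bs"
    have "c \<noteq> []" using k by auto
    then have "rotate k c \<noteq> []" "hd (rotate k c) = Suc n" using k by (simp_all add: hd_rotate_conv_nth)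
    then have rot: "rotate k c = Suc n # ys" unfolding ys_def by (metis list.collapse)
    have cd: "distinct c" "set c \<subseteq> {1..Suc n}" "odd (length c)"
      using disj_cycles_memD[OF Suc.prems(1) c(1)] Suc.prems(2) c(1) by auto
    have sr: "set (Suc n # ys) = set c" "length (Suc n # ys) = length c" "distinct (Suc n # ys)"
      unfolding rot[symmetric] using cd(1) by simp_all
    \<comment> \<open>Odd cycles commute and may be rotated, so the cycle through
      \<open>Suc n\<close> can be put first and written with \<open>Suc n\<close> as its
      head.\<close>
    have "mset cs = mset (c # es)" by (simp add: abs es_def)
    then have "cycs cs = cyc c * cycs es"
      using cycs_mset_eq[OF Suc.prems(1,2), of "c # es"] by simp
    also have "cyc c = cyc (Suc n # ys)" unfolding rot[symmetric] using cyc_rotate[OF cd(1,3,2)] by simp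
    finally have u: "cycs cs = cycs ((Suc n # ys) # es)" by simp
    have disj: "disj_cycles (Suc n) ((Suc n # ys) # es)"
      using Suc.prems(1) cd sr unfolding abs es_def disj_cycles_append disj_cycles_simps by auto
    have odd: "odd (length (Suc n # ys))" "\<forall>c\<in>set es. odd (length c)"
      using sr(2) cd(3) Suc.prems(2) by (auto simp: abs es_def)
    have deg: "refl_len ((Suc n # ys) # es) = 2 * r"
      using Suc.prems(3) sr(2) by (simp add: abs es_def)
    have w: "(\<Prod>c\<leftarrow>cs. cycle_weight c) = cycle_weight (Suc n # ys) * (\<Prod>c\<leftarrow>es. cycle_weight c)"
      using sr(2) by (simp add: abs es_def cycle_weight_def)
    show ?thesis
    proof (cases "ys = []")
      \<comment> \<open>A one-point cycle at \<open>Suc n\<close> contributes the factor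
        \<open>- 1\<close> both to the operator and to the product of weights.\<close>
      case True
      then have "co_diff r (Suc n) (cycs es) = (\<Prod>c\<leftarrow>es. cycle_weight c)"
        using disj odd deg by (intro fixed) auto
      moreover have "cycle_weight [Suc n] = - 1" by (simp add: cycle_weight_def)
      ultimately show ?thesis unfolding u w using True by simp
    next
      case False
      then have "2 \<le> length ys" using odd(1) by (cases ys; cases "tl ys") auto
      then obtain s where s: "r = Suc s" using deg by (cases r) auto
      obtain h where h: "length ys = 2 * Suc h"
        using odd(1) False by (metis even_Suc evenE length_Cons length_0_conv mult_0_right not0_implies_Suc)
      let ?P = "\<Prod>c\<leftarrow>es. cycle_weight c"
      have "co_diff s n (cycs (drop (2 * i + 1) ys # take (2 * i + 1) ys # es)) =
          int (catalan i * catalan (h - i)) * ?P" if i: "i < Suc h" for i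
      proof -
        let ?x = "take (2 * i + 1) ys" and ?z = "drop (2 * i + 1) ys"
        have lx: "length ?x = 2 * i + 1" "length ?z = 2 * (h - i) + 1" using i h by auto
        have sub: "set ?x \<subseteq> set ys" "set ?z \<subseteq> set ys" by (simp_all add: set_take_subset set_drop_subset)
        have "disj_cycles (Suc n) (?z # ?x # es)"
          using disj sub set_take_disj_set_drop_if_distinct[of ys "2 * i + 1" "2 * i + 1"] by auto
        moreover have "Suc n \<notin> set (concat (?z # ?x # es))" using disj sub by auto
        moreover have "{1..Suc n} - {Suc n} = {1..n}" by auto
        ultimately have "disj_cycles n (?z # ?x # es)" unfolding disj_cycles_def by blast
        moreover have "\<forall>c\<in>set (?z # ?x # es). odd (length c)" using lx odd(2) by simp
        moreover have "refl_len (?z # ?x # es) = 2 * s" using lx deg h s i by simp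
        ultimately have "co_diff s n (cycs (?z # ?x # es)) = (\<Prod>c\<leftarrow>?z # ?x # es. cycle_weight c)"
          by (rule Suc.IH)
        also have "\<dots> = int (catalan i * catalan (h - i)) * ?P"
          using lx by (simp add: cycle_weight_def)
        finally show ?thesis .
      qed
      then have "co_diff r (Suc n) (cycs cs) = - (\<Sum>i<Suc h. int (catalan i * catalan (h - i)) * ?P)"
        unfolding u s using co_diff_Suc_moved[OF disj odd deg[unfolded s] False] h by simp
      \<comment> \<open>The signs of the two pieces have cancelled inside the sum, so the outer sign
        survives in front of the Catalan convolution.\<close>
      also have "\<dots> = - int (catalan (Suc h)) * ?P"
        by (simp add: sum_distrib_right lessThan_Suc_atMost del: sum.lessThan_Suc)
      also have "\<dots> = cycle_weight (Suc n # ys) * ?P" using h by (simp add: cycle_weight_def)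
      finally show ?thesis using w by simp
    qed
  qed
qed

section \<open>The presented groups and their group rings\<close>

text \<open>By soundness and completeness this is a full congruence class when \<open>u\<close> lies
  in \<open>Spin n\<close>, so elements of the presented group can be named by operators.\<close>

definition spin_elt :: "nat \<Rightarrow> lin_op \<Rightarrow> spin_gen gword set" where
  "spin_elt n u = {v \<in> spin_words n. word_op v = u}"

lemma spin_class_eq:
  assumes "w \<in> spin_words n"
  shows "spin_class n w = spin_elt n (word_op w)"
  unfolding spin_class_def pres_class_def spin_elt_def
  by (rule Collect_cong) (metis assms spin_eq_sound spin_eq_complete)

lemma spin_elt_nonempty: "u \<in> Spin n \<Longrightarrow> \<exists>w. w \<in> spin_elt n u"
  using Spin_word_op[of u n] by (auto simp: spin_elt_def)

lemma inj_spin_elt: "inj_on (spin_elt n) (Spin n)"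
proof (rule inj_onI)
  fix u v assume "u \<in> Spin n" "v \<in> Spin n" and eq: "spin_elt n u = spin_elt n v"
  then obtain w where "w \<in> spin_elt n u" using spin_elt_nonempty by blast
  then have "word_op w = u" "word_op w = v" unfolding eq[symmetric] using eq by (auto simp: spin_elt_def)
  then show "u = v" by simp
qed

lemma spin_elt_eq_iff: "u \<in> Spin n \<Longrightarrow> v \<in> Spin n \<Longrightarrow> spin_elt n u = spin_elt n v \<longleftrightarrow> u = v"
  using inj_spin_elt by (auto dest: inj_onD)

lemma carrier_spin_group: "carrier (spin_group n) = spin_elt n ` Spin n"
proof -
  have "carrier (spin_group n) = spin_class n ` spin_words n"
    by (simp add: spin_group_def pres_group_def spin_class_def)
  also have "\<dots> = (\<lambda>w. spin_elt n (word_op w)) ` spin_words n"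
    by (intro image_cong spin_class_eq HOL.refl)
  finally show ?thesis by (simp add: Spin_eq_word_op_image image_image)
qed

lemma spin_elt_carrier [simp]: "u \<in> Spin n \<Longrightarrow> spin_elt n u \<in> carrier (spin_group n)"
  by (simp add: carrier_spin_group)

lemma one_spin_group: "\<one>\<^bsub>spin_group n\<^esub> = spin_elt n 1"
  using spin_class_eq[of "[]" n] by (simp add: spin_group_def pres_group_def spin_class_def)

lemma mult_spin_group:
  assumes "u \<in> Spin n" "v \<in> Spin n"
  shows "spin_elt n u \<otimes>\<^bsub>spin_group n\<^esub> spin_elt n v = spin_elt n (u * v)"
proof -
  have "pres_class (spin_gens n) (spin_rels n) (a @ b) = spin_elt n (u * v)"
    if "a \<in> spin_elt n u" "b \<in> spin_elt n v" for a b
    using that spin_class_eq[of "a @ b" n] by (simp add: spin_elt_def spin_class_def)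
  moreover obtain a b where "a \<in> spin_elt n u" "b \<in> spin_elt n v"
    using spin_elt_nonempty assms by blast
  ultimately show ?thesis unfolding spin_group_def pres_group_def by auto
qed

subsection \<open>Cycles\<close>

lemma x_word_Suc: "i < n \<Longrightarrow> x_word n i = tw i @ x_word n (Suc i) @ tw i"
  by (simp add: x_word_def upt_conv_Cons)

lemma word_op_x_word:
  assumes "i \<le> n"
  shows "word_op (x_word n i) = tr i (Suc n)"
  using assms
proof (induction i rule: inc_induct)
  case base
  show ?case by (simp add: x_word_def)
next
  case (step i)
  have "tr i (Suc i) * tr (Suc i) (Suc n) = - (tr i (Suc n) * tr i (Suc i))"
    using tr_conj[of i "Suc i" "Suc i" "Suc n"] step.hyps by simp
  then have "tr i (Suc i) * (tr (Suc i) (Suc n) * tr i (Suc i)) = tr i (Suc n)"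
    by (simp add: mult.assoc[symmetric]) (simp add: mult.assoc)
  then show ?case using step by (simp add: x_word_Suc)
qed

lemma x_word_words: "1 \<le> i \<Longrightarrow> i \<le> n \<Longrightarrow> x_word n i \<in> spin_words (Suc n)"
  by (auto simp: x_word_def)

lemma word_op_cycle_word:
  assumes "distinct xs" "set xs \<subseteq> {1..n}" "xs \<noteq> []"
  shows "word_op (cycle_word n xs) = cyc xs"
proof -
  have "word_op (concat (map (x_word n) ys)) = prod_list (map (\<lambda>y. tr y (Suc n)) ys)"
    if "set ys \<subseteq> {1..n}" for ys
    using that by (induction ys) (auto simp: word_op_x_word)
  from this[of "rev xs"] have "word_op (concat (map (x_word n) (rev xs))) = wind (Suc n) xs"
    using assms(2) by (simp add: wind_def)
  moreover have "hd xs \<le> n" using subsetD[OF assms(2) hd_in_set[OF assms(3)]] by simp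
  ultimately have "word_op (cycle_word n xs) = tr (hd xs) (Suc n) * wind (Suc n) xs"
    by (simp add: cycle_word_def word_op_x_word)
  moreover have "Suc n \<notin> set xs" using subsetD[OF assms(2), of "Suc n"] by auto
  ultimately show ?thesis using cyc_eq_wind[OF assms(1) _ assms(3), of "Suc n"] by simp
qed

lemma cycle_word_words:
  assumes "set xs \<subseteq> {1..n}" "xs \<noteq> []"
  shows "cycle_word n xs \<in> spin_words (Suc n)"
proof -
  have x: "x_word n i \<in> spin_words (Suc n)" if "i \<in> set xs" for i
    using that assms(1) by (intro x_word_words) auto
  then have "concat (map (x_word n) ys) \<in> spin_words (Suc n)" if "set ys \<subseteq> set xs" for ys
    using that by (induction ys) auto
  from this[of "rev xs"] show ?thesis
    using x[OF hd_in_set[OF assms(2)]] unfolding cycle_word_def by (simp only: append_in_lists_conv set_rev order_refl)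
qed

lemma spin_embed_spin_elt:
  assumes "u \<in> Spin n"
  shows "spin_embed n (spin_elt n u) = spin_elt (Suc n) u"
proof -
  have "spin_class (n + 1) w = spin_elt (Suc n) u" if "w \<in> spin_elt n u" for w
  proof -
    have "w \<in> spin_words (Suc n)" using that spin_words_mono[of n "Suc n"] by (auto simp: spin_elt_def)
    then show ?thesis using spin_class_eq that by (simp add: spin_elt_def)
  qed
  moreover obtain w where "w \<in> spin_elt n u" using spin_elt_nonempty[OF assms] by blast
  ultimately show ?thesis unfolding spin_embed_def by auto
qed

text \<open>The embedding keeps the operator of an element, hence is injective; the definite
  description therefore selects the class of \<open>cyc xs\<close>, the operator of the cycle word
  one level up.\<close>

lemma spin_cycle_eq:
  assumes "distinct xs" "set xs \<subseteq> {1..n}" "xs \<noteq> []"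
  shows "spin_cycle n xs = spin_elt n (cyc xs)"
proof -
  have u: "cyc xs \<in> Spin n" using cyc_Spin assms by blast
  have c: "spin_class (n + 1) (cycle_word n xs) = spin_elt (Suc n) (cyc xs)"
    using spin_class_eq[OF cycle_word_words[OF assms(2,3)]] word_op_cycle_word[OF assms] by simp
  show ?thesis
    unfolding spin_cycle_def
  proof (rule the_equality)
    show "spin_elt n (cyc xs) \<in> carrier (spin_group n) \<and>
        spin_embed n (spin_elt n (cyc xs)) = spin_class (n + 1) (cycle_word n xs)"
      unfolding c using u spin_embed_spin_elt by simp
    fix g assume g: "g \<in> carrier (spin_group n) \<and> spin_embed n g = spin_class (n + 1) (cycle_word n xs)"
    then obtain v where v: "v \<in> Spin n" "g = spin_elt n v" by (auto simp: carrier_spin_group)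
    then have "spin_elt (Suc n) v = spin_elt (Suc n) (cyc xs)"
      using g unfolding c by (simp add: spin_embed_spin_elt)
    then have "v = cyc xs" using v(1) u Spin_mono[of n "Suc n"] by (simp add: spin_elt_eq_iff)
    then show "g = spin_elt n (cyc xs)" using v(2) by simp
  qed
qed

definition D_ops :: "nat list \<Rightarrow> nat \<Rightarrow> lin_op set" where
  "D_ops p n = {cycs cs | cs. map length cs = map Suc p \<and> disj_cycles n cs}"

lemma D_ops_Spin: "D_ops p n \<subseteq> Spin n"
  by (auto simp: D_ops_def cycs_Spin)

lemma D_class_eq: "D_class p n = spin_elt n ` D_ops p n"
proof -
  have *: "foldr (monoid.mult (spin_group n)) (map (spin_cycle n) cs) \<one>\<^bsub>spin_group n\<^esub> = spin_elt n (cycs cs)"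
    if "disj_cycles n cs" "\<forall>c\<in>set cs. c \<noteq> []" for cs
    using that
  proof (induction cs)
    case (Cons c cs)
    then have c: "distinct c" "set c \<subseteq> {1..n}" "c \<noteq> []" "disj_cycles n cs" by simp_all
    then have "spin_cycle n c = spin_elt n (cyc c)" "cyc c \<in> Spin n" "cycs cs \<in> Spin n"
      using spin_cycle_eq cyc_Spin cycs_Spin by blast+
    then show ?case using Cons by (simp add: mult_spin_group)
  qed (simp add: one_spin_group)
  have ne: "\<forall>c\<in>set cs. c \<noteq> []" if "map length cs = map Suc p" for cs
  proof
    fix c assume "c \<in> set cs"
    then have "length c \<in> set (map Suc p)" unfolding that[symmetric] by simp
    then show "c \<noteq> []" by auto
  qed
  show ?thesis
    unfolding D_class_def D_ops_def disj_cycles_def[symmetric]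
  proof (rule equalityI; rule subsetI)
    fix x assume "x \<in> {foldr (monoid.mult (spin_group n)) (map (spin_cycle n) cs) \<one>\<^bsub>spin_group n\<^esub> |cs.
        map length cs = map Suc p \<and> disj_cycles n cs}"
    then show "x \<in> spin_elt n ` {cycs cs |cs. map length cs = map Suc p \<and> disj_cycles n cs}"
      using * ne by blast
  next
    fix x assume "x \<in> spin_elt n ` {cycs cs |cs. map length cs = map Suc p \<and> disj_cycles n cs}"
    then show "x \<in> {foldr (monoid.mult (spin_group n)) (map (spin_cycle n) cs) \<one>\<^bsub>spin_group n\<^esub> |cs.
        map length cs = map Suc p \<and> disj_cycles n cs}"
      using *[symmetric] ne by blast
  qed
qed

subsection \<open>The group ring\<close>

abbreviation ZSpin :: "nat \<Rightarrow> (spin_gen gword set \<Rightarrow> int) ring" where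
  "ZSpin n \<equiv> int_group_ring (spin_group n)"

text \<open>\<open>galg\<close> is built on all operators, uniformly in \<open>n\<close>; this
  predicate cuts out the group ring of \<open>Spin n\<close>.\<close>

definition supp :: "nat \<Rightarrow> galg \<Rightarrow> bool" where
  "supp n a \<longleftrightarrow> (\<forall>u. u \<notin> Spin n \<longrightarrow> co a u = 0)"

definition to_ZSpin :: "nat \<Rightarrow> galg \<Rightarrow> spin_gen gword set \<Rightarrow> int" where
  "to_ZSpin n a A = (if A \<in> carrier (spin_group n) then co a (the_inv_into (Spin n) (spin_elt n) A) else 0)"

lemma to_ZSpin_elt [simp]: "u \<in> Spin n \<Longrightarrow> to_ZSpin n a (spin_elt n u) = co a u"
  by (simp add: to_ZSpin_def the_inv_into_f_f[OF inj_spin_elt])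

lemma to_ZSpin_outside: "A \<notin> carrier (spin_group n) \<Longrightarrow> to_ZSpin n a A = 0"
  by (simp add: to_ZSpin_def)

lemma ZSpin_eqI:
  assumes "\<And>u. u \<in> Spin n \<Longrightarrow> f (spin_elt n u) = g (spin_elt n u)"
    and "\<And>A. A \<notin> carrier (spin_group n) \<Longrightarrow> f A = g A"
  shows "f = g"
proof
  fix A show "f A = g A"
    using assms by (cases "A \<in> carrier (spin_group n)") (auto simp: carrier_spin_group)
qed

lemma co_single: "co (Poly_Mapping.single (Mop u) c) v = (if u = v then c else 0)"
  by (simp add: co_def lookup_single when_def)

lemma supp_expand:
  assumes "supp n a"
  shows "a = (\<Sum>u\<in>Spin n. Poly_Mapping.single (Mop u) (co a u))"
  by (rule galg_eqI) (use assms in \<open>auto simp: co_single finite_Spin supp_def\<close>)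

lemma supp_simps:
  "supp n 0" "supp n a \<Longrightarrow> supp n b \<Longrightarrow> supp n (a + b)" "supp n a \<Longrightarrow> supp n b \<Longrightarrow> supp n (a - b)"
  "supp n a \<Longrightarrow> supp n (- a)" "u \<in> Spin n \<Longrightarrow> supp n (gel u)"
  by (auto simp: supp_def co_gel)

lemma co_mult_supp:
  assumes "supp n a" "supp n b"
  shows "co (a * b) w = (\<Sum>u\<in>Spin n. \<Sum>v\<in>Spin n. if u * v = w then co a u * co b v else 0)"
proof -
  have "a * b = (\<Sum>u\<in>Spin n. Poly_Mapping.single (Mop u) (co a u)) *
      (\<Sum>v\<in>Spin n. Poly_Mapping.single (Mop v) (co b v))"
    using supp_expand[OF assms(1)] supp_expand[OF assms(2)] by simp
  then show ?thesis by (simp add: sum_product mult_single plus_mop_def co_single)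
qed

lemma supp_mult:
  assumes "supp n a" "supp n b"
  shows "supp n (a * b)"
  unfolding supp_def
proof (intro allI impI)
  fix w assume "w \<notin> Spin n"
  then show "co (a * b) w = 0"
    unfolding co_mult_supp[OF assms] using Spin_mult by (intro sum.neutral ballI) auto
qed

lemma supp_one: "supp n 1"
  using supp_simps(5)[OF Spin.one] by simp

lemma carrier_ZSpin: "carrier (ZSpin n) = to_ZSpin n ` Collect (supp n)"
proof (rule equalityI; rule subsetI)
  fix f assume f: "f \<in> carrier (ZSpin n)"
  let ?a = "\<Sum>u\<in>Spin n. Poly_Mapping.single (Mop u) (f (spin_elt n u))"
  have co: "co ?a u = (if u \<in> Spin n then f (spin_elt n u) else 0)" for u
    by (simp add: co_single finite_Spin)
  then have "supp n ?a" by (simp add: supp_def)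
  moreover have "f = to_ZSpin n ?a"
  proof (rule ZSpin_eqI[of n])
    fix u assume "u \<in> Spin n"
    then show "f (spin_elt n u) = to_ZSpin n ?a (spin_elt n u)" by (simp only: to_ZSpin_elt co if_True)
  next
    fix A assume "A \<notin> carrier (spin_group n)"
    then show "f A = to_ZSpin n ?a A" using f by (auto simp: to_ZSpin_outside int_group_ring_def)
  qed
  ultimately show "f \<in> to_ZSpin n ` Collect (supp n)" by blast
next
  fix f assume "f \<in> to_ZSpin n ` Collect (supp n)"
  then have "{x. f x \<noteq> 0} \<subseteq> carrier (spin_group n)"
    by (auto simp: to_ZSpin_def split: if_splits)
  moreover have "finite (carrier (spin_group n))" by (simp add: carrier_spin_group finite_Spin)
  ultimately show "f \<in> carrier (ZSpin n)"
    by (simp add: int_group_ring_def finite_subset)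
qed

lemma to_ZSpin_carrier [simp]: "supp n a \<Longrightarrow> to_ZSpin n a \<in> carrier (ZSpin n)"
  by (simp add: carrier_ZSpin)

lemma to_ZSpin_add: "to_ZSpin n (a + b) = to_ZSpin n a \<oplus>\<^bsub>ZSpin n\<^esub> to_ZSpin n b"
  by (rule ZSpin_eqI[of n]) (simp_all add: int_group_ring_def to_ZSpin_outside)

lemma to_ZSpin_zero: "to_ZSpin n 0 = \<zero>\<^bsub>ZSpin n\<^esub>"
  by (rule ZSpin_eqI[of n]) (simp_all add: int_group_ring_def to_ZSpin_outside)

lemma to_ZSpin_one: "to_ZSpin n 1 = \<one>\<^bsub>ZSpin n\<^esub>"
proof (rule ZSpin_eqI)
  fix u assume u: "u \<in> Spin n"
  have "co 1 u = (if 1 = u then 1 else 0)" using co_gel[of 1 u] by simp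
  then show "to_ZSpin n 1 (spin_elt n u) = \<one>\<^bsub>ZSpin n\<^esub> (spin_elt n u)"
    using u by (auto simp: int_group_ring_def one_spin_group spin_elt_eq_iff Spin.one)
next
  fix A assume "A \<notin> carrier (spin_group n)"
  moreover from this have "A \<noteq> \<one>\<^bsub>spin_group n\<^esub>" by (auto simp: one_spin_group Spin.one)
  ultimately show "to_ZSpin n 1 A = \<one>\<^bsub>ZSpin n\<^esub> A"
    by (simp add: int_group_ring_def to_ZSpin_outside)
qed

lemma to_ZSpin_mult:
  assumes "supp n a" "supp n b"
  shows "to_ZSpin n (a * b) = to_ZSpin n a \<otimes>\<^bsub>ZSpin n\<^esub> to_ZSpin n b"
proof (rule ZSpin_eqI)
  let ?f = "to_ZSpin n a" and ?g = "to_ZSpin n b" and ?G = "spin_group n"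
  fix w assume w: "w \<in> Spin n"
  let ?S = "{(A, B). ?f A \<noteq> 0 \<and> ?g B \<noteq> 0 \<and> A \<otimes>\<^bsub>?G\<^esub> B = spin_elt n w}"
  let ?T = "{(u, v) \<in> Spin n \<times> Spin n. u * v = w}"
  let ?e = "map_prod (spin_elt n) (spin_elt n)"
  have inj: "inj_on ?e ?T"
    using map_prod_inj_on[OF inj_spin_elt inj_spin_elt, of n n] by (rule inj_on_subset) auto
  have sub: "?S \<subseteq> ?e ` ?T"
  proof
    fix x assume x: "x \<in> ?S"
    obtain A B where AB: "x = (A, B)" by (cases x)
    then have "A \<in> carrier ?G" "B \<in> carrier ?G" using x to_ZSpin_outside by auto
    then obtain u v where uv: "u \<in> Spin n" "v \<in> Spin n" "A = spin_elt n u" "B = spin_elt n v"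
      by (auto simp: carrier_spin_group)
    then have "u * v = w" using x AB w by (simp add: mult_spin_group spin_elt_eq_iff Spin_mult)
    then show "x \<in> ?e ` ?T" using uv AB by (intro image_eqI[of _ _ "(u, v)"]) auto
  qed
  have "(?f \<otimes>\<^bsub>ZSpin n\<^esub> ?g) (spin_elt n w) = (\<Sum>(A, B)\<in>?S. ?f A * ?g B)"
    by (simp add: int_group_ring_def)
  \<comment> \<open>The product in the group ring sums only over pairs with nonzero coefficients;
    adding zero terms extends it to all factorisations of \<open>w\<close>.\<close>
  also have "\<dots> = (\<Sum>(A, B)\<in>?e ` ?T. ?f A * ?g B)"
  proof (rule sum.mono_neutral_left[OF _ sub])
    show "finite (?e ` ?T)" by (intro finite_imageI finite_subset[of ?T "Spin n \<times> Spin n"]) (auto simp: finite_Spin)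
    show "\<forall>x\<in>?e ` ?T - ?S. (case x of (A, B) \<Rightarrow> ?f A * ?g B) = 0"
      using w by (auto simp: mult_spin_group)
  qed
  also have "\<dots> = (\<Sum>(u, v)\<in>?T. co a u * co b v)"
    by (subst sum.reindex[OF inj]) (auto intro!: sum.cong)
  also have "\<dots> = (\<Sum>x\<in>Spin n \<times> Spin n. if x \<in> ?T then (case x of (u, v) \<Rightarrow> co a u * co b v) else 0)"
    by (rule sum.mono_neutral_cong_left) (auto simp: finite_Spin)
  also have "\<dots> = co (a * b) w"
    unfolding co_mult_supp[OF assms] by (subst sum.cartesian_product) (auto intro!: sum.cong)
  finally show "to_ZSpin n (a * b) (spin_elt n w) = (?f \<otimes>\<^bsub>ZSpin n\<^esub> ?g) (spin_elt n w)"
    using w by simp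
next
  let ?f = "to_ZSpin n a" and ?g = "to_ZSpin n b" and ?G = "spin_group n"
  fix C assume C: "C \<notin> carrier ?G"
  let ?S = "{(A, B). ?f A \<noteq> 0 \<and> ?g B \<noteq> 0 \<and> A \<otimes>\<^bsub>?G\<^esub> B = C}"
  have S: "?S = {}"
  proof -
    have False if "?f A \<noteq> 0" "?g B \<noteq> 0" "A \<otimes>\<^bsub>?G\<^esub> B = C" for A B
    proof -
      have "A \<in> carrier ?G" "B \<in> carrier ?G" using that to_ZSpin_outside by auto
      then obtain u v where "u \<in> Spin n" "v \<in> Spin n" "A = spin_elt n u" "B = spin_elt n v"
        by (auto simp: carrier_spin_group)
      then have "C \<in> carrier ?G" using that(3) Spin_mult by (simp add: mult_spin_group flip: that(3))
      then show False using C by simp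
    qed
    then show ?thesis by blast
  qed
  have "(?f \<otimes>\<^bsub>ZSpin n\<^esub> ?g) C = (\<Sum>(A, B)\<in>?S. ?f A * ?g B)"
    by (simp add: int_group_ring_def)
  then show "to_ZSpin n (a * b) C = (?f \<otimes>\<^bsub>ZSpin n\<^esub> ?g) C"
    unfolding S using C by (simp add: to_ZSpin_outside)
qed

text \<open>Every element of the carrier is the image of an element of \<open>galg\<close>, so the
  axioms are inherited along \<open>to_ZSpin\<close>.\<close>

lemma ring_ZSpin: "ring (ZSpin n)"
proof (rule ringI)
  note hom = to_ZSpin_add[symmetric] to_ZSpin_mult[symmetric] to_ZSpin_zero[symmetric]
    to_ZSpin_one[symmetric] supp_simps supp_mult supp_one
  show "abelian_group (ZSpin n)"
  proof (rule abelian_groupI)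
    fix x assume "x \<in> carrier (ZSpin n)"
    then obtain a where a: "x = to_ZSpin n a" "supp n a" by (auto simp: carrier_ZSpin)
    have "to_ZSpin n (- a) \<oplus>\<^bsub>ZSpin n\<^esub> x = \<zero>\<^bsub>ZSpin n\<^esub>" by (simp add: a hom)
    then show "\<exists>y\<in>carrier (ZSpin n). y \<oplus>\<^bsub>ZSpin n\<^esub> x = \<zero>\<^bsub>ZSpin n\<^esub>"
      using a(2) by (intro bexI[of _ "to_ZSpin n (- a)"]) (auto simp: hom)
  qed (auto simp: carrier_ZSpin hom add_ac intro!: imageI)
  show "Group.monoid (ZSpin n)"
    by (rule monoidI) (auto simp: carrier_ZSpin hom mult.assoc intro!: imageI)
qed (auto simp: carrier_ZSpin to_ZSpin_add[symmetric] to_ZSpin_mult[symmetric] supp_simps supp_mult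
    distrib_left distrib_right)

lemma set_sum_gel:
  assumes "U \<subseteq> Spin n"
  shows "set_sum (spin_elt n ` U) = to_ZSpin n (\<Sum>u\<in>U. gel u)"
proof (rule ZSpin_eqI)
  have fin: "finite U" using assms finite_Spin by (rule finite_subset)
  fix u assume u: "u \<in> Spin n"
  have "spin_elt n u \<in> spin_elt n ` U \<longleftrightarrow> u \<in> U"
    using inj_on_image_mem_iff[OF inj_spin_elt u assms] .
  then show "set_sum (spin_elt n ` U) (spin_elt n u) = to_ZSpin n (\<Sum>u\<in>U. gel u) (spin_elt n u)"
    using u fin by (simp add: set_sum_def co_gel)
next
  fix A assume "A \<notin> carrier (spin_group n)"
  then show "set_sum (spin_elt n ` U) A = to_ZSpin n (\<Sum>u\<in>U. gel u) A"
    using assms by (auto simp: set_sum_def to_ZSpin_outside carrier_spin_group)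
qed

subsection \<open>The spin group algebra\<close>

lemma co_gz_mult: "co (gz * a) u = co a (- u)"
  by (simp add: gz_def co_gel_mult[of _ "- 1"])

lemma supp_gz: "supp n gz"
  unfolding gz_def by (intro supp_simps Spin.intros)

lemma spin_ideal_generator:
  "set_sum {spin_class n zw} \<oplus>\<^bsub>ZSpin n\<^esub> \<one>\<^bsub>ZSpin n\<^esub> = to_ZSpin n (gz + 1)"
proof -
  have "zw \<in> spin_words n" by simp
  then have "{spin_class n zw} = spin_elt n ` {- 1}" by (simp add: spin_class_eq)
  then show ?thesis
    using set_sum_gel[of "{- 1}" n] by (simp add: to_ZSpin_add to_ZSpin_one gz_def Spin.one)
qed

lemma spin_ideal_eq_Idl: "spin_ideal n = Idl\<^bsub>ZSpin n\<^esub> {to_ZSpin n (gz + 1)}"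
  by (simp add: spin_ideal_def Let_def spin_ideal_generator)

lemma ideal_spin_ideal: "ideal (spin_ideal n) (ZSpin n)"
  unfolding spin_ideal_eq_Idl
  by (rule ring.genideal_ideal[OF ring_ZSpin]) (simp add: supp_simps supp_gz supp_one)

lemma gz_fixed_eq_mult:
  assumes "supp n a" "gz * a = a"
  obtains h where "supp n h" "a = h * (gz + 1)"
proof -
  \<comment> \<open>The choice depends only on the pair \<open>{u, - u}\<close>, so \<open>T\<close>
    contains exactly one of the two for every \<open>u\<close> in \<open>Spin n\<close>. The
    restriction of \<open>a\<close> to \<open>T\<close>, multiplied by \<open>gz + 1\<close>, then
    restores the symmetric element \<open>a\<close>.\<close>
  define T :: "lin_op set" where "T = {u. u = (SOME x. x = u \<or> x = - u)}"
  have T: "(u \<in> T) \<noteq> (- u \<in> T)" if "u \<in> Spin n" for u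
  proof -
    have "(\<lambda>x. x = - u \<or> x = - (- u)) = (\<lambda>x. x = u \<or> x = - u)" by (simp add: disj_commute)
    then have "(SOME x. x = - u \<or> x = - (- u)) = (SOME x. x = u \<or> x = - u)" by simp
    moreover have "(SOME x. x = u \<or> x = - u) = u \<or> (SOME x. x = u \<or> x = - u) = - u"
      by (rule someI[of _ u]) simp
    ultimately show ?thesis using Spin_neq_uminus[OF that] unfolding T_def mem_Collect_eq by metis
  qed
  define h where "h = (\<Sum>u\<in>Spin n \<inter> T. Poly_Mapping.single (Mop u) (co a u))"
  have h: "co h u = (if u \<in> Spin n \<inter> T then co a u else 0)" for u
    by (simp add: h_def co_single finite_Spin)
  have "supp n h" by (simp add: supp_def h)
  moreover have "a = h * (gz + 1)"
  proof (rule galg_eqI)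
    fix u
    have e: "co (h * (gz + 1)) u = co h (- u) + co h u"
      by (simp add: distrib_left gz_central co_gz_mult)
    have "co a (- u) = co a u" using assms(2) co_gz_mult[of a u] by simp
    moreover have "co a u = 0" if "u \<notin> Spin n" using assms(1) that by (auto simp: supp_def)
    ultimately show "co a u = co (h * (gz + 1)) u" unfolding e h using T[of u] by auto
  qed
  ultimately show ?thesis using that by blast
qed

text \<open>The elements fixed by \<open>gz\<close> form an ideal, which contains the generator
  because \<open>gz * gz = 1\<close>; conversely they are multiples of the generator. Membership
  thus becomes a condition on coefficients.\<close>

lemma mem_spin_ideal_iff:
  assumes "supp n a"
  shows "to_ZSpin n a \<in> spin_ideal n \<longleftrightarrow> gz * a = a"
proof
  interpret I: ideal "spin_ideal n" "ZSpin n" by (rule ideal_spin_ideal)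
  assume "gz * a = a"
  then obtain h where h: "supp n h" "a = h * (gz + 1)" using gz_fixed_eq_mult[OF assms] by blast
  have s: "supp n (gz + 1)" by (intro supp_simps supp_gz supp_one)
  have "to_ZSpin n (gz + 1) \<in> spin_ideal n"
    unfolding spin_ideal_eq_Idl by (rule I.genideal_self') (simp add: s)
  then show "to_ZSpin n a \<in> spin_ideal n"
    unfolding h(2) to_ZSpin_mult[OF h(1) s] using h(1) by (intro I.I_l_closed) auto
next
  let ?J = "to_ZSpin n ` {b. supp n b \<and> gz * b = b}"
  note hom = to_ZSpin_add[symmetric] to_ZSpin_mult[symmetric] to_ZSpin_zero[symmetric]
  have "ideal ?J (ZSpin n)"
  proof (rule idealI[OF ring_ZSpin])
    interpret R: ring "ZSpin n" by (rule ring_ZSpin)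
    show "subgroup ?J (add_monoid (ZSpin n))"
    proof (rule R.add.subgroupI)
      show "?J \<subseteq> carrier (ZSpin n)" by (auto simp: carrier_ZSpin)
      show "?J \<noteq> {}" using supp_simps(1) by (auto intro!: exI[of _ 0])
    next
      fix x assume "x \<in> ?J"
      then obtain b where b: "x = to_ZSpin n b" "supp n b" "gz * b = b" by auto
      have "\<ominus>\<^bsub>ZSpin n\<^esub> x = to_ZSpin n (- b)"
        using b by (intro R.minus_equality) (auto simp: hom supp_simps)
      then show "\<ominus>\<^bsub>ZSpin n\<^esub> x \<in> ?J" using b by (auto intro!: imageI simp: supp_simps)
    next
      fix x y assume "x \<in> ?J" "y \<in> ?J"
      then show "x \<oplus>\<^bsub>ZSpin n\<^esub> y \<in> ?J"
        by (auto simp: hom supp_simps distrib_left intro!: imageI)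
    qed
  next
    fix x y assume "x \<in> ?J" "y \<in> carrier (ZSpin n)"
    then obtain b c where b: "x = to_ZSpin n b" "supp n b" "gz * b = b" and c: "y = to_ZSpin n c" "supp n c"
      by (auto simp: carrier_ZSpin)
    have "gz * (c * b) = c * b" using gz_left_commute[of c b] b(3) by simp
    then show "y \<otimes>\<^bsub>ZSpin n\<^esub> x \<in> ?J" using b c by (auto simp: hom supp_mult intro!: imageI)
    have "gz * (b * c) = b * c" using b(3) by (simp flip: mult.assoc)
    then show "x \<otimes>\<^bsub>ZSpin n\<^esub> y \<in> ?J" using b c by (auto simp: hom supp_mult intro!: imageI)
  qed
  moreover have "to_ZSpin n (gz + 1) \<in> ?J"
    by (intro imageI) (simp add: supp_simps supp_gz supp_one distrib_left add.commute)
  ultimately have "spin_ideal n \<subseteq> ?J"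
    unfolding spin_ideal_eq_Idl by (intro ring.genideal_minimal[OF ring_ZSpin]) auto
  moreover assume "to_ZSpin n a \<in> spin_ideal n"
  ultimately obtain b where b: "to_ZSpin n a = to_ZSpin n b" "supp n b" "gz * b = b" by blast
  have "a = b"
  proof (rule galg_eqI)
    fix u show "co a u = co b u"
      using assms b(2) to_ZSpin_elt[of u n a] to_ZSpin_elt[of u n b] b(1)
      by (cases "u \<in> Spin n") (auto simp: supp_def)
  qed
  then show "gz * a = a" using b(3) by simp
qed

definition to_spin :: "nat \<Rightarrow> galg \<Rightarrow> (spin_gen gword set \<Rightarrow> int) set" where
  "to_spin n a = spin_proj n (to_ZSpin n a)"

lemma ring_spin_algebra: "ring (spin_algebra n)"
  unfolding spin_algebra_def by (rule ideal.quotient_is_ring[OF ideal_spin_ideal])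

lemma spin_proj_hom: "spin_proj n \<in> ring_hom (ZSpin n) (spin_algebra n)"
  using ideal.rcos_ring_hom[OF ideal_spin_ideal] unfolding spin_algebra_def spin_proj_def by simp

lemma to_spin_carrier [simp]: "supp n a \<Longrightarrow> to_spin n a \<in> carrier (spin_algebra n)"
  unfolding to_spin_def by (intro ring_hom_closed[OF spin_proj_hom] to_ZSpin_carrier)

lemma to_spin_add:
  "supp n a \<Longrightarrow> supp n b \<Longrightarrow> to_spin n (a + b) = to_spin n a \<oplus>\<^bsub>spin_algebra n\<^esub> to_spin n b"
  unfolding to_spin_def to_ZSpin_add by (intro ring_hom_add[OF spin_proj_hom] to_ZSpin_carrier)

lemma to_spin_mult:
  "supp n a \<Longrightarrow> supp n b \<Longrightarrow> to_spin n (a * b) = to_spin n a \<otimes>\<^bsub>spin_algebra n\<^esub> to_spin n b"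
  unfolding to_spin_def
  by (simp only: to_ZSpin_mult) (intro ring_hom_mult[OF spin_proj_hom] to_ZSpin_carrier)

lemma to_spin_one: "to_spin n 1 = \<one>\<^bsub>spin_algebra n\<^esub>"
  unfolding to_spin_def to_ZSpin_one by (rule ring_hom_one[OF spin_proj_hom])

lemma to_spin_zero: "to_spin n 0 = \<zero>\<^bsub>spin_algebra n\<^esub>"
  unfolding to_spin_def to_ZSpin_zero
  by (rule ring_hom_zero[OF spin_proj_hom ring_ZSpin ring_spin_algebra])

lemma to_spin_eq_iff:
  assumes "supp n a" "supp n b"
  shows "to_spin n a = to_spin n b \<longleftrightarrow> (\<forall>u. co a u - co a (- u) = co b u - co b (- u))"
proof -
  interpret R: ring "ZSpin n" by (rule ring_ZSpin)
  have "to_spin n a = to_spin n b \<longleftrightarrow> to_ZSpin n a \<ominus>\<^bsub>ZSpin n\<^esub> to_ZSpin n b \<in> spin_ideal n"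
    unfolding to_spin_def spin_proj_def
    using R.quotient_eq_iff_same_a_r_cos[OF ideal_spin_ideal] assms by simp
  also have "\<ominus>\<^bsub>ZSpin n\<^esub> to_ZSpin n b = to_ZSpin n (- b)"
    using assms by (intro R.minus_equality)
      (auto simp: to_ZSpin_add[symmetric] to_ZSpin_zero[symmetric] supp_simps)
  then have "to_ZSpin n a \<ominus>\<^bsub>ZSpin n\<^esub> to_ZSpin n b = to_ZSpin n (a - b)"
    by (simp add: a_minus_def flip: to_ZSpin_add)
  also have "to_ZSpin n (a - b) \<in> spin_ideal n \<longleftrightarrow> gz * (a - b) = a - b"
    using assms by (intro mem_spin_ideal_iff supp_simps)
  also have "\<dots> \<longleftrightarrow> (\<forall>u. co a (- u) - co b (- u) = co a u - co b u)"
    using galg_eqI[of "gz * (a - b)" "a - b"] co_gz_mult[of "a - b"] by auto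
  finally show ?thesis by (auto simp: algebra_simps)
qed

lemma supp_sum: "(\<And>i. i \<in> I \<Longrightarrow> supp n (f i)) \<Longrightarrow> supp n (\<Sum>i\<in>I. f i)"
  by (induction I rule: infinite_finite_induct) (auto intro!: supp_simps)

lemma to_spin_sum:
  assumes "finite I" "\<And>i. i \<in> I \<Longrightarrow> supp n (f i)"
  shows "to_spin n (\<Sum>i\<in>I. f i) = finsum (spin_algebra n) (\<lambda>i. to_spin n (f i)) I"
proof -
  interpret R: ring "spin_algebra n" by (rule ring_spin_algebra)
  show ?thesis
    using assms
  proof induction
    case (insert i I)
    then have "to_spin n (\<Sum>i\<in>insert i I. f i) = to_spin n (f i) \<oplus>\<^bsub>spin_algebra n\<^esub> to_spin n (\<Sum>i\<in>I. f i)"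
      by (simp add: to_spin_add supp_sum)
    then show ?case using insert by (simp add: R.finsum_insert Pi_def)
  qed (simp add: to_spin_zero)
qed

lemma co_of_int_mult: "co (of_int k * a) u = k * co a u"
proof -
  have nat: "co (of_nat m * a) u = int m * co a u" for m
    by (induction m) (simp_all add: distrib_right)
  show ?thesis
    by (cases k rule: int_cases2) (simp_all add: nat)
qed

lemma supp_of_int_mult: "supp n a \<Longrightarrow> supp n (of_int k * a)"
  by (auto simp: supp_def co_of_int_mult)

lemma to_spin_of_int_mult:
  assumes "supp n a"
  shows "to_spin n (of_int k * a) = [k] \<cdot>\<^bsub>spin_algebra n\<^esub> to_spin n a"
proof -
  interpret R: ring "spin_algebra n" by (rule ring_spin_algebra)
  have nat: "to_spin n (of_nat m * a) = [m] \<cdot>\<^bsub>spin_algebra n\<^esub> to_spin n a" for m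
  proof (induction m)
    case (Suc m)
    have "supp n (of_nat m * a)" using supp_of_int_mult[OF assms, of "int m"] by simp
    then show ?case using assms Suc
      by (simp add: distrib_right to_spin_add R.a_comm)
  qed (simp add: to_spin_zero)
  show ?thesis
  proof (cases "k \<ge> 0")
    case True
    then show ?thesis using nat[of "nat k"] by (simp add: add_pow_int_ge)
  next
    case False
    let ?b = "of_nat (nat (- k)) * a"
    have b: "supp n ?b" using supp_of_int_mult[OF assms, of "- k"] False by simp
    have "of_int k * a = - ?b" using False by simp
    moreover have "to_spin n (- ?b) = \<ominus>\<^bsub>spin_algebra n\<^esub> to_spin n ?b"
      using b by (intro R.minus_equality[symmetric])
        (auto simp: supp_simps to_spin_zero[symmetric] simp flip: to_spin_add)
    ultimately show ?thesis using False nat[of "nat (- k)"] by (simp add: add_pow_int_lt)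
  qed
qed

lemma supp_JM: "k \<le> n \<Longrightarrow> supp n (JM k)"
  unfolding JM_def by (intro supp_sum supp_simps Spin_tr) auto

lemma supp_JM_elem: "m \<le> n \<Longrightarrow> supp n (JM_elem r m)"
  using JM_elem_support[of r m] Spin_mono[of m n] unfolding supp_def rank_le_def by blast

lemma odd_JM_eq:
  assumes "k \<le> n"
  shows "odd_JM n k = to_spin n (JM k)"
proof -
  have eq: "spin_proj n (set_sum {spin_cycle n [i, k]}) = to_spin n (gel (tr k i))" if "i \<in> {1..<k}" for i
  proof -
    have "tr k i \<in> Spin n" using that assms by (intro Spin_tr) auto
    moreover have "spin_cycle n [i, k] = spin_elt n (tr k i)"
      using spin_cycle_eq[of "[i, k]" n] that assms by simp
    ultimately show ?thesis using set_sum_gel[of "{tr k i}" n] by (simp add: to_spin_def)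
  qed
  interpret R: ring "spin_algebra n" by (rule ring_spin_algebra)
  have s: "supp n (gel (tr k i))" if "i \<in> {1..<k}" for i
    using that assms by (intro supp_simps Spin_tr) auto
  have "odd_JM n k = finsum (spin_algebra n) (\<lambda>i. to_spin n (gel (tr k i))) {1..<k}"
    unfolding odd_JM_def using s eq by (intro R.finsum_cong') auto
  then show ?thesis unfolding JM_def using s by (subst to_spin_sum) auto
qed

text \<open>The index sets are split according to whether they contain the maximum
  \<open>Suc n\<close>; a sorted list ends with it, so its factor stands on the right as in the
  recursion.\<close>

lemma JM_elem_eq_sum:
  "JM_elem r n = (\<Sum>I\<in>{I. I \<subseteq> {1..n} \<and> card I = r}. prod_list (map (\<lambda>i. (JM i)\<^sup>2) (sorted_list_of_set I)))"
proof (induction r n rule: JM_elem.induct)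
  case (1 n)
  have "{I. I \<subseteq> {1..n} \<and> card I = 0} = {{}}"
    by (auto dest: finite_subset[OF _ finite_atLeastAtMost])
  then show ?case by simp
next
  case (2 r)
  have "{I. I \<subseteq> {1..0 :: nat} \<and> card I = Suc r} = {}" by auto
  then show ?case by (simp only: JM_elem.simps sum.empty)
next
  case (3 r n)
  let ?S = "\<lambda>r n. {I. I \<subseteq> {1..n} \<and> card I = r}"
  let ?f = "\<lambda>I. prod_list (map (\<lambda>i. (JM i)\<^sup>2) (sorted_list_of_set I))"
  have fin: "finite (?S r n)" for r n :: nat by (rule finite_subset[of _ "Pow {1..n}"]) auto
  have I: "finite I" "Suc n \<notin> I" if "I \<subseteq> {1..n}" for I
    using that finite_subset[of I "{1..n}"] by auto
  have S: "?S (Suc r) (Suc n) = ?S (Suc r) n \<union> insert (Suc n) ` ?S r n"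
  proof (rule equalityI; rule subsetI)
    fix I assume A: "I \<in> ?S (Suc r) (Suc n)"
    show "I \<in> ?S (Suc r) n \<union> insert (Suc n) ` ?S r n"
    proof (cases "Suc n \<in> I")
      case True
      have "I - {Suc n} \<in> ?S r n" using A True by (auto simp: card_Diff_singleton)
      moreover have "I = insert (Suc n) (I - {Suc n})" using True by auto
      ultimately show ?thesis by blast
    next
      case False
      then have "I \<subseteq> {1..n}" using A by (auto simp: le_Suc_eq)
      then show ?thesis using A by simp
    qed
  next
    fix I assume "I \<in> ?S (Suc r) n \<union> insert (Suc n) ` ?S r n"
    then show "I \<in> ?S (Suc r) (Suc n)" using I by fastforce
  qed
  have inj: "inj_on (insert (Suc n)) (?S r n)"
    by (rule inj_onI) (metis (no_types, lifting) I(2) insert_ident mem_Collect_eq)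
  have f: "?f (insert (Suc n) J) = ?f J * (JM (Suc n))\<^sup>2" if "J \<subseteq> {1..n}" for J
  proof -
    have "sorted_list_of_set (insert (Suc n) J) = insort (Suc n) (sorted_list_of_set J)"
      using I[OF that] by simp
    also have "\<dots> = sorted_list_of_set J @ [Suc n]"
      using that I[OF that] by (intro sorted_insort_is_snoc) auto
    finally show ?thesis by simp
  qed
  have "sum ?f (?S (Suc r) (Suc n)) = sum ?f (?S (Suc r) n) + sum ?f (insert (Suc n) ` ?S r n)"
    unfolding S by (rule sum.union_disjoint) (use fin I(2) in auto)
  also have "sum ?f (insert (Suc n) ` ?S r n) = (\<Sum>J\<in>?S r n. ?f J * (JM (Suc n))\<^sup>2)"
    unfolding sum.reindex[OF inj] comp_def by (intro sum.cong HOL.refl f) simp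
  also have "\<dots> = JM_elem r n * (JM (Suc n))\<^sup>2" by (simp only: sum_distrib_right[symmetric] 3)
  finally show ?case using 3(1) by simp
qed

lemma elem_sym_JM_eq: "elem_sym_JM r n = to_spin n (JM_elem r n)"
proof -
  interpret R: ring "spin_algebra n" by (rule ring_spin_algebra)
  let ?S = "{I. I \<subseteq> {1..n} \<and> card I = r}"
  let ?f = "\<lambda>xs. prod_list (map (\<lambda>i. (JM i)\<^sup>2) xs)"
  let ?g = "\<lambda>xs. foldr (monoid.mult (spin_algebra n))
      (map (\<lambda>i. odd_JM n i [^]\<^bsub>spin_algebra n\<^esub> (2::nat)) xs) \<one>\<^bsub>spin_algebra n\<^esub>"
  have *: "supp n (?f xs) \<and> ?g xs = to_spin n (?f xs)" if "set xs \<subseteq> {1..n}" for xs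
    using that
  proof (induction xs)
    case Nil
    show ?case by (simp add: supp_one to_spin_one)
  next
    case (Cons i xs)
    then have s: "supp n (JM i)" "supp n (?f xs)" by (auto intro: supp_JM)
    have "odd_JM n i [^]\<^bsub>spin_algebra n\<^esub> (2::nat) = to_spin n ((JM i)\<^sup>2)"
      using Cons.prems s by (simp add: odd_JM_eq numeral_2_eq_2 to_spin_mult R.nat_pow_Suc)
    moreover have "supp n ((JM i)\<^sup>2)" using s by (simp add: power2_eq_square supp_mult)
    ultimately show ?case using Cons s by (simp add: to_spin_mult supp_mult)
  qed
  have fin: "finite ?S" by (rule finite_subset[of _ "Pow {1..n}"]) auto
  have set: "set (sorted_list_of_set I) \<subseteq> {1..n}" if "I \<in> ?S" for I
    using that finite_subset[of I "{1..n}"] by auto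
  have "elem_sym_JM r n = finsum (spin_algebra n) (\<lambda>I. to_spin n (?f (sorted_list_of_set I))) ?S"
    unfolding elem_sym_JM_def using *[OF set] by (intro R.finsum_cong') auto
  also have "\<dots> = to_spin n (JM_elem r n)"
    unfolding JM_elem_eq_sum using *[OF set] fin by (intro to_spin_sum[symmetric]) auto
  finally show ?thesis .
qed

section \<open>The classes as a basis\<close>

lemma EP_upto_D: "p \<in> EP_upto n \<Longrightarrow> p \<in> EP" "p \<in> EP_upto n \<Longrightarrow> sum_list p + length p \<le> n"
  by (simp_all add: EP_upto_def)

lemma EP_odd_cycles:
  assumes "p \<in> EP" "map length cs = map Suc p" "disj_cycles n cs"
  shows "odd_cycles n cs"
  unfolding odd_cycles_def
proof (intro conjI ballI)
  fix c assume "c \<in> set cs"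
  then have "length c \<in> set (map Suc p)" unfolding assms(2)[symmetric] by simp
  then obtain k where "k \<in> set p" "length c = Suc k" by auto
  moreover from this have "even k" "k \<noteq> 0"
    using assms(1) unfolding EP_def partition_def mem_Collect_eq by metis+
  ultimately show "odd (length c)" "2 \<le> length c" by auto
qed (fact assms(3))

lemma finite_EP_upto: "finite (EP_upto n)"
proof (rule finite_subset)
  show "EP_upto n \<subseteq> {p. set p \<subseteq> {..n} \<and> length p \<le> n}"
    using member_le_sum_list by (fastforce simp: EP_upto_def)
qed (rule finite_lists_length_le, simp)

lemma D_ops_nonempty:
  assumes "sum_list p + length p \<le> n"
  shows "D_ops p n \<noteq> {}"
proof -
  \<comment> \<open>Consecutive blocks of integers serve as cycles; the offset \<open>m\<close> is
    generalised so that the induction can continue behind the first block.\<close>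
  have "\<exists>cs. map length cs = map Suc p \<and> distinct (concat cs) \<and>
      set (concat cs) \<subseteq> {m<..m + sum_list p + length p}" for m
  proof (induction p arbitrary: m)
    case Nil
    show ?case by (intro exI[of _ "[]"]) simp
  next
    case (Cons k p)
    obtain cs where cs: "map length cs = map Suc p" "distinct (concat cs)"
      "set (concat cs) \<subseteq> {m + Suc k<..m + Suc k + sum_list p + length p}"
      using Cons[of "m + Suc k"] by auto
    let ?c = "[Suc m..<Suc m + Suc k]"
    have "set ?c \<inter> set (concat cs) = {}" using cs(3) by (auto simp: subset_iff)
    then have "distinct (concat (?c # cs))" using cs(2) by (simp del: upt_Suc)
    moreover have "set (concat (?c # cs)) \<subseteq> {m<..m + sum_list (k # p) + length (k # p)}"
      using cs(3) by (auto simp: subset_iff simp del: upt_Suc)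
    moreover have "map length (?c # cs) = map Suc (k # p)" using cs(1) by (simp del: upt_Suc)
    ultimately show ?case by blast
  qed
  from this[of 0] obtain cs where "map length cs = map Suc p" "distinct (concat cs)"
    "set (concat cs) \<subseteq> {0<..sum_list p + length p}" by auto
  moreover have "{0<..sum_list p + length p} \<subseteq> {1..n}" using assms by auto
  ultimately have "cycs cs \<in> D_ops p n" unfolding D_ops_def disj_cycles_def by blast
  then show ?thesis by blast
qed

lemma EP_eqI:
  assumes "p \<in> EP" "q \<in> EP" "mset p = mset q"
  shows "p = q"
proof -
  have "sorted (rev p)" "sorted (rev q)" using assms by (auto simp: EP_def partition_def sorted_wrt_rev)
  moreover have "mset (rev p) = mset (rev q)" using assms(3) by simp
  ultimately have "rev p = rev q" by (metis properties_for_sort)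
  then show ?thesis by simp
qed

text \<open>Operators equal up to sign lie over the same permutation, and the uniqueness of odd
  cycle products then fixes both the cycle type and the sign.\<close>

lemma D_ops_unique:
  assumes "p \<in> EP" "q \<in> EP" "u \<in> D_ops p n" "v \<in> D_ops q n" "v = u \<or> v = - u"
  shows "p = q \<and> u = v"
proof -
  obtain cs where cs: "u = cycs cs" "map length cs = map Suc p" "disj_cycles n cs"
    using assms(3) by (auto simp: D_ops_def)
  obtain ds where ds: "v = cycs ds" "map length ds = map Suc q" "disj_cycles n ds"
    using assms(4) by (auto simp: D_ops_def)
  have "lifts v (cycs_perm cs) ((- 1) ^ refl_len cs)"
    using lifts_cycs[OF cs(3)] assms(5) cs(1) lifts_uminus by auto
  moreover have "lifts v (cycs_perm ds) ((- 1) ^ refl_len ds)" using lifts_cycs[OF ds(3)] ds(1) by simp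
  moreover have "v \<in> Spin n" using cycs_Spin[OF ds(3)] ds(1) by simp
  ultimately have "cycs_perm cs = cycs_perm ds"
    using Spin_lifts_unique(1) neg_one_power_mem by blast
  then have "cycs cs = cycs ds" "mset (map length cs) = mset (map length ds)"
    using odd_cycles_unique EP_odd_cycles assms(1,2) cs(2,3) ds(2,3) by blast+
  moreover have "mset p = mset q"
    using \<open>mset (map length cs) = mset (map length ds)\<close> unfolding cs(2) ds(2) mset_map
    by (metis multiset.inj_map_strong nat.inject)
  ultimately show ?thesis using EP_eqI[OF assms(1,2)] cs(1) ds(1) by simp
qed

lemma uminus_D_ops:
  assumes "p \<in> EP" "q \<in> EP" "u \<in> D_ops p n"
  shows "- u \<notin> D_ops q n"
proof
  assume "- u \<in> D_ops q n"
  then have "u = - u" using D_ops_unique[OF assms] by blast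
  moreover have "u \<in> Spin n" using assms(3) D_ops_Spin by blast
  ultimately show False using Spin_neq_uminus by blast
qed

lemma co_diff_D_ops:
  assumes "p \<in> EP" "u \<in> D_ops p n" "v \<in> D_ops p n"
  shows "co_diff r n u = co_diff r n v"
proof -
  obtain cs where cs: "u = cycs cs" "map length cs = map Suc p" "disj_cycles n cs"
    using assms(2) by (auto simp: D_ops_def)
  obtain ds where ds: "v = cycs ds" "map length ds = map Suc p" "disj_cycles n ds"
    using assms(3) by (auto simp: D_ops_def)
  obtain g where g: "g \<in> Spin n" "g * u = v * g"
    using cycs_conjugate[of n cs ds] EP_odd_cycles[OF assms(1)] cs ds by auto
  then have "g * (- u) = (- v) * g" by simp
  then show ?thesis
    using co_JM_elem_conj[OF g] co_JM_elem_conj[OF g(1)] unfolding co_diff_def by metis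
qed

lemma odd_cycles_D_ops:
  assumes "odd_cycles n cs"
  obtains p where "p \<in> EP_upto n" "cycs cs \<in> D_ops p n"
proof -
  have disj: "disj_cycles n cs" and odd: "\<forall>c\<in>set cs. odd (length c)" "\<forall>c\<in>set cs. 2 \<le> length c"
    using assms by (auto simp: odd_cycles_def)
  \<comment> \<open>A partition lists its parts in decreasing order, so the cycles are sorted
    accordingly; odd cycles commute, hence the product is unchanged.\<close>
  define ds where "ds = rev (sort_key length cs)"
  define p where "p = map (\<lambda>c. length c - 1) ds"
  have m: "mset ds = mset cs" "set ds = set cs" by (simp_all add: ds_def)
  then have "cycs cs = cycs ds" by (intro cycs_mset_eq[OF disj odd(1)]) simp
  have "mset (concat ds) = mset (concat cs)"
    unfolding mset_concat using m(1) by (metis mset_map sum_mset_sum_list)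
  then have dd: "disj_cycles n ds"
    using disj unfolding disj_cycles_def by (metis mset_eq_imp_distinct_iff mset_eq_setD)
  have len: "map length ds = map Suc p"
  proof -
    have "length c = Suc (length c - 1)" if "c \<in> set ds" for c using odd(2) m(2) that by fastforce
    then show ?thesis unfolding p_def map_map comp_def by (intro map_cong) auto
  qed
  have "sorted_wrt (\<ge>) (map length ds)"
    unfolding ds_def rev_map[symmetric] sorted_wrt_rev by (simp add: sorted_sort_key)
  then have "sorted_wrt (\<ge>) p" unfolding len by (simp add: sorted_wrt_map)
  moreover have "\<forall>k\<in>set p. even k \<and> k \<noteq> 0"
  proof
    fix k assume "k \<in> set p"
    then obtain c where "c \<in> set cs" "k = length c - 1" using m(2) by (auto simp: p_def)
    then have "odd (length c)" "2 \<le> length c" using odd by auto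
    then show "even k \<and> k \<noteq> 0" using \<open>k = length c - 1\<close> by auto
  qed
  ultimately have "p \<in> EP" by (auto simp: EP_def partition_def)
  moreover have "sum_list p + length p \<le> n"
  proof -
    have "sum_list p + length p = sum_list (map Suc p)" by (induction p) auto
    also have "\<dots> = length (concat ds)" unfolding len[symmetric] by (simp add: length_concat)
    also have "\<dots> = card (set (concat ds))" using dd unfolding disj_cycles_def by (metis distinct_card)
    also have "\<dots> \<le> card {1..n}" using dd unfolding disj_cycles_def by (intro card_mono) auto
    finally show ?thesis by simp
  qed
  ultimately have "p \<in> EP_upto n" by (simp add: EP_upto_def)
  moreover have "cycs cs \<in> D_ops p n"
    unfolding \<open>cycs cs = cycs ds\<close> D_ops_def using len dd by blast
  ultimately show ?thesis using that by blast
qed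

section \<open>Class sums and coordinates in the quotient\<close>

definition D_gel :: "nat list \<Rightarrow> nat \<Rightarrow> galg" where
  "D_gel p n = (\<Sum>u\<in>D_ops p n. gel u)"

lemma finite_D_ops: "finite (D_ops p n)"
  using D_ops_Spin finite_Spin by (rule finite_subset)

lemma co_D_gel: "co (D_gel p n) u = (if u \<in> D_ops p n then 1 else 0)"
  by (simp add: D_gel_def co_gel finite_D_ops)

lemma supp_D_gel: "supp n (D_gel p n)"
  unfolding D_gel_def using D_ops_Spin by (intro supp_sum supp_simps) blast

lemma d_sum_eq: "d_sum p n = to_spin n (D_gel p n)"
  unfolding d_sum_def D_class_eq set_sum_gel[OF D_ops_Spin] to_spin_def D_gel_def ..

lemma finsum_d_sum:
  "finsum (spin_algebra n) (\<lambda>p. [c p] \<cdot>\<^bsub>spin_algebra n\<^esub> d_sum p n) (EP_upto n) =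
     to_spin n (\<Sum>p\<in>EP_upto n. of_int (c p) * D_gel p n)"
proof -
  interpret R: ring "spin_algebra n" by (rule ring_spin_algebra)
  have "to_spin n (of_int (c p) * D_gel p n) = [c p] \<cdot>\<^bsub>spin_algebra n\<^esub> d_sum p n" for p
    by (simp add: to_spin_of_int_mult supp_D_gel d_sum_eq)
  then show ?thesis
    by (subst to_spin_sum) (auto intro: finite_EP_upto supp_of_int_mult supp_D_gel)
qed

text \<open>The classes and their negatives are pairwise disjoint, so a single term survives. This
  yields the uniqueness of coordinates in the quotient.\<close>

lemma sum_D_gel_at:
  fixes c :: "nat list \<Rightarrow> int"
  assumes "q \<in> EP_upto n" "u \<in> D_ops q n"
  defines "a \<equiv> \<Sum>p\<in>EP_upto n. of_int (c p) * D_gel p n"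
  shows "co a u - co a (- u) = c q"
proof -
  have "c p * co (D_gel p n) u - c p * co (D_gel p n) (- u) = (if p = q then c q else 0)"
    if "p \<in> EP_upto n" for p
  proof -
    have "- u \<notin> D_ops p n"
      using uminus_D_ops[OF EP_upto_D(1)[OF assms(1)] EP_upto_D(1)[OF that] assms(2)] .
    moreover have "u \<in> D_ops p n \<longleftrightarrow> p = q"
      using D_ops_unique[OF EP_upto_D(1)[OF that] EP_upto_D(1)[OF assms(1)] _ assms(2)] assms(2)
      by blast
    ultimately show ?thesis by (simp add: co_D_gel)
  qed
  then have "(\<Sum>p\<in>EP_upto n. c p * co (D_gel p n) u - c p * co (D_gel p n) (- u)) =
      (\<Sum>p\<in>EP_upto n. if p = q then c q else 0)"
    by (intro sum.cong) auto
  then show ?thesis using assms(1) by (simp add: a_def co_of_int_mult sum_subtractf finite_EP_upto)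
qed

lemma sum_D_gel_outside:
  fixes c :: "nat list \<Rightarrow> int"
  assumes "\<And>p. p \<in> EP_upto n \<Longrightarrow> u \<notin> D_ops p n \<and> - u \<notin> D_ops p n"
  defines "a \<equiv> \<Sum>p\<in>EP_upto n. of_int (c p) * D_gel p n"
  shows "co a u - co a (- u) = 0"
proof -
  have "co (D_gel p n) u = 0" "co (D_gel p n) (- u) = 0" if "p \<in> EP_upto n" for p
    using assms(1)[OF that] by (simp_all add: co_D_gel)
  then show ?thesis by (simp add: a_def co_of_int_mult)
qed

lemma d_coords_elem_sym_JM:
  assumes "p \<in> EP_upto n" "u \<in> D_ops p n"
  shows "d_coords n (elem_sym_JM r n) p = co_diff r n u"
proof -
  let ?a = "\<lambda>c. \<Sum>p\<in>EP_upto n. of_int (c p) * D_gel p n"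
  \<comment> \<open>The value may be taken at any element of the class because
    \<open>co_diff\<close> is constant there; the default \<open>0\<close> is the normalisation
    required by \<open>d_coords\<close>.\<close>
  define c where "c p = (if p \<in> EP_upto n then co_diff r n (SOME u. u \<in> D_ops p n) else 0)" for p
  have supp: "supp n (?a c)" for c by (intro supp_sum supp_of_int_mult supp_D_gel)
  have c: "c q = co_diff r n v" if "q \<in> EP_upto n" "v \<in> D_ops q n" for q v
  proof -
    have "(SOME u. u \<in> D_ops q n) \<in> D_ops q n" using that(2) by (rule someI)
    from co_diff_D_ops[OF EP_upto_D(1)[OF that(1)] this that(2)] show ?thesis
      using that(1) by (simp add: c_def)
  qed
  have eq: "elem_sym_JM r n = finsum (spin_algebra n) (\<lambda>p. [d p] \<cdot>\<^bsub>spin_algebra n\<^esub> d_sum p n) (EP_upto n)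
      \<longleftrightarrow> (\<forall>u. co_diff r n u = co (?a d) u - co (?a d) (- u))" for d :: "nat list \<Rightarrow> int"
    unfolding finsum_d_sum elem_sym_JM_eq co_diff_def
    by (rule to_spin_eq_iff[OF supp_JM_elem[OF order_refl] supp])
  have main: "co_diff r n v = co (?a c) v - co (?a c) (- v)" for v
  proof -
    \<comment> \<open>An operator lies in a class, in the negative of a class, or in neither; in the
      last case its \<open>co_diff\<close> vanishes, because a nonzero value forces an odd cycle
      product up to sign.\<close>
    consider q where "q \<in> EP_upto n" "v \<in> D_ops q n" | q where "q \<in> EP_upto n" "- v \<in> D_ops q n"
      | "\<And>q. q \<in> EP_upto n \<Longrightarrow> v \<notin> D_ops q n \<and> - v \<notin> D_ops q n" by metis
    then show ?thesis
    proof cases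
      case 1
      show ?thesis unfolding sum_D_gel_at[OF 1] by (rule c[OF 1, symmetric])
    next
      case 2
      have "co (?a c) (- v) - co (?a c) (- (- v)) = co_diff r n (- v)"
        unfolding sum_D_gel_at[OF 2] by (rule c[OF 2])
      then show ?thesis by simp
    next
      case 3
      have "co_diff r n v = 0"
      proof (rule ccontr)
        assume nz: "co_diff r n v \<noteq> 0"
        then have "v \<in> Spin n" using co_diff_not_Spin by blast
        then obtain cs where "odd_cycles n cs" "v = cycs cs \<or> v = - cycs cs"
          using co_JM_elem_cases[of v n r] nz by (auto simp: co_diff_def)
        moreover from this obtain q where "q \<in> EP_upto n" "cycs cs \<in> D_ops q n"
          using odd_cycles_D_ops by blast
        ultimately show False using 3[of q] by (metis minus_minus)
      qed
      moreover have "co (?a c) v - co (?a c) (- v) = 0" using 3 by (rule sum_D_gel_outside)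
      ultimately show ?thesis by (simp only:)
    qed
  qed
  have c1: "(\<forall>p. p \<notin> EP_upto n \<longrightarrow> c p = 0) \<and> elem_sym_JM r n =
      finsum (spin_algebra n) (\<lambda>p. [c p] \<cdot>\<^bsub>spin_algebra n\<^esub> d_sum p n) (EP_upto n)"
  proof
    show "\<forall>p. p \<notin> EP_upto n \<longrightarrow> c p = 0" by (simp add: c_def)
    show "elem_sym_JM r n =
      finsum (spin_algebra n) (\<lambda>p. [c p] \<cdot>\<^bsub>spin_algebra n\<^esub> d_sum p n) (EP_upto n)"
      unfolding eq by (rule allI) (rule main)
  qed
  have "d_coords n (elem_sym_JM r n) = c"
    unfolding d_coords_def
  proof (rule the_equality)
    show "(\<forall>p. p \<notin> EP_upto n \<longrightarrow> c p = 0) \<and> elem_sym_JM r n =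
      finsum (spin_algebra n) (\<lambda>p. [c p] \<cdot>\<^bsub>spin_algebra n\<^esub> d_sum p n) (EP_upto n)" by (rule c1)
  next
    fix d :: "nat list \<Rightarrow> int"
    assume d: "(\<forall>p. p \<notin> EP_upto n \<longrightarrow> d p = 0) \<and> elem_sym_JM r n =
      finsum (spin_algebra n) (\<lambda>p. [d p] \<cdot>\<^bsub>spin_algebra n\<^esub> d_sum p n) (EP_upto n)"
    show "d = c"
    proof
      fix q show "d q = c q"
      proof (cases "q \<in> EP_upto n")
        case True
        then obtain v where v: "v \<in> D_ops q n" using D_ops_nonempty EP_upto_D(2) by blast
        have "co_diff r n v = d q" using d sum_D_gel_at[OF True v, of d] unfolding eq by simp
        then show ?thesis using c[OF True v] by simp
      next
        case False
        then show ?thesis using d by (simp add: c_def)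
      qed
    qed
  qed
  then show ?thesis using c[OF assms] by simp
qed

lemma A_coeff_eq:
  assumes "p \<in> EP" "sum_list p + length p \<le> n"
  shows "A_coeff n p = (\<Prod>k\<leftarrow>p. - int (catalan (k div 2)))"
proof -
  have p: "p \<in> EP_upto n" using assms by (simp add: EP_upto_def)
  obtain cs where cs: "cycs cs \<in> D_ops p n" "map length cs = map Suc p" "disj_cycles n cs"
    using D_ops_nonempty[OF assms(2)] by (auto simp: D_ops_def)
  have "refl_len cs = sum_list (map (\<lambda>k. k - 1) (map length cs))" by (simp add: refl_len_def comp_def)
  also have "\<dots> = sum_list p" unfolding cs(2) by (simp add: comp_def)
  also have "\<dots> = 2 * (sum_list p div 2)"
  proof -
    have "even (sum_list p)" using assms(1) by (induction p) (auto simp: EP_def partition_def)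
    then show ?thesis by simp
  qed
  finally have deg: "refl_len cs = 2 * (sum_list p div 2)" .
  have "A_coeff n p = co_diff (sum_list p div 2) n (cycs cs)"
    unfolding A_coeff_def by (rule d_coords_elem_sym_JM[OF p cs(1)])
  also have "\<dots> = (\<Prod>c\<leftarrow>cs. cycle_weight c)"
    using EP_odd_cycles[OF assms(1) cs(2,3)] deg by (intro co_diff_top_degree cs) (auto simp: odd_cycles_def)
  also have "\<dots> = prod_list (map (\<lambda>l. - int (catalan ((l - 1) div 2))) (map length cs))"
    by (simp add: cycle_weight_def[abs_def] comp_def)
  also have "\<dots> = (\<Prod>k\<leftarrow>p. - int (catalan (k div 2)))" unfolding cs(2) by (simp add: comp_def)
  finally show ?thesis .
qed

theorem theorem4p5:
  shows "(\<forall>r n. 1 \<le> r \<longrightarrow> 2 * r + 1 \<le> n \<longrightarrow>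
            rat_of_int (A_coeff n [2 * r]) = - Cat (r + 1)) \<and>
         (\<forall>p n. p \<in> EP \<longrightarrow> sum_list p + length p \<le> n \<longrightarrow>
            A_coeff n p = (\<Prod>k\<leftarrow>p. A_coeff n [k]) \<and>
            rat_of_int (A_coeff n p) = (- 1) ^ length p * (\<Prod>k\<leftarrow>p. Cat (k div 2 + 1)))"
proof (intro conjI allI impI)
  fix r n :: nat assume "1 \<le> r" "2 * r + 1 \<le> n"
  then have "A_coeff n [2 * r] = - int (catalan r)"
    by (subst A_coeff_eq) (simp_all add: EP_def partition_def)
  then show "rat_of_int (A_coeff n [2 * r]) = - Cat (r + 1)"
    using of_nat_catalan[of r] by simp
next
  fix p :: "nat list" and n assume p: "p \<in> EP" "sum_list p + length p \<le> n"
  have "A_coeff n [k] = - int (catalan (k div 2))" if k: "k \<in> set p" for k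
  proof -
    \<comment> \<open>A single part needs no more points than the whole partition, so the same
      \<open>n\<close> is large enough for \<open>[k]\<close>.\<close>
    have "k \<le> sum_list p" using k by (rule member_le_sum_list) simp
    moreover have "1 \<le> length p" using k by (cases p) auto
    ultimately have "sum_list [k] + length [k] \<le> n" using p(2) by simp
    moreover have "k \<noteq> 0" "even k"
      using k p(1) unfolding EP_def partition_def mem_Collect_eq by metis+
    then have "[k] \<in> EP" by (simp add: EP_def partition_def)
    ultimately show ?thesis using A_coeff_eq[of "[k]" n] by simp
  qed
  then have "map (\<lambda>k. A_coeff n [k]) p = map (\<lambda>k. - int (catalan (k div 2))) p" by simp
  then show "A_coeff n p = (\<Prod>k\<leftarrow>p. A_coeff n [k])" using A_coeff_eq[OF p] by (simp only:)
  have "rat_of_int (\<Prod>k\<leftarrow>q. - int (catalan (k div 2))) =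
      (- 1) ^ length q * (\<Prod>k\<leftarrow>q. Cat (k div 2 + 1))" for q
    using of_nat_catalan by (induction q) simp_all
  then show "rat_of_int (A_coeff n p) = (- 1) ^ length p * (\<Prod>k\<leftarrow>p. Cat (k div 2 + 1))"
    using A_coeff_eq[OF p] by simp
qed

end
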